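(* Fix $k\in\mathbb{Q}^+$. Let $n\to\infty$ through positive integers with $kn\in\mathbb{Z}^+$, and for each such $n$ let $d=d(n)\in\{1,\dots,n\}$ satisfy $kd\in\mathbb{Z}^+$ and $kd\le n$. Let $Y$ and $Z$ be sets with $|Y|=n$ and $|Z|=kn$, let $G\sim G(k,n,d)$ be a random biregular bipartite directed graph on $(Y,Z)$, let $A\subseteq Y$ and $B\subseteq Z$ be (fixed) subsets of size $kd$, and let $H:=G[A,B]$ be the subgraph induced by $G$ on the vertex set $(A,B)$. Then: (i) with high probability no perfect matching exists in $H$ when $\frac{kd^2}{n}-\log(kd)\to-\infty$ or when $d$ is a constant; (ii) with high probability a perfect matching exists in $H$ when $\frac{kd^2}{n}-\log(kd)\to+\infty$.
   Context: Given $k\in\mathbb{Q}^+$ and positive integers $n,d$ with $kn,kd\in\mathbb{Z}^+$ and $1\le d\le n$, and sets $Y,Z$ with $|Y|=n$, $|Z|=kn$, let $\mathcal{G}(k,n,d)$ be the family of labelled bipartite directed (simple) graphs on vertex set $(Y,Z)$, all edges directed from $Y$ to $Z$, in which every $y\in Y$ has out-degree $kd$ and every $z\in Z$ has in-degree $d$. $G\sim G(k,n,d)$ means that $G$ is chosen uniformly at random from $\mathcal{G}(k,n,d)$. For sets $A,B$ of equal size, a perfect matching from $A$ to $B$ in a bipartite directed graph on $(A,B)$ is a collection of $|A|$ vertex-disjoint edges from $A$ to $B$. An event holds with high probability if its probability tends to $1$ as $n\to\infty$. *)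

theory Defs
  imports "HOL-Probability.Probability" "Graph_Theory.Graph_Theory"
begin

text \<open>
  The family of bipartite digraphs \<open>\<G>(k, n, d)\<close> on the vertex set \<open>(Y, Z)\<close>; the parameter \<open>n\<close> is
  \<open>card Y\<close>. The definition is meant for finite disjoint \<open>Y\<close> and \<open>Z\<close>. Arcs of
  \<^typ>\<open>'a pair_pre_digraph\<close> are ordered pairs of vertices, so there are no parallel arcs. The
  out-degree condition is an equation in \<^typ>\<open>rat\<close>, so it is unsatisfiable on a nonempty \<open>Y\<close> unless
  \<open>k * d\<close> is a natural number.
\<close>

definition biregular_digraphs ::
    "rat \<Rightarrow> 'a set \<Rightarrow> 'a set \<Rightarrow> nat \<Rightarrow> 'a pair_pre_digraph set" where
  "biregular_digraphs k Y Z d =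
     {G. pverts G = Y \<union> Z \<and> parcs G \<subseteq> Y \<times> Z \<and>
         (\<forall>y\<in>Y. of_nat (out_degree (with_proj G) y) = k * of_nat d) \<and>
         (\<forall>z\<in>Z. in_degree (with_proj G) z = d)}"

text \<open>
  The uniform distribution on that family. \<^const>\<open>pmf_of_set\<close> is uniform only on finite
  nonempty sets; the family is one when \<open>1 \<le> d \<le> n\<close>, \<open>card Y = n\<close>, \<open>card Z = k * n\<close>, \<open>k * d\<close> is an
  integer, \<open>k > 0\<close> and \<open>Y\<close>, \<open>Z\<close> are disjoint.
\<close>

definition random_biregular_digraph ::
    "rat \<Rightarrow> 'a set \<Rightarrow> 'a set \<Rightarrow> nat \<Rightarrow> 'a pair_pre_digraph pmf" where
  "random_biregular_digraph k Y Z d = pmf_of_set (biregular_digraphs k Y Z d)"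

definition perfect_matching ::
    "('a, 'b) pre_digraph \<Rightarrow> 'a set \<Rightarrow> 'a set \<Rightarrow> 'b set \<Rightarrow> bool" where
  "perfect_matching H A B M \<longleftrightarrow>
     M \<subseteq> arcs H \<and> finite M \<and> card M = card A \<and>
     (\<forall>e\<in>M. tail H e \<in> A \<and> head H e \<in> B) \<and>
     (\<forall>e\<in>M. \<forall>f\<in>M. e \<noteq> f \<longrightarrow> {tail H e, head H e} \<inter> {tail H f, head H f} = {})"

text \<open>\<open>n \<rightarrow> \<infinity>\<close> through those \<open>n\<close> for which \<open>k * n\<close> is an integer.\<close>

definition integral_at_top :: "rat \<Rightarrow> nat filter" where
  "integral_at_top k = inf at_top (principal {n. k * of_nat n \<in> \<int>})"

end

theory Submission
  imports Defs "HOL-Real_Asymp.Real_Asymp"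
begin

text \<open>
  Write \<open>m = k d\<close> and \<open>p = d / n\<close>, and let \<open>W(S, U)\<close> be the event that no edge joins \<open>S\<close> to \<open>U\<close>.
  Expose the columns of \<open>U\<close> one at a time. Transposing unexposed columns preserves \<open>W(S, U)\<close>, so the
  number \<open>X\<close> of neighbours in \<open>S\<close> of the next column has mean at least \<open>p |S|\<close>, exactly; and the
  switching that removes one prescribed edge bounds the conditional probability of a further edge by
  roughly \<open>p\<close>, which controls \<open>E X\<^sup>2\<close>. The second moment method applied to \<open>X\<close> then bounds the
  probability of \<open>W(S, U)\<close> from above, with no concentration estimate for codegrees.

  Below the threshold the expected number of vertices of \<open>A\<close> isolated in \<open>H\<close> tends to infinity, and the
  two-row case of this bound shows that isolation events are asymptotically uncorrelated. Above the
  threshold and for small \<open>p\<close>, a minimal violator \<open>S\<close> of Hall's condition has \<open>|S| - 1\<close> neighbours, each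
  joined to \<open>S\<close> at least twice; a union bound over such configurations tends to zero. For \<open>p\<close> bounded
  away from zero, switchings lose a constant factor, but moving incidences between columns shows that
  balanced column sums are the most frequent ones. Hence conditioning independent uniform rows on the
  column sums costs at most a factor \<open>(n + 1)\<close> to the power \<open>k n\<close>, which is negligible against the
  probability \<open>exp (- \<Omega>(n\<^sup>2))\<close> of an empty block of linear size.
\<close>

section \<open>Hall's theorem and minimal violators\<close>

text \<open>Part (ii) needs only \<open>L - ln m\<close> to tend to infinity, where
  \<open>L = p m\<close>, so the events that decide the threshold must be counted with no constant
  lost in the exponent. These are isolations of single vertices, and for one row the transposition
  argument is exact: its degree in the next column is 0 or 1. Violators with two or more vertices
  have a constant factor in the exponent to spare, which pays for the lossy second moment bound. The
  switching inequality bounds edge probabilities from above only, while emptiness of a block is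
  improbable because edges are likely. Hence exact symmetry supplies the mean of X, and switchings
  are confined to its correlations. A switching fails for a fraction of at most
  \<open>2 p + |S| / n + |U| / (k n)\<close> of the edges. Keeping this fraction small is what
  forces the separate treatment of the dense range. For constant d the quantity
  \<open>L - ln m\<close> stays bounded, so that case of (i) has its own argument: one fixed vertex
  of A is isolated with probability tending to 1.\<close>

lemma hall_matching:
  fixes E :: "('a \<times> 'b) set"
  assumes "finite A" and "\<And>a. a \<in> A \<Longrightarrow> finite (E `` {a})"
    and "\<And>S. S \<subseteq> A \<Longrightarrow> card S \<le> card (E `` S)"
  shows "\<exists>f. inj_on f A \<and> (\<forall>a\<in>A. (a, f a) \<in> E)"
  using assms
proof (induction "card A" arbitrary: A E rule: less_induct)
  case less
  have finI: "finite (E `` S)" if "S \<subseteq> A" for S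
  proof -
    have "E `` S = (\<Union>a\<in>S. E `` {a})" by auto
    moreover have "finite S" using that less.prems(1) by (rule finite_subset)
    moreover have "finite (E `` {a})" if "a \<in> S" for a
      using that \<open>S \<subseteq> A\<close> less.prems(2) by blast
    ultimately show ?thesis using finite_UN_I[of S "\<lambda>a. E `` {a}"] by simp
  qed
  show ?case
  proof (cases "A = {}")
    case True
    then show ?thesis by simp
  next
    case False
    show ?thesis
    \<comment> \<open>The dichotomy of Halmos and Vaughan. A proper tight set S splits the problem:
      Hall's condition survives on \<open>A - S\<close> after the neighbours of S are removed.
      Without one, every proper nonempty subset has slack at least one, so an arbitrary edge may be
      fixed and its end b discarded.\<close>
    proof (cases "\<exists>S. S \<subset> A \<and> S \<noteq> {} \<and> card (E `` S) = card S")
      case True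
      then obtain S where S: "S \<subset> A" "S \<noteq> {}" "card (E `` S) = card S" by blast
      have finS: "finite S" using S(1) less.prems(1) by (meson finite_subset psubset_imp_subset)
      have "card S < card A" using S(1) less.prems(1) by (simp add: psubset_card_mono)
      then obtain f where f: "inj_on f S" "\<forall>a\<in>S. (a, f a) \<in> E"
        using less.hyps[of S E, OF _ finS] less.prems(2,3) S(1) by (meson psubset_imp_subset subset_trans subsetD)
      define E' where "E' = {e \<in> E. snd e \<notin> E `` S}"
      have card': "card (A - S) < card A"
proof -
        have "card S > 0" using S(2) finS by (simp add: card_gt_0_iff)
        then show ?thesis using S(1) finS \<open>card S < card A\<close>
          by (simp add: card_Diff_subset psubset_imp_subset)
      qed
      have "\<exists>g. inj_on g (A - S) \<and> (\<forall>a\<in>A - S. (a, g a) \<in> E')"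
      proof (rule less.hyps[OF card'])
        show "finite (A - S)" using less.prems(1) by simp
        show "finite (E' `` {a})" if "a \<in> A - S" for a
          by (rule finite_subset[OF _ less.prems(2)[of a]]) (use that in \<open>auto simp: E'_def\<close>)
        show "card T \<le> card (E' `` T)" if T: "T \<subseteq> A - S" for T
        proof -
          have finT: "finite T" using T less.prems(1) by (meson Diff_subset finite_subset)
          have eq: "E `` (S \<union> T) = E `` S \<union> E' `` T" by (auto simp: E'_def Image_def)
          have "card S + card T = card (S \<union> T)"
            using T finS finT by (subst card_Un_disjoint) auto
          also have "\<dots> \<le> card (E `` (S \<union> T))" using less.prems(3)[of "S \<union> T"] T S(1) by blast
          also have "\<dots> \<le> card (E `` S) + card (E' `` T)" unfolding eq by (rule card_Un_le)
          finally show ?thesis using S(3) by simp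
        qed
      qed
      then obtain g where g: "inj_on g (A - S)" "\<forall>a\<in>A - S. (a, g a) \<in> E'" by blast
      define h where "h a = (if a \<in> S then f a else g a)" for a
      have neq: "f a \<noteq> g b" if "a \<in> S" "b \<in> A - S" for a b
        using bspec[OF f(2), of a] bspec[OF g(2), of b] that by (auto simp: E'_def)
      have "inj_on h A"
      proof (rule inj_onI)
        fix x y assume "x \<in> A" "y \<in> A" "h x = h y"
        then show "x = y"
          using neq[of x y] neq[of y x] inj_onD[OF f(1), of x y] inj_onD[OF g(1), of x y]
          by (auto simp: h_def split: if_splits)
      qed
      moreover have "\<forall>a\<in>A. (a, h a) \<in> E"
        using f(2) g(2) by (auto simp: h_def E'_def)
      ultimately show ?thesis by blast
    next
      case no: False
      obtain a where a: "a \<in> A" using False by blast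
      have "1 \<le> card (E `` {a})" using less.prems(3)[of "{a}"] a by simp
      then obtain b where b: "(a, b) \<in> E" by (metis Image_singleton_iff card.empty ex_in_conv not_one_le_zero)
      define E' where "E' = {e \<in> E. snd e \<noteq> b}"
      have card': "card (A - {a}) < card A" using a less.prems(1) by (meson card_Diff1_less)
      have "\<exists>g. inj_on g (A - {a}) \<and> (\<forall>x\<in>A - {a}. (x, g x) \<in> E')"
      proof (rule less.hyps[OF card'])
        show "finite (A - {a})" using less.prems(1) by simp
        show "finite (E' `` {x})" if "x \<in> A - {a}" for x
          by (rule finite_subset[OF _ less.prems(2)[of x]]) (use that in \<open>auto simp: E'_def\<close>)
        show "card T \<le> card (E' `` T)" if T: "T \<subseteq> A - {a}" for T
        proof (cases "T = {}")
          case True then show ?thesis by simp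
        next
          case F: False
          have "T \<subset> A" using T a by blast
          then have "card (E `` T) \<noteq> card T" using no F by blast
          moreover have "card T \<le> card (E `` T)" using less.prems(3)[of T] \<open>T \<subset> A\<close> by blast
          ultimately have "card T < card (E `` T)" by simp
          moreover have "E' `` T = E `` T - {b}" by (auto simp: E'_def Image_def)
          ultimately show ?thesis
            using finI[of T] T by (auto simp: card_Diff_singleton_if)
        qed
      qed
      then obtain g where g: "inj_on g (A - {a})" "\<forall>x\<in>A - {a}. (x, g x) \<in> E'" by blast
      have "inj_on (g(a := b)) A"
      proof (rule inj_onI)
        fix x y assume "x \<in> A" "y \<in> A" "(g(a := b)) x = (g(a := b)) y"
        moreover have "g x \<noteq> b" if "x \<in> A" "x \<noteq> a" for x using g(2) that by (auto simp: E'_def)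
        ultimately show "x = y"
          using inj_onD[OF g(1), of x y] by (auto split: if_splits)
      qed
      moreover have "\<forall>x\<in>A. (x, (g(a := b)) x) \<in> E" using g(2) b by (auto simp: E'_def)
      ultimately show ?thesis by blast
    qed
  qed
qed

text \<open>In a violator of least cardinality, deleting any element restores Hall's condition.
  Since cardinalities are integers, the deficiency is then exactly one and the deletion leaves the
  neighbourhood unchanged, so no neighbour hangs on a single element of S.\<close>

lemma minimal_hall_violator:
  fixes E :: "('a \<times> 'b) set"
  assumes "finite S0" and "finite (E `` S0)" and "card (E `` S0) < card S0"
  obtains S where "S \<subseteq> S0" "card S = Suc (card (E `` S))"
    "\<And>t. t \<in> E `` S \<Longrightarrow> \<exists>x y. x \<in> S \<and> y \<in> S \<and> x \<noteq> y \<and> (x, t) \<in> E \<and> (y, t) \<in> E"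
proof -
  let ?P = "\<lambda>S. S \<subseteq> S0 \<and> card (E `` S) < card S"
  obtain S where S: "?P S" and min: "\<And>T. ?P T \<Longrightarrow> card S \<le> card T"
    using ex_has_least_nat[of ?P S0 card] assms(3) by blast
  have finS: "finite S" using S assms(1) finite_subset by blast
  have finE: "finite (E `` S)" using S assms(2) by (meson Image_mono finite_subset order_refl)
  have del: "E `` (S - {x}) = E `` S \<and> card S = Suc (card (E `` S))" if x: "x \<in> S" for x
  proof -
    have lt: "card (S - {x}) < card S" using finS x by (meson card_Diff1_less)
    then have "card (S - {x}) \<le> card (E `` (S - {x}))"
      using min[of "S - {x}"] S by (meson Diff_subset not_le subset_trans)
    moreover have sub: "E `` (S - {x}) \<subseteq> E `` S" by blast
    moreover have "card (S - {x}) = card S - 1" using finS x by simp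
    moreover have "card (E `` (S - {x})) \<le> card (E `` S)" using sub finE by (rule card_mono[rotated])
    ultimately have "card (E `` (S - {x})) = card (E `` S)" "card S = Suc (card (E `` S))"
      using S by linarith+
    then show ?thesis using sub finE by (simp add: card_subset_eq)
  qed
  obtain x0 where "x0 \<in> S" using S by fastforce
  then have "card S = Suc (card (E `` S))" using del by blast
  moreover have "\<exists>x y. x \<in> S \<and> y \<in> S \<and> x \<noteq> y \<and> (x, t) \<in> E \<and> (y, t) \<in> E" if t: "t \<in> E `` S" for t
  proof -
    obtain x where x: "x \<in> S" "(x, t) \<in> E" using t by (elim ImageE)
    then have "t \<in> E `` (S - {x})" using del t by simp
    then obtain y where "y \<in> S - {x}" "(y, t) \<in> E" by (elim ImageE)
    then show ?thesis using x by blast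
  qed
  ultimately show ?thesis using that S by blast
qed

section \<open>Biregular relations and switchings\<close>

text \<open>With separate types for the two sides, the converse of a relation lies in a family of
  the same shape, and bounds proved for rows transfer to columns.\<close>

definition biregular_relations ::
    "'a set \<Rightarrow> 'b set \<Rightarrow> nat \<Rightarrow> nat \<Rightarrow> ('a \<times> 'b) set set" where
  "biregular_relations R C r c =
     {E. E \<subseteq> R \<times> C \<and> (\<forall>y\<in>R. card (E `` {y}) = r) \<and> (\<forall>z\<in>C. card (E\<inverse> `` {z}) = c)}"

definition avoiding ::
    "'a set \<Rightarrow> 'b set \<Rightarrow> nat \<Rightarrow> nat \<Rightarrow> 'a set \<Rightarrow> 'b set \<Rightarrow> ('a \<times> 'b) set set" where
  "avoiding R C r c S U = {E \<in> biregular_relations R C r c. E \<inter> S \<times> U = {}}"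

lemma finite_biregular_relations:
  assumes "finite R" "finite C"
  shows "finite (biregular_relations R C r c)"
  by (rule finite_subset[of _ "Pow (R \<times> C)"]) (use assms in \<open>auto simp: biregular_relations_def\<close>)

lemma finite_avoiding:
  assumes "finite R" "finite C"
  shows "finite (avoiding R C r c S U)"
  using finite_biregular_relations[OF assms] by (simp add: avoiding_def)

lemma avoiding_empty [simp]: "avoiding R C r c S {} = biregular_relations R C r c"
  "avoiding R C r c {} U = biregular_relations R C r c"
  by (auto simp: avoiding_def)

lemma avoiding_insert:
  "avoiding R C r c S (insert z U) = {E \<in> avoiding R C r c S U. E\<inverse> `` {z} \<inter> S = {}}"
  by (auto simp: avoiding_def)

lemma converse_mem_biregular_relations [simp]:
  "E\<inverse> \<in> biregular_relations C R c r \<longleftrightarrow> E \<in> biregular_relations R C r c"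
  by (auto simp: biregular_relations_def)

lemma converse_mem_avoiding [simp]:
  "E\<inverse> \<in> avoiding C R c r U S \<longleftrightarrow> E \<in> avoiding R C r c S U"
  by (auto simp: avoiding_def)

lemma card_converse_Collect:
  "card {E. P (E\<inverse>)} = card {E. P E}"
proof -
  have "{E. P (E\<inverse>)} = converse ` {E. P E}" by (auto simp: image_iff)
  then show ?thesis by (simp add: card_image inj_on_def)
qed

lemma card_biregular_relations_converse:
  "card (biregular_relations C R c r) = card (biregular_relations R C r c)"
  using card_converse_Collect[of "\<lambda>E. E \<in> biregular_relations R C r c"] by simp

lemma card_exchange:
  "finite T \<Longrightarrow> p \<in> T \<Longrightarrow> q \<notin> T \<Longrightarrow> card (T - {p} \<union> {q}) = card T"
  using card_gt_0_iff[of T] by (auto simp: Suc_pred simp del: One_nat_def)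

lemma swap_back:
  "p \<in> D \<Longrightarrow> q \<in> D \<Longrightarrow> a \<notin> D \<Longrightarrow> b \<notin> D \<Longrightarrow> D = (D - {p, q} \<union> {a, b}) - {a, b} \<union> {p, q}"
  by blast

locale biregular_degrees =
  fixes R :: "'a set" and C :: "'b set" and r c :: nat
  assumes finite_rows: "finite R" and finite_cols: "finite C"
    and degree_sum: "card R * r = card C * c"
begin

abbreviation "\<B> \<equiv> biregular_relations R C r c"
abbreviation "\<W> \<equiv> avoiding R C r c"

lemma finite_\<B>: "finite \<B>"
  by (rule finite_biregular_relations[OF finite_rows finite_cols])

lemma finite_\<W>: "finite (\<W> S U)"
  by (rule finite_avoiding[OF finite_rows finite_cols])

lemma finite_rel: "E \<in> \<B> \<Longrightarrow> finite E"
  using finite_rows finite_cols by (auto simp: biregular_relations_def intro: finite_subset)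

lemma card_rel: assumes "E \<in> \<B>" shows "card E = card R * r"
proof -
  have "E = Sigma R (\<lambda>y. E `` {y})" using assms by (auto simp: biregular_relations_def)
  then have "card E = (\<Sum>y\<in>R. card (E `` {y}))"
    using card_SigmaI[of R "\<lambda>y. E `` {y}"] finite_rows finite_rel[OF assms] by (simp add: finite_Image)
  also have "\<dots> = card R * r" using assms by (simp add: biregular_relations_def)
  finally show ?thesis .
qed

text \<open>Transposing two columns outside \<open>U\<close> preserves \<open>\<W> S U\<close>, so in it every
  pair \<open>(y, z)\<close> with \<open>z \<notin> U\<close> is equally likely to be an edge.\<close>

lemma card_avoiding_edge:
  assumes "y \<in> S" "S \<subseteq> R" "U \<subseteq> C" "z \<in> C - U"
  shows "(card C - card U) * card {E \<in> \<W> S U. (y, z) \<in> E} = r * card (\<W> S U)"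
proof -
  let ?N = "\<lambda>z. {E \<in> \<W> S U. (y, z) \<in> E}"
  have le: "card (?N z) \<le> card (?N z')" if zz: "z \<in> C - U" "z' \<in> C - U" for z z'
  proof -
    define \<tau> where "\<tau> b = (if b = z then z' else if b = z' then z else b)" for b
    have \<tau>2: "\<tau> (\<tau> b) = b" for b by (simp add: \<tau>_def)
    have inj: "inj \<tau>" by (metis \<tau>2 injI)
    define g where "g E = {(a, b). (a, \<tau> b) \<in> E}" for E :: "('a \<times> 'b) set"
    have gg: "g (g E) = E" for E by (auto simp: g_def \<tau>2)
    have \<tau>C: "\<tau> b \<in> C \<longleftrightarrow> b \<in> C" for b using zz by (auto simp: \<tau>_def)
    have \<tau>U: "b \<in> U \<Longrightarrow> \<tau> b = b" for b using zz by (auto simp: \<tau>_def)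
    have row: "card (g E `` {a}) = card (E `` {a})" for E a
    proof -
      have "g E `` {a} = \<tau> ` (E `` {a})"
      proof (intro equalityI subsetI)
        fix b assume "b \<in> g E `` {a}"
        then have "\<tau> b \<in> E `` {a}" by (simp add: g_def)
        then have "\<tau> (\<tau> b) \<in> \<tau> ` (E `` {a})" by (rule imageI)
        then show "b \<in> \<tau> ` (E `` {a})" by (simp only: \<tau>2)
      next
        fix b assume "b \<in> \<tau> ` (E `` {a})"
        then obtain x where "x \<in> E `` {a}" "b = \<tau> x" by (elim imageE)
        then show "b \<in> g E `` {a}" by (simp add: g_def \<tau>2)
      qed
      then show ?thesis using inj by (simp add: card_image inj_on_subset[of _ UNIV])
    qed
    have col: "(g E)\<inverse> `` {b} = E\<inverse> `` {\<tau> b}" for E b by (auto simp: g_def)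
    have "g E \<in> ?N z'" if EN: "E \<in> ?N z" for E
    proof -
      have ER: "E \<subseteq> R \<times> C" using EN by (simp add: avoiding_def biregular_relations_def)
      have "g E \<subseteq> R \<times> C"
      proof clarify
        fix a b assume "(a, b) \<in> g E"
        then have "(a, \<tau> b) \<in> R \<times> C" using ER by (auto simp: g_def)
        then show "a \<in> R \<and> b \<in> C" by (simp add: \<tau>C)
      qed
      moreover have "card ((g E)\<inverse> `` {b}) = c" if "b \<in> C" for b
        unfolding col using EN that \<tau>C by (simp add: avoiding_def biregular_relations_def)
      moreover have "g E \<inter> S \<times> U = {}"
        using EN \<tau>U by (auto simp: g_def avoiding_def)
      moreover have "(y, z') \<in> g E" using EN by (simp add: g_def \<tau>_def)
      ultimately show ?thesis
        using EN by (simp add: avoiding_def biregular_relations_def row)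
    qed
    then have "g ` ?N z \<subseteq> ?N z'" by blast
    moreover have "inj_on g (?N z)" by (rule inj_on_inverseI[where g = g]) (rule gg)
    ultimately show ?thesis using finite_\<W> by (simp add: card_inj_on_le)
  qed
  then have eq: "card (?N z') = card (?N z)" if "z' \<in> C - U" for z'
    using that assms(4) by (simp add: le_antisym)
  \<comment> \<open>Since y lies in S, all r edges of its row end in \<open>C - U\<close>. Counting
    them over all relations turns the equality of the \<open>?N z'\<close> into their exact common
    value.\<close>
  have "(\<Sum>z'\<in>C - U. card (?N z')) = (\<Sum>E\<in>\<W> S U. r)"
  proof (rule sum_multicount_gen)
    show "\<forall>E\<in>\<W> S U. card {z' \<in> C - U. (y, z') \<in> E} = r"
    proof
      fix E assume E: "E \<in> \<W> S U"
      then have "{z' \<in> C - U. (y, z') \<in> E} = E `` {y}"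
        using assms(1) by (auto simp: avoiding_def biregular_relations_def)
      then show "card {z' \<in> C - U. (y, z') \<in> E} = r"
        using E assms by (auto simp: avoiding_def biregular_relations_def)
    qed
  qed (use finite_cols finite_\<W> in auto)
  also have "(\<Sum>z'\<in>C - U. card (?N z')) = (\<Sum>z'\<in>C - U. card (?N z))" by (simp add: eq)
  finally show ?thesis
    using assms(3) finite_cols by (simp add: card_Diff_subset finite_subset mult.commute)
qed

lemma switch_mem:
  assumes E: "E \<in> \<B>" and e: "(y, z) \<in> E" "(y', w) \<in> E" "(y, w) \<notin> E" "(y', z) \<notin> E"
  shows "E - {(y, z), (y', w)} \<union> {(y, w), (y', z)} \<in> \<B>"
proof -
  let ?E = "E - {(y, z), (y', w)} \<union> {(y, w), (y', z)}"
  have sub: "E \<subseteq> R \<times> C" using E by (simp add: biregular_relations_def)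
  have ne: "y \<noteq> y'" "z \<noteq> w" using e by auto
  have "card (?E `` {v}) = r" if "v \<in> R" for v
  proof -
    have "?E `` {v} = (if v = y then E `` {y} - {z} \<union> {w} else if v = y' then E `` {y'} - {w} \<union> {z} else E `` {v})"
      using ne by auto
    moreover have "card (E `` {v}) = r" "finite (E `` {v})"
      using E that finite_rel[OF E] by (auto simp: biregular_relations_def)
    ultimately show ?thesis using e ne card_exchange[of "E `` {v}"] by auto
  qed
  moreover have "card (?E\<inverse> `` {v}) = c" if "v \<in> C" for v
  proof -
    have "?E\<inverse> `` {v} = (if v = z then E\<inverse> `` {z} - {y} \<union> {y'} else if v = w then E\<inverse> `` {w} - {y'} \<union> {y} else E\<inverse> `` {v})"
      using ne by auto
    moreover have "card (E\<inverse> `` {v}) = c" "finite (E\<inverse> `` {v})"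
      using E that finite_rel[OF E] by (auto simp: biregular_relations_def)
    ultimately show ?thesis using e ne card_exchange[of "E\<inverse> `` {v}"] by auto
  qed
  moreover have "?E \<subseteq> R \<times> C" using sub e by auto
  ultimately show ?thesis unfolding biregular_relations_def by blast
qed

text \<open>Double counting of the switchings that trade \<open>(y, z)\<close>,
  \<open>(y', w)\<close> for \<open>(y, w)\<close>, \<open>(y', z)\<close>. Before the switching
  most edges may serve as \<open>(y', w)\<close>; after it, \<open>y'\<close> is a neighbour of z
  and w a neighbour of y, so at most \<open>c * r\<close> switchings lead to a given result.\<close>

lemma card_switching:
  assumes F: "F \<subseteq> S \<times> (C - U)" and f: "(y, z) \<in> F" and SU: "S \<subseteq> R" "U \<subseteq> C"
  defines "WF \<equiv> {E \<in> \<W> S U. F \<subseteq> E}" and "WF' \<equiv> {E \<in> \<W> S U. F - {(y, z)} \<subseteq> E}"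
  shows "card WF * (card R * r) \<le> card WF' * (c * r) + card WF * (2 * c * r + card S * r + card U * c)"
proof -
  \<comment> \<open>The condition \<open>y' \<notin> S\<close> keeps the removed edge
    \<open>(y', w)\<close> out of F, and \<open>w \<notin> U\<close> keeps the new edge
    \<open>(y, w)\<close> out of \<open>S \<times> U\<close>. The other two say that the new edges
    are not yet present.\<close>
  define A where "A E = {(y', w). (y', w) \<in> E \<and> (y', z) \<notin> E \<and> y' \<notin> S \<and> (y, w) \<notin> E \<and> w \<notin> U}" for E
  have yz: "y \<in> S" "y \<in> R" "z \<in> C" "z \<notin> U" using F f SU by auto
  have finS: "finite S" "finite U" using SU finite_rows finite_cols finite_subset by auto
  have finW: "finite WF" "finite WF'" using finite_\<W> by (auto simp: WF_def WF'_def)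
  have WB: "E \<in> \<B>" if "E \<in> WF \<or> E \<in> WF'" for E using that by (auto simp: WF_def WF'_def avoiding_def)
  have deg: "card (E `` {a}) = r" if "E \<in> \<B>" "a \<in> R" for E a
    using that by (simp add: biregular_relations_def)
  have cdeg: "card (E\<inverse> `` {b}) = c" if "E \<in> \<B>" "b \<in> C" for E b
    using that by (simp add: biregular_relations_def)
  have lower: "card R * r \<le> card (A E) + (2 * c * r + card S * r + card U * c)" if EW: "E \<in> WF" for E
  proof -
    have E: "E \<in> \<B>" using WB EW by blast
    have sub: "E \<subseteq> R \<times> C" using E by (simp add: biregular_relations_def)
    have rows: "card (Sigma T (\<lambda>a. E `` {a})) = card T * r" if "T \<subseteq> R" for T
    proof -
      have "card (Sigma T (\<lambda>a. E `` {a})) = (\<Sum>a\<in>T. card (E `` {a}))"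
        using that finite_rows finite_rel[OF E] by (intro card_SigmaI) (auto intro: finite_subset)
      also have "\<dots> = (\<Sum>a\<in>T. r)" using that by (intro sum.cong refl deg[OF E]) blast
      finally show ?thesis by simp
    qed
    have cols: "card (Sigma T (\<lambda>b. E\<inverse> `` {b})) = card T * c" if "T \<subseteq> C" for T
    proof -
      have "card (Sigma T (\<lambda>b. E\<inverse> `` {b})) = (\<Sum>b\<in>T. card (E\<inverse> `` {b}))"
        using that finite_cols finite_rel[OF E] by (intro card_SigmaI) (auto intro: finite_subset)
      also have "\<dots> = (\<Sum>b\<in>T. c)" using that by (intro sum.cong refl cdeg[OF E]) blast
      finally show ?thesis by simp
    qed
    \<comment> \<open>The edges lost to the four conditions: row adjacent to z, row in S, column
      adjacent to y, column in U.\<close>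
    let ?X1 = "Sigma (E\<inverse> `` {z}) (\<lambda>a. E `` {a})" and ?X2 = "Sigma S (\<lambda>a. E `` {a})"
    let ?X3 = "prod.swap ` Sigma (E `` {y}) (\<lambda>b. E\<inverse> `` {b})" and ?X4 = "prod.swap ` Sigma U (\<lambda>b. E\<inverse> `` {b})"
    have cover: "E \<subseteq> A E \<union> (?X1 \<union> ?X2 \<union> (?X3 \<union> ?X4))"
      by (auto simp: A_def image_iff)
    have "finite (A E)" by (rule finite_subset[OF _ finite_rel[OF E]]) (auto simp: A_def)
    have finX: "finite ?X1" "finite ?X2" "finite ?X3" "finite ?X4"
      using finite_rel[OF E] finS by auto
    have "card R * r = card E" using card_rel[OF E] by simp
    also have "\<dots> \<le> card (A E \<union> (?X1 \<union> ?X2 \<union> (?X3 \<union> ?X4)))"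
      using cover finX \<open>finite (A E)\<close> by (intro card_mono) auto
    also have "\<dots> \<le> card (A E) + ((card ?X1 + card ?X2) + (card ?X3 + card ?X4))"
      by (intro order_trans[OF card_Un_le] add_mono order_refl)
    also have "card ?X1 = c * r" using sub cdeg[OF E yz(3)] rows[of "E\<inverse> `` {z}"] by auto
    also have "card ?X2 = card S * r" using rows[OF SU(1)] .
    also have "card ?X3 = r * c"
      using sub deg[OF E yz(2)] cols[of "E `` {y}"] by (auto simp: card_image)
    also have "card ?X4 = card U * c" using cols[OF SU(2)] by (simp add: card_image)
    finally show ?thesis by (simp add: algebra_simps)
  qed
  \<comment> \<open>Recording \<open>(y', w)\<close> beside the new relation makes the switching
    reversible.\<close>
  define \<phi> where "\<phi> = (\<lambda>(E, (y', w)). (E - {(y, z), (y', w)} \<union> {(y, w), (y', z)}, (y', w)))"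
  let ?Q = "Sigma WF' (\<lambda>E. (E\<inverse> `` {z}) \<times> (E `` {y}))"
  have "inj_on \<phi> (Sigma WF A)"
  proof (rule inj_onI)
    fix p q assume p: "p \<in> Sigma WF A" and q: "q \<in> Sigma WF A" and eq: "\<phi> p = \<phi> q"
    obtain E y' w where pe: "p = (E, (y', w))" by (metis surj_pair)
    obtain E2 y2 w2 where qe: "q = (E2, (y2, w2))" by (metis surj_pair)
    have same: "y2 = y'" "w2 = w" using eq by (auto simp: pe qe \<phi>_def)
    have rec: "D = (D - {(y, z), (y', w)} \<union> {(y, w), (y', z)}) - {(y, w), (y', z)} \<union> {(y, z), (y', w)}"
      if "D \<in> WF" "(y', w) \<in> A D" for D
    proof (rule swap_back)
      show "(y, z) \<in> D" using that(1) f by (auto simp only: WF_def)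
    qed (use that(2) in \<open>simp_all add: A_def\<close>)
    have "E - {(y, z), (y', w)} \<union> {(y, w), (y', z)} = E2 - {(y, z), (y', w)} \<union> {(y, w), (y', z)}"
      using eq by (simp add: pe qe same \<phi>_def)
    moreover have "E \<in> WF" "(y', w) \<in> A E" "E2 \<in> WF" "(y', w) \<in> A E2"
      using p q by (simp_all add: pe qe same)
    ultimately have "E = E2" using rec[of E] rec[of E2] by presburger
    then show "p = q" using same pe qe by simp
  qed
  moreover have "\<phi> ` Sigma WF A \<subseteq> ?Q"
  proof
    fix p assume "p \<in> \<phi> ` Sigma WF A"
    then obtain E y' w where EW: "E \<in> WF" and a: "(y', w) \<in> A E" and p: "p = \<phi> (E, (y', w))"
      by (elim imageE SigmaE) (metis surj_pair)
    define D where D: "D = E - {(y, z), (y', w)} \<union> {(y, w), (y', z)}"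
    have yzE: "(y, z) \<in> E" using EW f by (auto simp: WF_def)
    have a': "(y', w) \<in> E" "(y', z) \<notin> E" "y' \<notin> S" "(y, w) \<notin> E" "w \<notin> U" using a by (auto simp: A_def)
    have "D \<in> \<B>" unfolding D using EW WB yzE a' by (intro switch_mem) blast+
    moreover have "E \<inter> S \<times> U = {}" using EW by (simp add: WF_def avoiding_def)
    then have "D \<inter> S \<times> U = {}" using a' yz unfolding D by blast
    moreover have "F \<subseteq> E" using EW by (simp add: WF_def)
    then have "F - {(y, z)} \<subseteq> D" using a' F unfolding D by blast
    ultimately have "D \<in> WF'" by (simp add: WF'_def avoiding_def)
    moreover have "p = (D, (y', w))" by (simp add: p \<phi>_def D)
    ultimately show "p \<in> ?Q" by (simp add: D)
  qed
  moreover have "finite ?Q"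
    using finW WB finite_rel by (intro finite_SigmaI) auto
  ultimately have "card (Sigma WF A) \<le> card ?Q" by (meson card_inj_on_le)
  also have "card ?Q = (\<Sum>E\<in>WF'. c * r)"
    using finW WB finite_rel yz deg cdeg by (subst card_SigmaI) (auto simp: card_cartesian_product)
  finally have Q: "card (Sigma WF A) \<le> card WF' * (c * r)" by simp
  have finA: "finite (A E)" if "E \<in> WF" for E
    by (rule finite_subset[OF _ finite_rel[of E]]) (use WB that in \<open>auto simp: A_def\<close>)
  have "card WF * (card R * r) = (\<Sum>E\<in>WF. card R * r)" by simp
  also have "\<dots> \<le> (\<Sum>E\<in>WF. card (A E) + (2 * c * r + card S * r + card U * c))"
    by (intro sum_mono lower)
  also have "\<dots> = card (Sigma WF A) + card WF * (2 * c * r + card S * r + card U * c)"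
    using finW finA by (subst card_SigmaI) (auto simp: sum.distrib)
  finally show ?thesis using Q by linarith
qed

section \<open>Moments of the degree of a new column\<close>

definition density :: real where "density = real r / real (card C)"

lemma density_eq_col: assumes "R \<noteq> {}" "C \<noteq> {}" shows "density = real c / real (card R)"
proof -
  have "real (card R) * real r = real (card C) * real c" using degree_sum by (metis of_nat_mult)
  then show ?thesis using assms finite_rows finite_cols
    by (simp add: density_def divide_simps card_gt_0_iff mult.commute)
qed

text \<open>Dividing \<open>card_switching\<close> by the number \<open>card R * r\<close> of edges
  turns the excluded edges into the fractions \<open>2 * density\<close>,
  \<open>card S / card R\<close> and \<open>card U / card C\<close>; \<open>\<eta>\<close> bounds
  their sum, and the remaining fraction is at least \<open>1 - \<eta>\<close>.\<close>

lemma switching_ratio: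
  assumes F: "F \<subseteq> S \<times> (C - U)" and f: "f \<in> F" and SU: "S \<subseteq> R" "U \<subseteq> C"
    and small: "2 * density + card S / card R + card U / card C \<le> \<eta>" "\<eta> < 1"
  shows "real (card {E \<in> \<W> S U. F \<subseteq> E}) \<le> density / (1 - \<eta>) * real (card {E \<in> \<W> S U. F - {f} \<subseteq> E})"
proof -
  obtain y z where yz: "f = (y, z)" by fastforce
  have ne: "R \<noteq> {}" "C \<noteq> {}" using F f SU yz by auto
  define x where "x = real (card {E \<in> \<W> S U. F \<subseteq> E})"
  define x' where "x' = real (card {E \<in> \<W> S U. F - {f} \<subseteq> E})"
  have nR: "real (card R) > 0" and nC: "real (card C) > 0"
    using ne finite_rows finite_cols by (simp_all add: card_gt_0_iff)
  have ds: "real (card R) * real r = real (card C) * real c" using degree_sum by (metis of_nat_mult)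
  have "card {E \<in> \<W> S U. F \<subseteq> E} * (card R * r) \<le> card {E \<in> \<W> S U. F - {f} \<subseteq> E} * (c * r)
      + card {E \<in> \<W> S U. F \<subseteq> E} * (2 * c * r + card S * r + card U * c)"
    using card_switching[OF F _ SU, of y z] f yz by simp
  then have "real (card {E \<in> \<W> S U. F \<subseteq> E} * (card R * r)) \<le> real (card {E \<in> \<W> S U. F - {f} \<subseteq> E} * (c * r)
      + card {E \<in> \<W> S U. F \<subseteq> E} * (2 * c * r + card S * r + card U * c))"
    by (rule of_nat_mono)
  then have main: "x * (card R * r) \<le> x' * (c * r) + x * (2 * c * r + card S * r + card U * c)"
    by (simp add: x_def x'_def)
  have "x * (1 - \<eta>) \<le> density * x'"
  \<comment> \<open>With no edges the division is impossible, but then no relation contains the edge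
    f and the left side is zero.\<close>
  proof (cases "r = 0")
    case True
    have "F \<subseteq> E \<Longrightarrow> E \<notin> \<W> S U" for E
    proof
      assume "F \<subseteq> E" "E \<in> \<W> S U"
      then have "card E = 0" "finite E" using card_rel[of E] finite_rel[of E] True by (auto simp: avoiding_def)
      then show False using \<open>F \<subseteq> E\<close> f by auto
    qed
    then have "x = 0" by (auto simp: x_def card_eq_0_iff)
    then show ?thesis by (simp add: density_def x'_def)
  next
    case False
    then have rp: "real r > 0" by simp
    define N a1 a2 where "N = real (card R * r)" and "a1 = card S / card R" and "a2 = card U / card C"
    have N: "N > 0" using nR rp by (simp add: N_def)
    have h: "density * N = c * r" "a1 * N = card S * r" "a2 * N = card U * c"
    proof -
      show "density * N = c * r" using density_eq_col[OF ne] nR by (simp add: N_def)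
      show "a1 * N = card S * r" using nR by (simp add: N_def a1_def)
      show "a2 * N = card U * c" using nC ds by (simp add: N_def a2_def)
    qed
    have "x * (2 * c * r + card S * r + card U * c) = x * (2 * (density * N) + a1 * N + a2 * N)"
      unfolding h by simp
    also have "\<dots> = x * (2 * density + a1 + a2) * N" by (simp add: algebra_simps)
    also have "\<dots> \<le> x * \<eta> * N"
      using small(1) N by (intro mult_right_mono mult_left_mono) (auto simp: x_def a1_def a2_def)
    finally have "x * N \<le> x' * (density * N) + x * \<eta> * N"
      using main unfolding h by (simp add: N_def)
    then have "(x * (1 - \<eta>)) * N \<le> (density * x') * N"
      by (simp add: algebra_simps)
    then show ?thesis using N by (rule mult_right_le_imp_le)
  qed
  then show ?thesis using small(2) by (simp add: x_def x'_def field_simps)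
qed

lemma card_forced_edges:
  assumes "F \<subseteq> S \<times> (C - U)" and SU: "S \<subseteq> R" "U \<subseteq> C"
    and small: "2 * density + card S / card R + card U / card C \<le> \<eta>" "\<eta> < 1"
  shows "real (card {E \<in> \<W> S U. F \<subseteq> E}) \<le> (density / (1 - \<eta>)) ^ card F * real (card (\<W> S U))"
proof -
  have "finite F" using assms(1) SU finite_rows finite_cols
    by (meson finite_Diff finite_SigmaI finite_subset)
  then show ?thesis using assms(1)
  proof (induction F rule: finite_induct)
    case empty
    then show ?case by simp
  next
    case (insert f F)
    have "real (card {E \<in> \<W> S U. insert f F \<subseteq> E})
        \<le> density / (1 - \<eta>) * real (card {E \<in> \<W> S U. insert f F - {f} \<subseteq> E})"
      by (rule switching_ratio) (use insert SU small in auto)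
    also have "insert f F - {f} = F" using insert by simp
    also have "density / (1 - \<eta>) * real (card {E \<in> \<W> S U. F \<subseteq> E})
        \<le> density / (1 - \<eta>) * ((density / (1 - \<eta>)) ^ card F * real (card (\<W> S U)))"
      using insert small by (intro mult_left_mono) (auto simp: density_def)
    finally show ?case using insert by simp
  qed
qed

context
  fixes S :: "'a set" and U :: "'b set" and z :: 'b
  assumes SU: "S \<subseteq> R" "U \<subseteq> C" "z \<in> C - U"
begin

private abbreviation "deg E \<equiv> card (E\<inverse> `` {z} \<inter> S)"
private abbreviation "w \<equiv> real (card (\<W> S U))"
private abbreviation "a \<equiv> real r / real (card C - card U)"

private lemma finite_SU: "finite S" "finite U"
  using SU finite_rows finite_cols finite_subset by auto

private lemma card_U_less: "card U < card C"
  using SU finite_cols by (intro psubset_card_mono finite_cols) blast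

private lemma edge_count: "y \<in> S \<Longrightarrow> real (card {E \<in> \<W> S U. (y, z) \<in> E}) = a * w"
proof -
  assume "y \<in> S"
  then have "(card C - card U) * card {E \<in> \<W> S U. (y, z) \<in> E} = r * card (\<W> S U)"
    using card_avoiding_edge SU by blast
  then have eq: "real (card C - card U) * real (card {E \<in> \<W> S U. (y, z) \<in> E}) = real r * w"
    by (metis of_nat_mult)
  have div: "x = q / N * v" if "N > 0" "N * x = q * v" for N x q v :: real
    using that by (simp add: field_simps)
  show ?thesis by (rule div[OF _ eq]) (use card_U_less in simp)
qed

private lemma deg_sum: "real (deg E) = (\<Sum>y\<in>S. of_bool ((y, z) \<in> E))"
proof -
  have "(\<Sum>y\<in>S. of_bool ((y, z) \<in> E)) = real (card {y \<in> S. (y, z) \<in> E})"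
    using finite_SU by (simp add: of_bool_def sum.If_cases Int_def)
  moreover have "{y \<in> S. (y, z) \<in> E} = E\<inverse> `` {z} \<inter> S" by auto
  ultimately show ?thesis by simp
qed

private lemma sum_of_bool_card: "(\<Sum>E\<in>\<W> S U. of_bool (P E)) = real (card {E \<in> \<W> S U. P E})"
  using finite_\<W> by (simp add: of_bool_def sum.If_cases Int_def)

private lemma first_moment: "(\<Sum>E\<in>\<W> S U. real (deg E)) = card S * (a * w)"
proof -
  have "(\<Sum>E\<in>\<W> S U. real (deg E)) = (\<Sum>y\<in>S. \<Sum>E\<in>\<W> S U. of_bool ((y, z) \<in> E))"
    unfolding deg_sum by (rule sum.swap)
  also have "\<dots> = (\<Sum>y\<in>S. a * w)"
    unfolding sum_of_bool_card by (intro sum.cong refl edge_count)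
  finally show ?thesis by simp
qed

private lemma avoiding_insert_count:
  "real (card (\<W> S (insert z U))) = (\<Sum>E\<in>\<W> S U. of_bool (deg E = 0))"
  using finite_SU unfolding sum_of_bool_card avoiding_insert by (simp add: card_eq_0_iff)

text \<open>Diagonal terms are exact edge counts. An off-diagonal term is an exact count for one
  edge times a single switching ratio for the second, so the switching error affects only the
  correlations.\<close>

private lemma second_moment:
  assumes small: "2 * density + card S / card R + card U / card C \<le> \<eta>" "\<eta> < 1"
  shows "(\<Sum>E\<in>\<W> S U. (real (deg E))\<^sup>2) \<le> card S * (a * w) * (1 + (real (card S) - 1) * (density / (1 - \<eta>)))"
proof -
  let ?p = "density / (1 - \<eta>)"
  have "(\<Sum>E\<in>\<W> S U. (real (deg E))\<^sup>2)
      = (\<Sum>E\<in>\<W> S U. \<Sum>y\<in>S. \<Sum>y'\<in>S. of_bool ((y, z) \<in> E \<and> (y', z) \<in> E))"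
    unfolding deg_sum power2_eq_square by (simp add: sum_product of_bool_conj)
  also have "\<dots> = (\<Sum>y\<in>S. \<Sum>y'\<in>S. \<Sum>E\<in>\<W> S U. of_bool ((y, z) \<in> E \<and> (y', z) \<in> E))"
    by (subst sum.swap) (intro sum.cong refl sum.swap)
  also have "\<dots> \<le> (\<Sum>y\<in>S. a * w + (\<Sum>y'\<in>S - {y}. ?p * (a * w)))"
  proof (rule sum_mono)
    fix y assume y: "y \<in> S"
    have "real (card {E \<in> \<W> S U. (y, z) \<in> E \<and> (y', z) \<in> E}) \<le> ?p * (a * w)" if "y' \<in> S - {y}" for y'
    proof -
      have "real (card {E \<in> \<W> S U. {(y, z), (y', z)} \<subseteq> E})
          \<le> ?p * real (card {E \<in> \<W> S U. {(y, z), (y', z)} - {(y', z)} \<subseteq> E})"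
        by (rule switching_ratio) (use that y SU small in auto)
      also have "{(y, z), (y', z)} - {(y', z)} = {(y, z)}" using that by auto
      finally show ?thesis using edge_count[OF y] by simp
    qed
    then have "(\<Sum>y'\<in>S - {y}. real (card {E \<in> \<W> S U. (y, z) \<in> E \<and> (y', z) \<in> E})) \<le> (\<Sum>y'\<in>S - {y}. ?p * (a * w))"
      by (rule sum_mono)
    moreover have "(\<Sum>y'\<in>S. real (card {E \<in> \<W> S U. (y, z) \<in> E \<and> (y', z) \<in> E}))
        = real (card {E \<in> \<W> S U. (y, z) \<in> E}) + (\<Sum>y'\<in>S - {y}. real (card {E \<in> \<W> S U. (y, z) \<in> E \<and> (y', z) \<in> E}))"
      using finite_SU y by (subst sum.remove[of S y]) simp_all
    ultimately show "(\<Sum>y'\<in>S. \<Sum>E\<in>\<W> S U. of_bool ((y, z) \<in> E \<and> (y', z) \<in> E)) \<le> a * w + (\<Sum>y'\<in>S - {y}. ?p * (a * w))"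
      unfolding sum_of_bool_card
      by (metis (no_types, lifting) add_left_mono edge_count[OF y])
  qed
  also have "\<dots> = (\<Sum>y\<in>S. a * w + (real (card S) - 1) * (?p * (a * w)))"
  proof (rule sum.cong[OF refl])
    fix y assume y: "y \<in> S"
    then have "card S \<ge> 1" using finite_SU by (metis One_nat_def Suc_leI card_gt_0_iff empty_iff)
    then show "a * w + (\<Sum>y'\<in>S - {y}. ?p * (a * w)) = a * w + (real (card S) - 1) * (?p * (a * w))"
      using y finite_SU by (simp add: of_nat_diff)
  qed
  also have "\<dots> = card S * (a * w) * (1 + (real (card S) - 1) * ?p)"
  proof -
    have "s * (b + (s - 1) * (q * b)) = s * b * (1 + (s - 1) * q)" for s b q :: real
      by (simp add: algebra_simps)
    then show ?thesis by (simp only: sum_constant)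
  qed
  finally show ?thesis .
qed

text \<open>A single row has degree 0 or 1 in column z, so its first moment determines the count
  without any loss.\<close>

lemma avoiding_insert_singleton:
  assumes "S = {y}"
  shows "real (card (\<W> S (insert z U))) = (1 - a) * w"
proof -
  have "deg E \<le> 1" for E
    using card_mono[of S "E\<inverse> `` {z} \<inter> S"] finite_SU assms by simp
  then have "of_bool (deg E = 0) = 1 - real (deg E)" for E
  proof -
    have "of_bool (n = 0) = 1 - real n" if "n \<le> 1" for n :: nat
      using that by (cases n) auto
    then show ?thesis using \<open>deg E \<le> 1\<close> by blast
  qed
  then have "real (card (\<W> S (insert z U))) = (\<Sum>E\<in>\<W> S U. 1 - real (deg E))"
    unfolding avoiding_insert_count by simp
  also have "\<dots> = w - a * w" using first_moment assms by (simp add: sum_subtractf)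
  finally show ?thesis by (simp add: algebra_simps)
qed

lemma avoiding_insert_pair:
  assumes "card S = 2" and small: "2 * density + card S / card R + card U / card C \<le> \<eta>" "\<eta> < 1"
  shows "real (card (\<W> S (insert z U))) \<le> (1 - 2 * a + density / (1 - \<eta>) * a) * w"
proof -
  \<comment> \<open>The quadratic is \<open>(1 - x) * (2 - x) / 2\<close>, which agrees with the
    indicator of 0 at 0, 1 and 2, the values a degree into two rows can take. This is
    inclusion-exclusion for two events, phrased through moments.\<close>
  have pt: "of_bool (deg E = 0) \<le> 1 - (3/2) * real (deg E) + (1/2) * (real (deg E))\<^sup>2" for E
  proof (cases "deg E \<le> 1")
    case True then show ?thesis by (cases "deg E = 0") (auto simp: le_Suc_eq)
  next
    case False
    then have "0 \<le> (real (deg E) - 1) * (real (deg E) - 2)" by (intro mult_nonneg_nonneg) auto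
    then show ?thesis using False by (simp add: power2_eq_square algebra_simps)
  qed
  have "real (card (\<W> S (insert z U))) \<le> (\<Sum>E\<in>\<W> S U. 1 - (3/2) * real (deg E) + (1/2) * (real (deg E))\<^sup>2)"
    unfolding avoiding_insert_count by (rule sum_mono) (rule pt)
  also have "\<dots> = w - (3/2) * (\<Sum>E\<in>\<W> S U. real (deg E)) + (1/2) * (\<Sum>E\<in>\<W> S U. (real (deg E))\<^sup>2)"
    by (simp add: sum.distrib sum_subtractf sum_distrib_left)
  also have "\<dots> \<le> w - (3/2) * (2 * a * w) + (1/2) * (2 * a * w * (1 + density / (1 - \<eta>)))"
    using second_moment[OF small] unfolding first_moment assms(1) by (simp only: mult.assoc of_nat_numeral) (simp add: mult_ac)
  also have "\<dots> = (1 - 2 * a + density / (1 - \<eta>) * a) * w"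
  proof -
    have "v - (3/2) * (2 * b * v) + (1/2) * (2 * b * v * (1 + q)) = (1 - 2 * b + q * b) * v" for v b q :: real
      by (simp add: algebra_simps)
    then show ?thesis .
  qed
  finally show ?thesis .
qed

text \<open>The indicator of X = 0 is at most \<open>(1 - t X)^2\<close> for every t. The second
  moment is at most \<open>1 + q\<close> times the first, so \<open>t = 1 / (1 + q)\<close>
  minimises the resulting bound and leaves 1 minus t times the mean. The exact edge probability a is
  finally lowered to \<open>density\<close>, making the bound independent of how many columns were
  exposed.\<close>

lemma avoiding_insert_le:
  assumes small: "2 * density + card S / card R + card U / card C \<le> \<eta>" "\<eta> < 1"
  shows "real (card (\<W> S (insert z U)))
    \<le> (1 - card S * density / (1 + card S * (density / (1 - \<eta>)))) * w"
proof -
  define s where "s = real (card S)"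
  define q where "q = s * (density / (1 - \<eta>))"
  have dens: "density \<ge> 0" by (simp add: density_def)
  have q: "q \<ge> 0" using dens small by (simp add: q_def s_def)
  define t where "t = 1 / (1 + q)"
  have t: "0 \<le> t" "t * (1 + q) = 1" using q by (auto simp: t_def)
  have ap: "a \<ge> density" using card_U_less by (simp add: density_def frac_le)
  have pt: "of_bool (deg E = 0) \<le> 1 - 2 * t * real (deg E) + t\<^sup>2 * (real (deg E))\<^sup>2" for E
    using zero_le_power2[of "1 - t * real (deg E)"] by (simp add: power2_eq_square algebra_simps)
  have "(\<Sum>E\<in>\<W> S U. (real (deg E))\<^sup>2) \<le> s * (a * w) * (1 + (s - 1) * (density / (1 - \<eta>)))"
    using second_moment[OF small] by (simp only: s_def)
  also have "\<dots> \<le> s * (a * w) * (1 + q)"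
  proof (intro mult_left_mono add_left_mono)
    have "(s - 1) * b \<le> s * b" if "b \<ge> 0" for b using that by (simp add: algebra_simps)
    from this[of "density / (1 - \<eta>)"]
    show "(s - 1) * (density / (1 - \<eta>)) \<le> q" unfolding q_def using dens small by simp
  qed (simp add: s_def)
  finally have M2: "t\<^sup>2 * (\<Sum>E\<in>\<W> S U. (real (deg E))\<^sup>2) \<le> t\<^sup>2 * (s * (a * w) * (1 + q))"
    by (rule mult_left_mono) simp
  have "real (card (\<W> S (insert z U))) \<le> (\<Sum>E\<in>\<W> S U. 1 - 2 * t * real (deg E) + t\<^sup>2 * (real (deg E))\<^sup>2)"
    unfolding avoiding_insert_count by (rule sum_mono) (rule pt)
  also have "\<dots> = w - 2 * t * (\<Sum>E\<in>\<W> S U. real (deg E)) + t\<^sup>2 * (\<Sum>E\<in>\<W> S U. (real (deg E))\<^sup>2)"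
    by (simp add: sum.distrib sum_subtractf sum_distrib_left)
  also have "\<dots> \<le> w - 2 * t * (s * (a * w)) + t\<^sup>2 * (s * (a * w) * (1 + q))"
    using M2 unfolding first_moment s_def by (rule add_left_mono)
  also have "t\<^sup>2 * (s * (a * w) * (1 + q)) = t * (s * (a * w)) * (t * (1 + q))"
    by (simp add: power2_eq_square)
  also have "w - 2 * t * (s * (a * w)) + t * (s * (a * w)) * (t * (1 + q)) = w - t * s * w * a"
    using t(2) by (simp add: algebra_simps)
  also have "\<dots> \<le> w - t * s * w * density"
    using ap t by (intro diff_left_mono mult_left_mono mult_nonneg_nonneg) (auto simp: s_def)
  also have "\<dots> = (1 - s * density / (1 + q)) * w" by (simp add: t_def algebra_simps)
  finally show ?thesis by (simp add: s_def q_def)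
qed

end

lemma card_avoiding_le:
  assumes "S \<subseteq> R" "U \<subseteq> C"
    and small: "2 * density + card S / card R + card U / card C \<le> \<eta>" "\<eta> < 1"
  shows "real (card (\<W> S U))
    \<le> (1 - card S * density / (1 + card S * (density / (1 - \<eta>)))) ^ card U * real (card \<B>)"
proof -
  have "finite U" using assms finite_cols finite_subset by blast
  then show ?thesis using assms(2) small(1)
  proof (induction U rule: finite_induct)
    case empty
    then show ?case by simp
  next
    case (insert z U)
    let ?\<rho> = "1 - card S * density / (1 + card S * (density / (1 - \<eta>)))"
    have dens: "density \<ge> 0" "density \<le> density / (1 - \<eta>)"
    proof -
      show 1: "density \<ge> 0" by (simp add: density_def)
      have "0 \<le> 2 * density + card S / card R + card (insert z U) / card C"
        using 1 by (intro add_nonneg_nonneg) auto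
      then have "0 \<le> \<eta>" using insert.prems(2) by linarith
      then have "density * (1 - \<eta>) \<le> density" using 1 by (simp add: mult_left_le)
      then show "density \<le> density / (1 - \<eta>)" using small by (simp add: pos_le_divide_eq)
    qed
    have "card S * density \<le> 1 + card S * (density / (1 - \<eta>))"
      using mult_left_mono[OF dens(2), of "card S"] by simp
    moreover have "1 + card S * (density / (1 - \<eta>)) > 0"
      using dens small by (intro add_pos_nonneg mult_nonneg_nonneg) auto
    ultimately have \<rho>: "?\<rho> \<ge> 0" by (simp add: divide_le_eq_1)
    have le: "2 * density + card S / card R + card U / card C \<le> \<eta>"
    proof -
      have "card U / card C \<le> card (insert z U) / card C"
        using insert by (intro divide_right_mono) auto
      then show ?thesis using insert.prems(2) by linarith
    qed
    have "real (card (\<W> S (insert z U))) \<le> ?\<rho> * real (card (\<W> S U))"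
      by (rule avoiding_insert_le) (use insert assms(1) le small in auto)
    also have "\<dots> \<le> ?\<rho> * (?\<rho> ^ card U * real (card \<B>))"
      using insert le \<rho> by (intro mult_left_mono) auto
    finally show ?case using insert by simp
  qed
qed

end

section \<open>Counting biregular relations\<close>

lemma card_row_constrained:
  assumes "finite R" "\<And>y. y \<in> R \<Longrightarrow> P y \<subseteq> Pow C"
  shows "card {E. E \<subseteq> R \<times> C \<and> (\<forall>y\<in>R. E `` {y} \<in> P y)} = (\<Prod>y\<in>R. card (P y))"
proof -
  have fib: "Sigma R f `` {y} = f y" if "y \<in> R" for y and f :: "'a \<Rightarrow> 'b set" using that by auto
  have "bij_betw (\<lambda>E. restrict (\<lambda>y. E `` {y}) R) {E. E \<subseteq> R \<times> C \<and> (\<forall>y\<in>R. E `` {y} \<in> P y)} (PiE R P)"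
  proof (rule bij_betw_byWitness[where f' = "\<lambda>f. Sigma R f"])
    show "\<forall>E\<in>{E. E \<subseteq> R \<times> C \<and> (\<forall>y\<in>R. E `` {y} \<in> P y)}. Sigma R (restrict (\<lambda>y. E `` {y}) R) = E"
      by auto
    show "\<forall>f\<in>PiE R P. restrict (\<lambda>y. Sigma R f `` {y}) R = f"
    proof
      fix f assume f: "f \<in> PiE R P"
      show "restrict (\<lambda>y. Sigma R f `` {y}) R = f"
        by (rule extensionalityI[of _ R]) (use f fib in \<open>auto simp: PiE_def\<close>)
    qed
    show "(\<lambda>E. restrict (\<lambda>y. E `` {y}) R) ` {E. E \<subseteq> R \<times> C \<and> (\<forall>y\<in>R. E `` {y} \<in> P y)} \<subseteq> PiE R P"
      by auto
    show "Sigma R ` PiE R P \<subseteq> {E. E \<subseteq> R \<times> C \<and> (\<forall>y\<in>R. E `` {y} \<in> P y)}"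
    proof
      fix E assume "E \<in> Sigma R ` PiE R P"
      then obtain f where f: "f \<in> PiE R P" "E = Sigma R f" by blast
      have 1: "f y \<in> P y" if "y \<in> R" for y using f(1) that by (rule PiE_mem)
      then have "E `` {y} \<in> P y" if "y \<in> R" for y using that by (simp only: f(2) fib)
      moreover have "E \<subseteq> R \<times> C" using 1 assms(2) by (force simp: f(2))
      ultimately show "E \<in> {E. E \<subseteq> R \<times> C \<and> (\<forall>y\<in>R. E `` {y} \<in> P y)}" by blast
    qed
  qed
  then have "card {E. E \<subseteq> R \<times> C \<and> (\<forall>y\<in>R. E `` {y} \<in> P y)} = card (PiE R P)"
    by (rule bij_betw_same_card)
  then show ?thesis using assms(1) by (simp add: card_PiE)
qed

text \<open>Removing the columns one by one multiplies the count by \<open>1 - r / (N - i)\<close>,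
  and each such factor is at most \<open>1 - r / N\<close>.\<close>

lemma binomial_diff_le:
  assumes "u \<le> N" "r \<le> N"
  shows "real ((N - u) choose r) \<le> (1 - real r / real N) ^ u * real (N choose r)"
  using assms(1)
proof (induction u)
  case 0
  then show ?case by simp
next
  case (Suc u)
  define M where "M = N - u"
  have M: "M > 0" "M \<le> N" "N - Suc u = M - 1" using Suc.prems by (auto simp: M_def)
  have nn: "1 - real r / real N \<ge> 0" using assms(2) by (simp add: divide_le_eq)
  have "real ((M - 1) choose r) \<le> (1 - real r / real N) * real (M choose r)"
  proof (cases "r \<le> M")
    case True
    have "M * ((M - 1) choose r) = (M - r) * (M choose r)"
      using binomial_absorb_comp[of M r] by simp
    then have "real M * real ((M - 1) choose r) = real (M - r) * real (M choose r)"
      by (metis of_nat_mult)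
    then have "real ((M - 1) choose r) = (1 - real r / real M) * real (M choose r)"
      using M True by (simp add: field_simps of_nat_diff)
    also have "\<dots> \<le> (1 - real r / real N) * real (M choose r)"
      using M by (intro mult_right_mono diff_left_mono frac_le) auto
    finally show ?thesis .
  next
    case False
    then show ?thesis using nn by (simp add: binomial_eq_0)
  qed
  also have "\<dots> \<le> (1 - real r / real N) * ((1 - real r / real N) ^ u * real (N choose r))"
    using Suc nn by (intro mult_left_mono) (auto simp: M_def)
  finally show ?case by (simp add: M(3))
qed

section \<open>Column sums of independent rows\<close>

context biregular_degrees
begin

definition with_col_sums :: "('b \<Rightarrow> nat) \<Rightarrow> ('a \<times> 'b) set set" where
  "with_col_sums v =
    {E. E \<subseteq> R \<times> C \<and> (\<forall>y\<in>R. card (E `` {y}) = r) \<and> (\<forall>z\<in>C. card (E\<inverse> `` {z}) = v z)}"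

lemma finite_with_col_sums: "finite (with_col_sums v)"
  by (rule finite_subset[of _ "Pow (R \<times> C)"])
    (use finite_rows finite_cols in \<open>auto simp: with_col_sums_def\<close>)

lemma move_edge_with_col_sums:
  assumes E: "E \<in> with_col_sums v" and z: "z2 \<in> C" "z1 \<noteq> z2"
    and y: "(y, z1) \<in> E" "(y, z2) \<notin> E"
  shows "E - {(y, z1)} \<union> {(y, z2)} \<in> with_col_sums (v(z1 := v z1 - 1, z2 := v z2 + 1))"
proof -
  let ?E = "E - {(y, z1)} \<union> {(y, z2)}"
  have sub: "E \<subseteq> R \<times> C" using E by (simp add: with_col_sums_def)
  have fin: "finite E" using sub finite_rows finite_cols by (rule finite_subset[OF _ finite_SigmaI])
  have "card (?E `` {x}) = r" if "x \<in> R" for x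
  proof -
    have "?E `` {x} = (if x = y then E `` {y} - {z1} \<union> {z2} else E `` {x})" by auto
    moreover have "card (E `` {x}) = r" using E that by (simp add: with_col_sums_def)
    moreover have "card (E `` {y} - {z1} \<union> {z2}) = card (E `` {y})"
      using y fin by (intro card_exchange) auto
    ultimately show ?thesis by (cases "x = y") simp_all
  qed
  moreover have "card (?E\<inverse> `` {x}) = (v(z1 := v z1 - 1, z2 := v z2 + 1)) x" if "x \<in> C" for x
  proof -
    have "?E\<inverse> `` {x} = (if x = z1 then E\<inverse> `` {z1} - {y} else if x = z2 then insert y (E\<inverse> `` {z2}) else E\<inverse> `` {x})"
      using z by auto
    moreover have "card (E\<inverse> `` {x}) = v x" "finite (E\<inverse> `` {x})" using E that fin by (simp_all add: with_col_sums_def)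
    moreover have "y \<in> E\<inverse> `` {z1}" "y \<notin> E\<inverse> `` {z2}" using y by auto
    ultimately show ?thesis using z(2) by (cases "x = z1"; cases "x = z2") simp_all
  qed
  moreover have "?E \<subseteq> R \<times> C" using sub y z by auto
  ultimately show ?thesis by (simp add: with_col_sums_def)
qed

text \<open>Moving a single incidence from column \<open>z1\<close> to column \<open>z2\<close> keeps the number of rows that meet
  both columns, so the larger column offers at least as many moves as there are moves back.\<close>

lemma card_with_col_sums_balance:
  assumes z: "z1 \<in> C" "z2 \<in> C" and less: "v z2 < v z1"
  shows "card (with_col_sums v) \<le> card (with_col_sums (v(z1 := v z1 - 1, z2 := v z2 + 1)))"
proof -
  let ?v = "v(z1 := v z1 - 1, z2 := v z2 + 1)"
  define D where "D a b E = {y. (y, a) \<in> E \<and> (y, b) \<notin> E}" for a b and E :: "('a \<times> 'b) set"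
  define K where "K E = {y. (y, z1) \<in> E \<and> (y, z2) \<in> E}" for E :: "('a \<times> 'b) set"
  define \<phi> where "\<phi> = (\<lambda>(E :: ('a \<times> 'b) set, y). (E - {(y, z1)} \<union> {(y, z2)}, y))"
  have ne: "z1 \<noteq> z2" using less by auto
  have fin: "finite E" if "E \<in> with_col_sums u" for u E
    using that finite_rows finite_cols by (auto simp: with_col_sums_def intro: finite_subset)
  have split: "u a = card (D a b E) + card (K E)" if "E \<in> with_col_sums u" "{a, b} = {z1, z2}" for u a b E
  proof -
    have *: "E\<inverse> `` {a} = D a b E \<union> K E" "D a b E \<inter> K E = {}" using that(2) by (auto simp: D_def K_def doubleton_eq_iff)
    have "finite (E\<inverse> `` {a})" using fin[OF that(1)] by simp
    then have "finite (D a b E)" "finite (K E)" using *(1) by simp_all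
    then have "card (E\<inverse> `` {a}) = card (D a b E) + card (K E)" using * by (simp add: card_Un_disjoint)
    moreover have "a \<in> C" using that(2) z by (auto simp: doubleton_eq_iff)
    ultimately show ?thesis using that(1) by (simp add: with_col_sums_def)
  qed
  have finD: "finite (D a b E)" if "E \<in> with_col_sums u" for u a b E
    by (rule finite_subset[of _ "E\<inverse> `` {a}"]) (use fin[OF that] in \<open>auto simp: D_def\<close>)
  have pos: "card (D z1 z2 E) > 0" if "E \<in> with_col_sums v" for E
    using split[OF that, of z1 z2] split[OF that, of z2 z1] less by (simp add: insert_commute)
  have move: "fst (\<phi> p) \<in> with_col_sums ?v \<and> snd (\<phi> p) \<in> D z2 z1 (fst (\<phi> p))
      \<and> card (D z2 z1 (fst (\<phi> p))) \<le> card (D z1 z2 (fst p))"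
    if "p \<in> Sigma (with_col_sums v) (D z1 z2)" for p
  proof -
    obtain E y where p: "p = (E, y)" by fastforce
    have E: "E \<in> with_col_sums v" and y: "(y, z1) \<in> E" "(y, z2) \<notin> E" using that by (auto simp: p D_def)
    let ?E = "E - {(y, z1)} \<union> {(y, z2)}"
    have E': "?E \<in> with_col_sums ?v" by (rule move_edge_with_col_sums[OF E z(2) ne y])
    have "K ?E = K E" using y by (auto simp: K_def)
    moreover have "?v z2 = card (D z2 z1 ?E) + card (K ?E)" by (rule split[OF E']) auto
    moreover have "v z1 = card (D z1 z2 E) + card (K E)" by (rule split[OF E]) auto
    ultimately have "card (D z2 z1 ?E) \<le> card (D z1 z2 E)" using less by simp
    moreover have "y \<in> D z2 z1 ?E" using ne by (simp add: D_def)
    moreover have "\<phi> p = (?E, y)" by (simp add: \<phi>_def p)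
    ultimately show ?thesis using E' p by simp
  qed
  have inj: "inj_on \<phi> (Sigma (with_col_sums v) (D z1 z2))"
  proof (rule inj_onI)
    fix p q assume pq: "p \<in> Sigma (with_col_sums v) (D z1 z2)" "q \<in> Sigma (with_col_sums v) (D z1 z2)" "\<phi> p = \<phi> q"
    obtain E y where p: "p = (E, y)" by fastforce
    obtain E2 y2 where q: "q = (E2, y2)" by fastforce
    have eq: "y2 = y" "E - {(y, z1)} \<union> {(y, z2)} = E2 - {(y, z1)} \<union> {(y, z2)}"
      using pq(3) by (auto simp: \<phi>_def p q)
    have "(y, z1) \<in> E" "(y, z2) \<notin> E" "(y, z1) \<in> E2" "(y, z2) \<notin> E2"
      using pq eq(1) by (auto simp: p q D_def)
    then have "E = E2" using eq(2) ne by blast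
    then show "p = q" using eq p q by simp
  qed
  have finS: "finite (Sigma (with_col_sums u) (D a b))" for u a b
    using finD by (intro finite_SigmaI finite_with_col_sums) auto
  \<comment> \<open>The number of moves varies with E, so weights replace plain counting: each E
    spreads weight 1 evenly over its moves. A moved relation has at most as many moves back, so
    weights do not decrease under \<open>\<phi>\<close>, while each relation on the target side
    carries total weight at most 1.\<close>
  let ?f = "\<lambda>p. 1 / real (card (D z2 z1 (fst p)))"
  have "real (card (with_col_sums v)) = (\<Sum>E\<in>with_col_sums v. \<Sum>y\<in>D z1 z2 E. 1 / real (card (D z1 z2 E)))"
  proof -
    have "(\<Sum>E\<in>with_col_sums v. \<Sum>y\<in>D z1 z2 E. 1 / real (card (D z1 z2 E))) = (\<Sum>E\<in>with_col_sums v. 1)"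
    proof (rule sum.cong[OF refl])
      fix E assume "E \<in> with_col_sums v"
      then show "(\<Sum>y\<in>D z1 z2 E. 1 / real (card (D z1 z2 E))) = 1" using pos[of E] by simp
    qed
    then show ?thesis by simp
  qed
  also have "\<dots> = (\<Sum>p\<in>Sigma (with_col_sums v) (D z1 z2). 1 / real (card (D z1 z2 (fst p))))"
    using finite_with_col_sums finD by (subst sum.Sigma) (auto simp: case_prod_beta)
  also have "\<dots> \<le> (\<Sum>p\<in>Sigma (with_col_sums v) (D z1 z2). ?f (\<phi> p))"
  proof (rule sum_mono)
    fix p assume p: "p \<in> Sigma (with_col_sums v) (D z1 z2)"
    have "snd (\<phi> p) \<in> D z2 z1 (fst (\<phi> p))" "finite (D z2 z1 (fst (\<phi> p)))" using move[OF p] finD by blast+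
    then have "card (D z2 z1 (fst (\<phi> p))) > 0" by (auto simp: card_gt_0_iff)
    then show "1 / real (card (D z1 z2 (fst p))) \<le> ?f (\<phi> p)"
      using move[OF p] by (intro frac_le) auto
  qed
  also have "\<dots> = (\<Sum>p\<in>\<phi> ` Sigma (with_col_sums v) (D z1 z2). ?f p)"
    using inj by (simp add: sum.reindex)
  also have "\<dots> \<le> (\<Sum>p\<in>Sigma (with_col_sums ?v) (D z2 z1). ?f p)"
  proof (rule sum_mono2)
    show "\<phi> ` Sigma (with_col_sums v) (D z1 z2) \<subseteq> Sigma (with_col_sums ?v) (D z2 z1)"
    proof
      fix q assume "q \<in> \<phi> ` Sigma (with_col_sums v) (D z1 z2)"
      then obtain p where "p \<in> Sigma (with_col_sums v) (D z1 z2)" "q = \<phi> p" by (elim imageE)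
      then show "q \<in> Sigma (with_col_sums ?v) (D z2 z1)" using move[of p] by (cases q) (metis fst_conv snd_conv SigmaI)
    qed
  qed (use finS in auto)
  also have "\<dots> = (\<Sum>E\<in>with_col_sums ?v. \<Sum>y\<in>D z2 z1 E. 1 / real (card (D z2 z1 E)))"
    using finite_with_col_sums finD by (subst sum.Sigma) (auto simp: case_prod_beta)
  also have "\<dots> \<le> (\<Sum>E\<in>with_col_sums ?v. 1)" by (intro sum_mono) simp
  finally show ?thesis by simp
qed

text \<open>Induction on the total excess over c. Subtraction on naturals is truncated, so only
  columns above c contribute, and moving one incidence from such a column to one below c lowers the
  excess by one.\<close>

lemma card_with_col_sums_le:
  assumes "(\<Sum>z\<in>C. v z) = card C * c"
  shows "card (with_col_sums v) \<le> card \<B>"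
  using assms
proof (induction "\<Sum>z\<in>C. v z - c" arbitrary: v rule: less_induct)
  case less
  show ?case
  proof (cases "\<exists>z1\<in>C. v z1 > c")
    case False
    have "v z = c" if "z \<in> C" for z
    proof (rule ccontr)
      assume "v z \<noteq> c"
      then have "v z < c" using False that by (meson linorder_neqE_nat)
      then have "(\<Sum>z\<in>C. v z) < (\<Sum>z\<in>C. c)"
        using that False finite_cols by (intro sum_strict_mono_ex1) (auto simp: not_less)
      then show False using less.prems by simp
    qed
    then have "with_col_sums v = \<B>" by (simp add: with_col_sums_def biregular_relations_def)
    then show ?thesis by simp
  next
    case True
    then obtain z1 where z1: "z1 \<in> C" "v z1 > c" by blast
    have "\<exists>z2\<in>C. v z2 < c"
    proof (rule ccontr)
      assume "\<not> (\<exists>z2\<in>C. v z2 < c)"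
      then have "(\<Sum>z\<in>C. c) < (\<Sum>z\<in>C. v z)"
        using z1 finite_cols by (intro sum_strict_mono_ex1) (auto simp: not_less)
      then show False using less.prems by simp
    qed
    then obtain z2 where z2: "z2 \<in> C" "v z2 < c" by blast
    let ?v = "v(z1 := v z1 - 1, z2 := v z2 + 1)"
    have ne: "z1 \<noteq> z2" using z1 z2 by auto
    have parts: "(\<Sum>z\<in>C. g z) = g z1 + (g z2 + (\<Sum>z\<in>C - {z1} - {z2}. g z))" for g :: "'b \<Rightarrow> nat"
      using z1(1) z2(1) ne finite_cols by (subst sum.remove[of C z1], simp, simp, subst sum.remove[of _ z2]) auto
    have rest: "(\<Sum>z\<in>C - {z1} - {z2}. h (?v z)) = (\<Sum>z\<in>C - {z1} - {z2}. h (v z))" for h :: "nat \<Rightarrow> nat"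
      by (intro sum.cong) auto
    have "(\<Sum>z\<in>C. ?v z) = card C * c"
      using less.prems ne z1(2) rest[of id] parts[of v] parts[of ?v] by simp
    moreover have "(\<Sum>z\<in>C. ?v z - c) < (\<Sum>z\<in>C. v z - c)"
      using ne z1(2) z2(2) rest[of "\<lambda>x. x - c"] parts[of "\<lambda>z. v z - c"] parts[of "\<lambda>z. ?v z - c"] by simp
    ultimately have "card (with_col_sums ?v) \<le> card \<B>" using less.hyps by blast
    moreover have "card (with_col_sums v) \<le> card (with_col_sums ?v)"
      by (rule card_with_col_sums_balance) (use z1 z2 in auto)
    ultimately show ?thesis by linarith
  qed
qed

text \<open>To be read as a lower bound on \<open>card \<B>\<close>. The choices of an r-set in each
  row split into at most \<open>(card R + 1) ^ card C\<close> classes by their column sums, and no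
  class is larger than the balanced one.\<close>

lemma binomial_power_le:
  "(card C choose r) ^ card R \<le> (card R + 1) ^ card C * card \<B>"
proof -
  let ?T = "{E. E \<subseteq> R \<times> C \<and> (\<forall>y\<in>R. E `` {y} \<in> {T. T \<subseteq> C \<and> card T = r})}"
  let ?V = "PiE C (\<lambda>_. {..card R})"
  have card_T: "card ?T = (card C choose r) ^ card R"
  proof -
    have "card ?T = (\<Prod>y\<in>R. card {T. T \<subseteq> C \<and> card T = r})"
      by (rule card_row_constrained) (use finite_rows in auto)
    then show ?thesis using finite_cols by (simp add: n_subsets)
  qed
  have "?T \<subseteq> (\<Union>v\<in>?V. with_col_sums v)"
  proof
    fix E assume E: "E \<in> ?T"
    define v where "v = restrict (\<lambda>z. card (E\<inverse> `` {z})) C"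
    have sub: "E \<subseteq> R \<times> C" using E by blast
    have "card (E\<inverse> `` {z}) \<le> card R" for z
      by (rule card_mono[OF finite_rows]) (use sub in auto)
    then have "v \<in> ?V" by (auto simp: v_def)
    moreover have "E \<in> with_col_sums v" using E by (simp add: with_col_sums_def v_def)
    ultimately show "E \<in> (\<Union>v\<in>?V. with_col_sums v)" by blast
  qed
  then have "card ?T \<le> card (\<Union>v\<in>?V. with_col_sums v)"
    using finite_cols finite_with_col_sums by (intro card_mono finite_UN_I finite_PiE) auto
  also have "\<dots> \<le> (\<Sum>v\<in>?V. card (with_col_sums v))"
    using finite_cols by (intro card_UN_le finite_PiE) auto
  also have "\<dots> \<le> (\<Sum>v\<in>?V. card \<B>)"
  proof (rule sum_mono)
    fix v
    show "card (with_col_sums v) \<le> card \<B>"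
    proof (cases "with_col_sums v = {}")
      case False
      then obtain E where E: "E \<in> with_col_sums v" by blast
      have sub: "E \<subseteq> R \<times> C" using E by (simp add: with_col_sums_def)
      have fin: "finite E" using sub finite_rows finite_cols by (rule finite_subset[OF _ finite_SigmaI])
      have "E = Sigma R (\<lambda>y. E `` {y})" using sub by auto
      then have "card E = card (Sigma R (\<lambda>y. E `` {y}))" by simp
      also have "\<dots> = (\<Sum>y\<in>R. card (E `` {y}))" using finite_rows fin by (intro card_SigmaI) auto
      also have "\<dots> = card R * r" using E by (simp add: with_col_sums_def)
      finally have 1: "card E = card R * r" .
      have "E\<inverse> = Sigma C (\<lambda>z. E\<inverse> `` {z})" using sub by auto
      then have "card (E\<inverse>) = card (Sigma C (\<lambda>z. E\<inverse> `` {z}))" by simp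
      also have "\<dots> = (\<Sum>z\<in>C. card (E\<inverse> `` {z}))" using finite_cols fin by (intro card_SigmaI) auto
      also have "\<dots> = (\<Sum>z\<in>C. v z)" using E by (simp add: with_col_sums_def)
      finally have "(\<Sum>z\<in>C. v z) = card C * c" using 1 degree_sum by (simp add: card_inverse)
      then show ?thesis by (rule card_with_col_sums_le)
    qed simp
  qed
  also have "\<dots> = (card R + 1) ^ card C * card \<B>" using finite_cols by (simp add: card_PiE)
  finally show ?thesis unfolding card_T .
qed

text \<open>The counting bound doubles as an existence proof, so no biregular relation has to be
  constructed.\<close>

lemma card_biregular_relations_pos:
  assumes "r \<le> card C"
  shows "card \<B> > 0"
proof -
  have "(card C choose r) ^ card R > 0" using assms by simp
  then show ?thesis using binomial_power_le by (metis gr0I mult_0_right not_le)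
qed

text \<open>The column condition is dropped when bounding the left side, which makes the rows
  independent; comparison with \<open>card \<B>\<close> through \<open>binomial_power_le\<close>
  costs only the number of possible column sums.\<close>

lemma card_avoiding_entropy:
  assumes SU: "S \<subseteq> R" "U \<subseteq> C" and "r \<le> card C"
  shows "real (card (\<W> S U)) \<le> (1 - density) ^ (card S * card U) * real (card R + 1) ^ card C * real (card \<B>)"
proof -
  let ?P = "\<lambda>y. {T. T \<subseteq> (if y \<in> S then C - U else C) \<and> card T = r}"
  have "\<W> S U \<subseteq> {E. E \<subseteq> R \<times> C \<and> (\<forall>y\<in>R. E `` {y} \<in> ?P y)}"
    by (auto simp: avoiding_def biregular_relations_def)
  moreover have "finite {E. E \<subseteq> R \<times> C \<and> (\<forall>y\<in>R. E `` {y} \<in> ?P y)}"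
    by (rule finite_subset[of _ "Pow (R \<times> C)"]) (use finite_rows finite_cols in auto)
  ultimately have "card (\<W> S U) \<le> card {E. E \<subseteq> R \<times> C \<and> (\<forall>y\<in>R. E `` {y} \<in> ?P y)}"
    by (rule card_mono[rotated])
  also have "\<dots> = (\<Prod>y\<in>R. card (?P y))"
    by (rule card_row_constrained) (use finite_rows in \<open>auto split: if_splits\<close>)
  also have "\<dots> = (\<Prod>y\<in>R. if y \<in> S then (card C - card U) choose r else card C choose r)"
    using finite_cols SU by (intro prod.cong) (auto simp: n_subsets card_Diff_subset finite_subset)
  also have "\<dots> = ((card C - card U) choose r) ^ card S * (card C choose r) ^ card (R - S)"
  proof -
    have "R \<inter> {y. y \<in> S} = S" "R \<inter> - {y. y \<in> S} = R - S" using SU by auto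
    then show ?thesis using finite_rows by (subst prod.If_cases) simp_all
  qed
  finally have le: "card (\<W> S U) \<le> ((card C - card U) choose r) ^ card S * (card C choose r) ^ card (R - S)" .
  have "real (card (\<W> S U)) \<le> real ((card C - card U) choose r) ^ card S * real (card C choose r) ^ card (R - S)"
    using of_nat_mono[OF le, where 'a = real] by simp
  also have "\<dots> \<le> ((1 - density) ^ card U * real (card C choose r)) ^ card S * real (card C choose r) ^ card (R - S)"
    unfolding density_def using SU finite_cols assms(3)
    by (intro mult_right_mono power_mono binomial_diff_le) (auto intro: card_mono)
  also have "\<dots> = (1 - density) ^ (card S * card U) * real (card C choose r) ^ (card S + card (R - S))"
    by (simp add: power_mult_distrib power_add mult.commute flip: power_mult)
  also have "card S + card (R - S) = card R"
    using SU finite_rows by (metis card_mono card_Diff_subset finite_subset le_add_diff_inverse)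
  also have "(1 - density) ^ (card S * card U) * real (card C choose r) ^ card R
      \<le> (1 - density) ^ (card S * card U) * (real (card R + 1) ^ card C * real (card \<B>))"
  proof (rule mult_left_mono)
    show "real (card C choose r) ^ card R \<le> real (card R + 1) ^ card C * real (card \<B>)"
      using binomial_power_le by (metis of_nat_le_iff of_nat_mult of_nat_power)
    show "0 \<le> (1 - density) ^ (card S * card U)"
      using assms(3) by (simp add: density_def divide_le_eq)
  qed
  finally show ?thesis by (simp add: mult.assoc)
qed

end

section \<open>Union bounds\<close>

definition matchable :: "'a set \<Rightarrow> 'b set \<Rightarrow> ('a \<times> 'b) set \<Rightarrow> bool" where
  "matchable A B E \<longleftrightarrow> (\<exists>f. inj_on f A \<and> (\<forall>a\<in>A. f a \<in> B \<and> (a, f a) \<in> E))"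

text \<open>The conditions force T to be the neighbourhood of S in B. It is quantified separately so
  that a union bound can run over pairs \<open>(S, T)\<close>, and \<open>Suc\<close> rules out
  \<open>s = 0\<close>.\<close>

definition violating :: "'a set \<Rightarrow> 'b set \<Rightarrow> nat \<Rightarrow> ('a \<times> 'b) set \<Rightarrow> bool" where
  "violating A B s E \<longleftrightarrow>
     (\<exists>S T. S \<subseteq> A \<and> T \<subseteq> B \<and> card S = s \<and> Suc (card T) = s \<and> E \<inter> S \<times> (B - T) = {} \<and>
        (\<forall>t\<in>T. \<exists>x y. x \<in> S \<and> y \<in> S \<and> x \<noteq> y \<and> (x, t) \<in> E \<and> (y, t) \<in> E))"

lemma violatingI:
  assumes "finite A" "finite B" "S0 \<subseteq> A" "card (E `` S0 \<inter> B) < card S0"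
  shows "\<exists>s. 1 \<le> s \<and> s \<le> card S0 \<and> violating A B s E"
proof -
  let ?E = "E \<inter> A \<times> B"
  have eq: "?E `` S = E `` S \<inter> B" if "S \<subseteq> A" for S using that by auto
  have fin: "finite S0" "finite (?E `` S0)"
    using assms eq finite_subset by (auto intro: finite_subset[of _ B])
  obtain S where S: "S \<subseteq> S0" "card S = Suc (card (?E `` S))"
    "\<And>t. t \<in> ?E `` S \<Longrightarrow> \<exists>x y. x \<in> S \<and> y \<in> S \<and> x \<noteq> y \<and> (x, t) \<in> ?E \<and> (y, t) \<in> ?E"
    using minimal_hall_violator[OF fin, of thesis] assms eq by auto
  have "violating A B (card S) E"
    unfolding violating_def
  proof (intro exI conjI)
    show "S \<subseteq> A" using S assms by blast
    show "?E `` S \<subseteq> B" by blast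
    show "Suc (card (?E `` S)) = card S" using S by simp
    show "E \<inter> S \<times> (B - ?E `` S) = {}" using \<open>S \<subseteq> A\<close> by blast
    show "\<forall>t\<in>?E `` S. \<exists>x y. x \<in> S \<and> y \<in> S \<and> x \<noteq> y \<and> (x, t) \<in> E \<and> (y, t) \<in> E"
      using S(3) by (metis IntD1)
  qed simp
  moreover have "card S \<le> card S0" using S(1) fin by (simp add: card_mono)
  ultimately show ?thesis using S(2) by (intro exI[of _ "card S"]) auto
qed

text \<open>If a minimal violator S with neighbourhood T is too large, \<open>B - T\<close> has
  \<open>card A + 1 - s\<close> elements and its neighbours all lie in \<open>A - S\<close>, which
  is one smaller. Hence it violates Hall's condition from the other side, and shrinking it to a
  minimal violator gives a small one there. The bound on s leaves an empty block of at least half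
  the columns.\<close>

lemma unmatchable_violating:
  assumes fin: "finite A" "finite B" and card: "card A = card B" and "\<not> matchable A B E"
  shows "\<exists>s. 1 \<le> s \<and> 2 * s \<le> card A + 1 \<and> (violating A B s E \<or> violating B A s (E\<inverse>))"
proof -
  let ?E = "E \<inter> A \<times> B"
  have "\<exists>S\<subseteq>A. card (?E `` S) < card S"
  proof (rule ccontr)
    assume neg: "\<not> ?thesis"
    have "\<exists>f. inj_on f A \<and> (\<forall>a\<in>A. (a, f a) \<in> ?E)"
    proof (rule hall_matching[OF fin(1)])
      show "finite (?E `` {a})" for a by (rule finite_subset[OF _ fin(2)]) auto
      show "card S \<le> card (?E `` S)" if "S \<subseteq> A" for S using neg that by (meson not_le)
    qed
    then show False using assms(4) unfolding matchable_def by blast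
  qed
  then obtain S where S: "S \<subseteq> A" "card (?E `` S) < card S" by blast
  have "?E `` S = E `` S \<inter> B" using S(1) by auto
  with S(2) have "card (E `` S \<inter> B) < card S" by simp
  from violatingI[OF fin S(1) this] obtain s where s: "1 \<le> s" "violating A B s E" by blast
  then obtain S T where ST: "S \<subseteq> A" "T \<subseteq> B" "card S = s" "Suc (card T) = s" "E \<inter> S \<times> (B - T) = {}"
    unfolding violating_def by blast
  show ?thesis
  proof (cases "2 * s \<le> card A + 1")
    case True
    then show ?thesis using s by blast
  next
    case False
    have fST: "finite S" "finite T" using ST fin finite_subset by auto
    have U: "card (B - T) = card A + 1 - s"
      using ST fST fin card by (simp add: card_Diff_subset)
    have "s \<le> card A" using ST fin by (metis card_mono)
    have "E\<inverse> `` (B - T) \<inter> A \<subseteq> A - S" using ST by blast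
    then have "card (E\<inverse> `` (B - T) \<inter> A) \<le> card (A - S)" using fin by (intro card_mono) auto
    also have "\<dots> = card A - s" using ST fST by (simp add: card_Diff_subset)
    finally have "card (E\<inverse> `` (B - T) \<inter> A) < card (B - T)" using U \<open>s \<le> card A\<close> by simp
    from violatingI[OF fin(2,1) _ this] obtain s' where "1 \<le> s'" "s' \<le> card (B - T)" "violating B A s' (E\<inverse>)"
      by auto
    then show ?thesis using U False by (intro exI[of _ s']) auto
  qed
qed

lemma violating_empty_block:
  assumes "finite A" "finite B" "card A = card B" "violating A B s E"
  shows "\<exists>S U. S \<subseteq> A \<and> U \<subseteq> B \<and> card S + card U = card A + 1 \<and> E \<inter> S \<times> U = {}"
proof -
  obtain S T where ST: "S \<subseteq> A" "T \<subseteq> B" "card S = s" "Suc (card T) = s" "E \<inter> S \<times> (B - T) = {}"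
    using assms(4) unfolding violating_def by blast
  have "card (B - T) = card B - card T" using ST assms by (simp add: card_Diff_subset finite_subset)
  moreover have "card T \<le> card B" using ST assms by (simp add: card_mono)
  ultimately show ?thesis using ST assms(3) by (intro exI[of _ S] exI[of _ "B - T"]) auto
qed

text \<open>The Frobenius-Koenig form of Hall's theorem, symmetric in the two sides.\<close>

lemma unmatchable_empty_block:
  assumes "finite A" "finite B" "card A = card B" "\<not> matchable A B E"
  shows "\<exists>S U. S \<subseteq> A \<and> U \<subseteq> B \<and> card S + card U = card A + 1 \<and> E \<inter> S \<times> U = {}"
proof -
  obtain s where "violating A B s E \<or> violating B A s (E\<inverse>)"
    using unmatchable_violating[OF assms] by blast
  then show ?thesis
  proof
    assume "violating B A s (E\<inverse>)"
    from violating_empty_block[OF assms(2,1) assms(3)[symmetric] this]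
    obtain U S where US: "U \<subseteq> B" "S \<subseteq> A" "card U + card S = card B + 1" "E\<inverse> \<inter> U \<times> S = {}"
      by (elim exE conjE)
    then have "E \<inter> S \<times> U = {}" by blast
    then show ?thesis using US assms(3) by (intro exI[of _ S] exI[of _ U]) auto
  next
    assume "violating A B s E"
    then show ?thesis by (rule violating_empty_block[OF assms(1-3)])
  qed
qed

lemma card_UN_le_const:
  assumes "finite I" "\<And>i. i \<in> I \<Longrightarrow> real (card (X i)) \<le> K"
  shows "real (card (\<Union>i\<in>I. X i)) \<le> real (card I) * K"
proof -
  have "real (card (\<Union>i\<in>I. X i)) \<le> real (\<Sum>i\<in>I. card (X i))"
    by (rule of_nat_mono) (rule card_UN_le[OF assms(1)])
  also have "\<dots> \<le> (\<Sum>i\<in>I. K)" unfolding of_nat_sum by (rule sum_mono) (rule assms(2))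
  finally show ?thesis by simp
qed

section \<open>Union bounds over violators and empty blocks\<close>

context biregular_degrees
begin

lemma converse_degrees: "biregular_degrees C R c r"
  using finite_rows finite_cols degree_sum by (simp add: biregular_degrees_def)

abbreviation "\<N> \<equiv> real (card \<B>)"

abbreviation switch_density :: "real \<Rightarrow> real" where
  "switch_density \<eta> \<equiv> density / (1 - \<eta>)"

text \<open>The factor gained per column in \<open>card_avoiding_le\<close>. It behaves like
  \<open>1 - s * density\<close> while \<open>s * density\<close> is small and approaches
  \<open>\<eta>\<close> when that product is large.\<close>

definition avoid_rate :: "real \<Rightarrow> nat \<Rightarrow> real" where
  "avoid_rate \<eta> s = 1 - real s * density / (1 + real s * switch_density \<eta>)"

text \<open>The estimate K for one pair \<open>(S, T)\<close> is left open because different sizes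
  need different ones: the empty block alone, the forced edges in addition, or an exact row count
  when \<open>s = 1\<close>.\<close>

lemma card_violating_le:
  assumes AB: "A \<subseteq> R" "B \<subseteq> C" "card A = m" "card B = m"
    and small: "2 * density + m / card R + m / card C \<le> \<eta>" "\<eta> < 1" and s: "1 \<le> s" "s \<le> m"
    and K: "\<And>S T. \<lbrakk>S \<subseteq> A; T \<subseteq> B; card S = s; Suc (card T) = s\<rbrakk> \<Longrightarrow>
      real (card {E \<in> \<W> S (B - T). \<forall>t\<in>T. \<exists>x y. x \<in> S \<and> y \<in> S \<and> x \<noteq> y \<and> (x, t) \<in> E \<and> (y, t) \<in> E}) \<le> K"
  shows "real (card {E \<in> \<B>. violating A B s E}) \<le> real (m choose s) * real (m choose (s - 1)) * K"
proof -
  have fin: "finite A" "finite B" using AB finite_rows finite_cols finite_subset by auto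
  let ?I = "{S. S \<subseteq> A \<and> card S = s} \<times> {T. T \<subseteq> B \<and> card T = s - 1}"
  let ?X = "\<lambda>(S, T). {E \<in> \<W> S (B - T). \<forall>t\<in>T. \<exists>x y. x \<in> S \<and> y \<in> S \<and> x \<noteq> y \<and> (x, t) \<in> E \<and> (y, t) \<in> E}"
  have finI: "finite ?I" using fin by auto
  have "{E \<in> \<B>. violating A B s E} \<subseteq> (\<Union>i\<in>?I. ?X i)"
  proof
    fix E assume "E \<in> {E \<in> \<B>. violating A B s E}"
    then obtain S T where "E \<in> \<B>" "S \<subseteq> A" "T \<subseteq> B" "card S = s" "Suc (card T) = s" "E \<inter> S \<times> (B - T) = {}"
      "\<forall>t\<in>T. \<exists>x y. x \<in> S \<and> y \<in> S \<and> x \<noteq> y \<and> (x, t) \<in> E \<and> (y, t) \<in> E"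
      unfolding violating_def by blast
    then have "(S, T) \<in> ?I" "E \<in> ?X (S, T)" by (auto simp: avoiding_def)
    then show "E \<in> (\<Union>i\<in>?I. ?X i)" by blast
  qed
  moreover have "finite (\<Union>i\<in>?I. ?X i)"
    using finI finite_\<W> by (intro finite_UN_I) auto
  ultimately have "real (card {E \<in> \<B>. violating A B s E}) \<le> real (card (\<Union>i\<in>?I. ?X i))"
    by (intro of_nat_mono card_mono)
  also have "\<dots> \<le> real (card ?I) * K"
    using finI K s by (intro card_UN_le_const) auto
  also have "card ?I = (m choose s) * (m choose (s - 1))"
    using fin AB by (simp add: card_cartesian_product n_subsets)
  finally show ?thesis by simp
qed

lemma small_restrict:
  assumes "2 * density + m / card R + m / card C \<le> \<eta>" "s \<le> m" "u \<le> m"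
  shows "2 * density + s / card R + u / card C \<le> \<eta>"
proof -
  have "s / card R \<le> m / card R" "u / card C \<le> m / card C"
    using assms(2,3) by (simp_all add: divide_right_mono)
  then show ?thesis using assms(1) by linarith
qed

lemma card_violating_le_crude:
  assumes AB: "A \<subseteq> R" "B \<subseteq> C" "card A = m" "card B = m"
    and small: "2 * density + m / card R + m / card C \<le> \<eta>" "\<eta> < 1" and s: "1 \<le> s" "s \<le> m"
  shows "real (card {E \<in> \<B>. violating A B s E})
    \<le> real (m choose s) * real (m choose (s - 1)) * (avoid_rate \<eta> s ^ (m + 1 - s) * \<N>)"
proof (rule card_violating_le[OF AB small s])
  fix S T assume ST: "S \<subseteq> A" "T \<subseteq> B" "card S = s" "Suc (card T) = s"
  have "finite T" using ST(2) AB(2) finite_cols by (meson finite_subset)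
  then have U: "card (B - T) = m + 1 - s" using ST AB by (simp add: card_Diff_subset)
  have "real (card {E \<in> \<W> S (B - T). \<forall>t\<in>T. \<exists>x y. x \<in> S \<and> y \<in> S \<and> x \<noteq> y \<and> (x, t) \<in> E \<and> (y, t) \<in> E})
      \<le> real (card (\<W> S (B - T)))"
    using finite_\<W> by (intro of_nat_mono card_mono) auto
  also have "\<dots> \<le> (1 - card S * density / (1 + card S * (density / (1 - \<eta>)))) ^ card (B - T) * \<N>"
    using ST AB s small_restrict[OF small(1), of s "m + 1 - s"] small(2) U
    by (intro card_avoiding_le) auto
  finally show "real (card {E \<in> \<W> S (B - T). \<forall>t\<in>T. \<exists>x y. x \<in> S \<and> y \<in> S \<and> x \<noteq> y \<and> (x, t) \<in> E \<and> (y, t) \<in> E})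
      \<le> avoid_rate \<eta> s ^ (m + 1 - s) * \<N>"
    using ST U by (simp add: avoid_rate_def)
qed

text \<open>Choosing two neighbours in S for each \<open>t \<in> T\<close> costs
  \<open>s choose 2\<close> per vertex and forces \<open>2 * (s - 1)\<close> distinct edges outside
  the empty block, each of which costs a factor \<open>switch_density \<eta>\<close>.\<close>

lemma card_violating_le_fine:
  assumes AB: "A \<subseteq> R" "B \<subseteq> C" "card A = m" "card B = m"
    and small: "2 * density + m / card R + m / card C \<le> \<eta>" "\<eta> < 1" and s: "1 \<le> s" "s \<le> m"
  shows "real (card {E \<in> \<B>. violating A B s E})
    \<le> real (m choose s) * real (m choose (s - 1)) *
      (real (s choose 2) ^ (s - 1) * (switch_density \<eta> ^ (2 * (s - 1)) * (avoid_rate \<eta> s ^ (m + 1 - s) * \<N>)))"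
proof (rule card_violating_le[OF AB small s])
  fix S T assume ST: "S \<subseteq> A" "T \<subseteq> B" "card S = s" "Suc (card T) = s"
  have fin: "finite S" "finite T" using ST AB finite_rows finite_cols finite_subset by metis+
  then have U: "card (B - T) = m + 1 - s" using ST AB by (simp add: card_Diff_subset)
  have dens: "density \<ge> 0" by (simp add: density_def)
  let ?\<Phi> = "PiE T (\<lambda>_. {D. D \<subseteq> S \<and> card D = 2})"
  define F where "F \<phi> = (\<lambda>(t, x). (x, t)) ` Sigma T \<phi>" for \<phi> :: "'b \<Rightarrow> 'a set"
  let ?X = "\<lambda>\<phi>. {E \<in> \<W> S (B - T). F \<phi> \<subseteq> E}"
  have sr: "2 * density + card S / card R + card (B - T) / card C \<le> \<eta>"
    using small_restrict[OF small(1), of s "m + 1 - s"] s U ST by simp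
  have X: "real (card (?X \<phi>)) \<le> switch_density \<eta> ^ (2 * (s - 1)) * (avoid_rate \<eta> s ^ (m + 1 - s) * \<N>)"
    if \<phi>: "\<phi> \<in> ?\<Phi>" for \<phi>
  proof -
    have \<phi>t: "\<phi> t \<subseteq> S \<and> card (\<phi> t) = 2" if "t \<in> T" for t using PiE_mem[OF \<phi> that] by simp
    have "card (F \<phi>) = card (Sigma T \<phi>)" unfolding F_def by (rule card_image) (auto simp: inj_on_def)
    also have "\<dots> = (\<Sum>t\<in>T. card (\<phi> t))"
      using fin \<phi>t by (intro card_SigmaI) (auto intro: finite_subset)
    also have "\<dots> = 2 * (s - 1)" using \<phi>t ST by simp
    finally have card_F: "card (F \<phi>) = 2 * (s - 1)" .
    have "F \<phi> \<subseteq> S \<times> (C - (B - T))" using \<phi>t ST AB by (force simp: F_def)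
    then have "real (card (?X \<phi>)) \<le> switch_density \<eta> ^ card (F \<phi>) * real (card (\<W> S (B - T)))"
      by (rule card_forced_edges) (use ST AB sr small in auto)
    also have "\<dots> \<le> switch_density \<eta> ^ card (F \<phi>) *
        ((1 - card S * density / (1 + card S * (density / (1 - \<eta>)))) ^ card (B - T) * \<N>)"
      using ST AB sr small dens by (intro mult_left_mono card_avoiding_le) auto
    finally show ?thesis unfolding card_F U ST(3) by (simp add: avoid_rate_def)
  qed
  have "{E \<in> \<W> S (B - T). \<forall>t\<in>T. \<exists>x y. x \<in> S \<and> y \<in> S \<and> x \<noteq> y \<and> (x, t) \<in> E \<and> (y, t) \<in> E} \<subseteq> (\<Union>\<phi>\<in>?\<Phi>. ?X \<phi>)"
  proof
    fix E assume "E \<in> {E \<in> \<W> S (B - T). \<forall>t\<in>T. \<exists>x y. x \<in> S \<and> y \<in> S \<and> x \<noteq> y \<and> (x, t) \<in> E \<and> (y, t) \<in> E}"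
    then have EW: "E \<in> \<W> S (B - T)"
      and "\<forall>t\<in>T. \<exists>x y. x \<in> S \<and> y \<in> S \<and> x \<noteq> y \<and> (x, t) \<in> E \<and> (y, t) \<in> E" by blast+
    then obtain f g where fg: "\<forall>t\<in>T. f t \<in> S \<and> g t \<in> S \<and> f t \<noteq> g t \<and> (f t, t) \<in> E \<and> (g t, t) \<in> E"
      by metis
    let ?\<phi> = "restrict (\<lambda>t. {f t, g t}) T"
    have "?\<phi> \<in> ?\<Phi>" using fg by auto
    moreover have "F ?\<phi> \<subseteq> E" using fg by (auto simp: F_def)
    ultimately show "E \<in> (\<Union>\<phi>\<in>?\<Phi>. ?X \<phi>)" using EW by blast
  qed
  moreover have fin\<Phi>: "finite ?\<Phi>" using fin by (intro finite_PiE) auto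
  moreover have "finite (\<Union>\<phi>\<in>?\<Phi>. ?X \<phi>)" using fin\<Phi> finite_\<W> by (intro finite_UN_I) auto
  ultimately have "real (card {E \<in> \<W> S (B - T). \<forall>t\<in>T. \<exists>x y. x \<in> S \<and> y \<in> S \<and> x \<noteq> y \<and> (x, t) \<in> E \<and> (y, t) \<in> E})
      \<le> real (card (\<Union>\<phi>\<in>?\<Phi>. ?X \<phi>))"
    by (intro of_nat_mono card_mono)
  also have "\<dots> \<le> real (card ?\<Phi>) * (switch_density \<eta> ^ (2 * (s - 1)) * (avoid_rate \<eta> s ^ (m + 1 - s) * \<N>))"
    using fin\<Phi> X by (rule card_UN_le_const)
  also have "card ?\<Phi> = (s choose 2) ^ (s - 1)"
  proof -
    have "card T = s - 1" using ST by simp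
    then show ?thesis using fin ST by (simp add: card_PiE n_subsets del: One_nat_def)
  qed
  finally show "real (card {E \<in> \<W> S (B - T). \<forall>t\<in>T. \<exists>x y. x \<in> S \<and> y \<in> S \<and> x \<noteq> y \<and> (x, t) \<in> E \<and> (y, t) \<in> E})
      \<le> real (s choose 2) ^ (s - 1) * (switch_density \<eta> ^ (2 * (s - 1)) * (avoid_rate \<eta> s ^ (m + 1 - s) * \<N>))"
    by simp
qed

section \<open>Single rows and the dense range\<close>

lemma card_avoiding_singleton:
  assumes "y \<in> R" "U \<subseteq> C"
  shows "real (card (\<W> {y} U)) = (\<Prod>i<card U. 1 - real r / real (card C - i)) * \<N>"
proof -
  have "finite U" using assms finite_cols finite_subset by blast
  then show ?thesis using assms(2)
  proof (induction U rule: finite_induct)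
    case empty
    then show ?case by simp
  next
    case (insert z U)
    have "real (card (\<W> {y} (insert z U))) = (1 - real r / real (card C - card U)) * real (card (\<W> {y} U))"
      by (rule avoiding_insert_singleton) (use insert assms in auto)
    then show ?case using insert by simp
  qed
qed

lemma card_avoiding_singleton_le:
  assumes "y \<in> R" "U \<subseteq> C" "r \<le> card C"
  shows "real (card (\<W> {y} U)) \<le> (1 - density) ^ card U * \<N>"
proof (cases "r \<le> card C - card U")
  case True
  have le: "card U \<le> card C" using assms finite_cols by (simp add: card_mono)
  have "(\<Prod>i<card U. 1 - real r / real (card C - i)) \<le> (\<Prod>i<card U. 1 - density)"
  proof (rule prod_mono)
    fix i assume "i \<in> {..<card U}"
    then have i: "card C - i \<ge> r" "card C - i > 0" using True le by auto
    then have "density \<le> real r / real (card C - i)" unfolding density_def by (intro frac_le) auto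
    then show "0 \<le> 1 - real r / real (card C - i) \<and> 1 - real r / real (card C - i) \<le> 1 - density"
      using i by (simp add: divide_le_eq)
  qed
  then show ?thesis using assms by (simp add: card_avoiding_singleton mult_right_mono)
next
  \<comment> \<open>Factors of the exact product may be negative here, so they cannot be compared
    one by one. But the row has fewer than r columns left, and the event is empty.\<close>
  case False
  have "E \<notin> \<W> {y} U" for E
  proof
    assume E: "E \<in> \<W> {y} U"
    then have "E `` {y} \<subseteq> C - U" "card (E `` {y}) = r"
      using assms(1) by (auto simp: avoiding_def biregular_relations_def)
    then have "r \<le> card (C - U)" using finite_cols by (metis card_mono finite_Diff)
    also have "card (C - U) = card C - card U"
      using assms(2) finite_cols by (simp add: card_Diff_subset finite_subset)
    finally show False using False by simp
  qed
  then have "\<W> {y} U = {}" by blast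
  moreover have "0 \<le> 1 - density" using assms(3) by (simp add: density_def divide_le_eq)
  ultimately show ?thesis by simp
qed

text \<open>The sides of the empty block have \<open>m + 1\<close> elements in total. If one side
  has at most j, a single vertex of it already misses \<open>m - j\<close> vertices opposite, and a
  one-row or one-column bound suffices. Otherwise both sides have at least j elements and the
  entropy bound applies; \<open>4 ^ m\<close> bounds the number of such blocks.\<close>

lemma card_unmatchable_le_dense:
  assumes AB: "A \<subseteq> R" "B \<subseteq> C" "card A = m" "card B = m" and "r \<le> card C" "c \<le> card R" "j \<le> m"
    and ne: "R \<noteq> {}" "C \<noteq> {}"
  shows "real (card {E \<in> \<B>. \<not> matchable A B E})
    \<le> (2 * (real m * (real (m choose j) * (1 - density) ^ (m - j)))
       + 4 ^ m * ((1 - density) ^ (j * j) * real (card R + 1) ^ card C)) * \<N>"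
proof -
  interpret conv: biregular_degrees C R c r by (rule converse_degrees)
  have dens: "conv.density = density" using density_eq_col[OF ne] by (simp add: conv.density_def)
  have p01: "0 \<le> 1 - density" "1 - density \<le> 1" using assms(5) by (simp_all add: density_def divide_le_eq)
  have fin: "finite A" "finite B" using AB finite_rows finite_cols finite_subset by blast+
  let ?I1 = "A \<times> {U. U \<subseteq> B \<and> card U = m - j}" and ?I2 = "B \<times> {U. U \<subseteq> A \<and> card U = m - j}"
  let ?I3 = "{(S, U). S \<subseteq> A \<and> U \<subseteq> B \<and> j \<le> card S \<and> j \<le> card U}"
  let ?X1 = "\<lambda>(y, U). \<W> {y} U" and ?X2 = "\<lambda>(z, U). \<W> U {z}" and ?X3 = "\<lambda>(S, U). \<W> S U"
  have I3: "?I3 \<subseteq> Pow A \<times> Pow B" by auto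
  have finI: "finite ?I1" "finite ?I2" "finite ?I3"
    using fin finite_subset[OF I3] by simp_all
  have cI: "card ?I1 = m * (m choose j)" "card ?I2 = m * (m choose j)"
    using fin AB assms(7) by (simp_all add: card_cartesian_product n_subsets binomial_symmetric[of j m])
  have cI3: "real (card ?I3) \<le> 4 ^ m"
  proof -
    have "card ?I3 \<le> card (Pow A \<times> Pow B)" using I3 fin by (intro card_mono) auto
    also have "\<dots> = 2 ^ m * 2 ^ m" using fin AB by (simp add: card_cartesian_product card_Pow)
    also have "\<dots> = 4 ^ m" by (simp flip: power_mult_distrib)
    finally have le: "card ?I3 \<le> 4 ^ m" .
    show ?thesis using of_nat_mono[OF le, where 'a = real] by simp
  qed
  have cover: "{E \<in> \<B>. \<not> matchable A B E} \<subseteq> (\<Union>i\<in>?I1. ?X1 i) \<union> ((\<Union>i\<in>?I2. ?X2 i) \<union> (\<Union>i\<in>?I3. ?X3 i))"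
  proof
    fix E assume "E \<in> {E \<in> \<B>. \<not> matchable A B E}"
    then have E: "E \<in> \<B>" "\<not> matchable A B E" by auto
    obtain S U where SU: "S \<subseteq> A" "U \<subseteq> B" "card S + card U = m + 1" "E \<inter> S \<times> U = {}"
      using unmatchable_empty_block[OF fin _ E(2)] AB by auto
    have le: "card S \<le> m" "card U \<le> m" using SU AB fin by (metis card_mono)+
    then have "S \<noteq> {}" "U \<noteq> {}" using SU(3) by auto
    then obtain y z where yz: "y \<in> S" "z \<in> U" by blast
    consider "card S \<le> j" | "card U \<le> j" | "j \<le> card S" "j \<le> card U" by linarith
    then show "E \<in> (\<Union>i\<in>?I1. ?X1 i) \<union> ((\<Union>i\<in>?I2. ?X2 i) \<union> (\<Union>i\<in>?I3. ?X3 i))"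
    proof cases
      case 1
      then have "m - j \<le> card U" using SU(3) by linarith
      then obtain U' where U': "U' \<subseteq> U" "card U' = m - j" by (metis obtain_subset_with_card_n)
      then have "(y, U') \<in> ?I1" using SU yz by auto
      moreover have "E \<in> ?X1 (y, U')" using E SU yz U' by (auto simp: avoiding_def)
      ultimately show ?thesis by blast
    next
      case 2
      then have "m - j \<le> card S" using SU(3) by linarith
      then obtain S' where S': "S' \<subseteq> S" "card S' = m - j" by (metis obtain_subset_with_card_n)
      then have "(z, S') \<in> ?I2" using SU yz by auto
      moreover have "E \<in> ?X2 (z, S')" using E SU yz S' by (auto simp: avoiding_def)
      ultimately show ?thesis by blast
    next
      case 3
      then have "(S, U) \<in> ?I3" using SU by auto
      moreover have "E \<in> ?X3 (S, U)" using E SU by (auto simp: avoiding_def)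
      ultimately show ?thesis by blast
    qed
  qed
  let ?K1 = "(1 - density) ^ (m - j) * \<N>"
  let ?K3 = "(1 - density) ^ (j * j) * real (card R + 1) ^ card C * \<N>"
  have "real (card (\<Union>i\<in>?I1. ?X1 i)) \<le> real (card ?I1) * ?K1"
  proof (rule card_UN_le_const[OF finI(1)])
    fix i assume "i \<in> ?I1"
    then obtain y U where "i = (y, U)" "y \<in> A" "U \<subseteq> B" "card U = m - j" by auto
    then show "real (card (?X1 i)) \<le> ?K1" using card_avoiding_singleton_le[of y U] AB assms(5) by auto
  qed
  moreover have "real (card (\<Union>i\<in>?I2. ?X2 i)) \<le> real (card ?I2) * ?K1"
  proof (rule card_UN_le_const[OF finI(2)])
    fix i assume "i \<in> ?I2"
    then obtain z U where i: "i = (z, U)" "z \<in> B" "U \<subseteq> A" "card U = m - j" by auto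
    have "card (avoiding C R c r {z} U) = card (\<W> U {z})"
      using card_converse_Collect[of "\<lambda>E. E \<in> \<W> U {z}"] by simp
    moreover have zU: "z \<in> C" "U \<subseteq> R" using i(2,3) AB(1,2) by auto
    moreover have "real (card (avoiding C R c r {z} U)) \<le> (1 - conv.density) ^ card U * real (card (biregular_relations C R c r))"
      by (rule conv.card_avoiding_singleton_le[OF zU assms(6)])
    ultimately show "real (card (?X2 i)) \<le> ?K1"
      by (simp only: i(1,4) dens card_biregular_relations_converse[of C R c r] prod.case)
  qed
  moreover have "real (card (\<Union>i\<in>?I3. ?X3 i)) \<le> real (card ?I3) * ?K3"
  proof (rule card_UN_le_const[OF finI(3)])
    fix i assume "i \<in> ?I3"
    then obtain S U where i: "i = (S, U)" "S \<subseteq> A" "U \<subseteq> B" "j \<le> card S" "j \<le> card U" by auto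
    have "real (card (\<W> S U)) \<le> (1 - density) ^ (card S * card U) * real (card R + 1) ^ card C * \<N>"
      using i AB assms(5) by (intro card_avoiding_entropy) auto
    also have "\<dots> \<le> ?K3"
      using i p01 by (intro mult_right_mono power_decreasing mult_mono) auto
    finally show "real (card (?X3 i)) \<le> ?K3" using i by simp
  qed
  moreover have "real (card ?I3) * ?K3 \<le> 4 ^ m * ?K3"
    using cI3 p01 by (intro mult_right_mono) auto
  moreover have "real (card {E \<in> \<B>. \<not> matchable A B E})
      \<le> real (card (\<Union>i\<in>?I1. ?X1 i)) + (real (card (\<Union>i\<in>?I2. ?X2 i)) + real (card (\<Union>i\<in>?I3. ?X3 i)))"
  proof -
    have "finite ((\<Union>i\<in>?I1. ?X1 i) \<union> ((\<Union>i\<in>?I2. ?X2 i) \<union> (\<Union>i\<in>?I3. ?X3 i)))"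
      using finI finite_\<W> by (intro finite_UnI finite_UN_I) auto
    then have "card {E \<in> \<B>. \<not> matchable A B E}
        \<le> card ((\<Union>i\<in>?I1. ?X1 i) \<union> ((\<Union>i\<in>?I2. ?X2 i) \<union> (\<Union>i\<in>?I3. ?X3 i)))"
      using cover by (rule card_mono)
    also have "\<dots> \<le> card (\<Union>i\<in>?I1. ?X1 i) + (card (\<Union>i\<in>?I2. ?X2 i) + card (\<Union>i\<in>?I3. ?X3 i))"
      by (intro order_trans[OF card_Un_le] add_mono order_refl)
    finally show ?thesis by (simp only: flip: of_nat_add)
  qed
  ultimately have "real (card {E \<in> \<B>. \<not> matchable A B E}) \<le> real (card ?I1) * ?K1 + (real (card ?I2) * ?K1 + 4 ^ m * ?K3)"
    by linarith
  then show ?thesis unfolding cI by (simp add: algebra_simps)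
qed

text \<open>The second sum is stated in the transposed family, so that one estimate for violators
  among rows serves both.\<close>

lemma card_unmatchable_le_sum:
  assumes AB: "A \<subseteq> R" "B \<subseteq> C" "card A = m" "card B = m"
  shows "real (card {E \<in> \<B>. \<not> matchable A B E})
    \<le> (\<Sum>s | 1 \<le> s \<and> 2 * s \<le> m + 1. real (card {E \<in> \<B>. violating A B s E}))
      + (\<Sum>s | 1 \<le> s \<and> 2 * s \<le> m + 1. real (card {E \<in> biregular_relations C R c r. violating B A s E}))"
proof -
  let ?J = "{s. 1 \<le> s \<and> 2 * s \<le> m + 1}"
  have finJ: "finite ?J" by (rule finite_subset[of _ "{..m + 1}"]) auto
  have fin: "finite A" "finite B" using AB finite_rows finite_cols finite_subset by blast+
  let ?X = "\<lambda>s. {E \<in> \<B>. violating A B s E}" and ?X' = "\<lambda>s. {E \<in> \<B>. violating B A s (E\<inverse>)}"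
  have "{E \<in> \<B>. \<not> matchable A B E} \<subseteq> (\<Union>s\<in>?J. ?X s) \<union> (\<Union>s\<in>?J. ?X' s)"
  proof
    fix E assume "E \<in> {E \<in> \<B>. \<not> matchable A B E}"
    then have E: "E \<in> \<B>" "\<not> matchable A B E" by auto
    then obtain s where "1 \<le> s" "2 * s \<le> m + 1" "violating A B s E \<or> violating B A s (E\<inverse>)"
      using unmatchable_violating[OF fin _ E(2)] AB by auto
    then show "E \<in> (\<Union>s\<in>?J. ?X s) \<union> (\<Union>s\<in>?J. ?X' s)" using E by blast
  qed
  moreover have "finite ((\<Union>s\<in>?J. ?X s) \<union> (\<Union>s\<in>?J. ?X' s))"
    using finJ finite_\<B> by (intro finite_UnI finite_UN_I) auto
  ultimately have "card {E \<in> \<B>. \<not> matchable A B E} \<le> card ((\<Union>s\<in>?J. ?X s) \<union> (\<Union>s\<in>?J. ?X' s))"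
    by (rule card_mono[rotated])
  also have "\<dots> \<le> card (\<Union>s\<in>?J. ?X s) + card (\<Union>s\<in>?J. ?X' s)" by (rule card_Un_le)
  also have "\<dots> \<le> (\<Sum>s\<in>?J. card (?X s)) + (\<Sum>s\<in>?J. card (?X' s))"
    using finJ by (intro add_mono card_UN_le)
  also have "(\<Sum>s\<in>?J. card (?X' s)) = (\<Sum>s\<in>?J. card {E \<in> biregular_relations C R c r. violating B A s E})"
  proof (rule sum.cong[OF refl])
    fix s
    show "card (?X' s) = card {E \<in> biregular_relations C R c r. violating B A s E}"
      using card_converse_Collect[of "\<lambda>E. E \<in> biregular_relations C R c r \<and> violating B A s E"] by simp
  qed
  finally have "real (card {E \<in> \<B>. \<not> matchable A B E}) \<le> real ((\<Sum>s\<in>?J. card (?X s))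
      + (\<Sum>s\<in>?J. card {E \<in> biregular_relations C R c r. violating B A s E}))"
    by (rule of_nat_mono)
  then show ?thesis by simp
qed

end

section \<open>Isolated vertices and the sparse range\<close>

lemma power_fact_le_exp: "real s ^ k / fact k \<le> exp (real s)"
proof -
  have "(\<Sum>i\<in>{k}. real s ^ i / fact i) \<le> (\<Sum>i. real s ^ i / fact i)"
    using summable_exp_generic[of "real s"] by (intro sum_le_suminf) (auto simp: divide_inverse mult.commute)
  then show ?thesis by (simp add: exp_def divide_inverse mult.commute)
qed

lemma binomial_le_power_fact: "real (m choose k) \<le> real m ^ k / fact k"
proof -
  have "real (m choose k) * fact k \<le> real m ^ k"
    using of_nat_mono[OF binomial_fact_pow[of m k], where 'a = real] by simp
  then show ?thesis by (simp add: field_simps)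
qed

text \<open>One term of the expansion of \<open>(1 + x) ^ m\<close>. The parameter x is free: a
  small value makes the cost in m negligible at the price of a larger constant in front of k, which
  is harmless when k is a small fraction of m.\<close>

lemma binomial_le_exp:
  assumes "0 < x" "x \<le> 1"
  shows "real (m choose k) \<le> exp (x * real m + ln (1 / x) * real k)"
proof (cases "k \<le> m")
  case True
  have "real (m choose k) * x ^ k \<le> (\<Sum>i\<le>m. real (m choose i) * x ^ i * 1 ^ (m - i))"
    using assms True member_le_sum[of k "{..m}" "\<lambda>i. real (m choose i) * x ^ i * 1 ^ (m - i)"] by simp
  also have "\<dots> = (x + 1) ^ m" by (rule binomial_ring[symmetric])
  also have "\<dots> \<le> exp x ^ m" using assms by (intro power_mono) (auto simp: add.commute)
  also have "\<dots> = exp (x * real m)" by (simp add: exp_of_nat2_mult)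
  finally have "real (m choose k) \<le> exp (x * real m) / x ^ k" using assms by (simp add: field_simps)
  also have "1 / x ^ k = exp (ln (1 / x)) ^ k" using assms by (simp add: power_one_over)
  then have "exp (x * real m) / x ^ k = exp (x * real m) * exp (ln (1 / x) * real k)"
    by (metis exp_of_nat2_mult mult.right_neutral times_divide_eq_right)
  finally show ?thesis by (simp add: exp_add)
qed (simp add: binomial_eq_0)

lemma one_minus_power_le_exp: "x \<le> 1 \<Longrightarrow> (1 - x) ^ k \<le> exp (- (x * real k))" for x :: real
proof -
  assume "x \<le> 1"
  then have "(1 - x) ^ k \<le> exp (- x) ^ k"
    using exp_ge_add_one_self[of "- x"] by (intro power_mono) auto
  then show ?thesis by (simp only: exp_of_nat2_mult mult_minus_left[symmetric])
qed

section \<open>Correlation of isolation events and the second moment of their number\<close>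

context biregular_degrees
begin

text \<open>By \<open>card_avoiding_singleton\<close> this is the exact probability that a given row
  has no edge into u given columns.\<close>

definition isolation :: "nat \<Rightarrow> real" where
  "isolation u = (\<Prod>i<u. 1 - real r / real (card C - i))"

lemma isolation_bounds:
  assumes "\<And>i. i < u \<Longrightarrow> real r / real (card C - i) \<le> a" "a \<le> 1"
  shows "isolation u \<ge> (1 - a) ^ u" "isolation u \<ge> 0"
proof -
  have "(\<Prod>i<u. 1 - a) \<le> isolation u"
    unfolding isolation_def using assms by (intro prod_mono) auto
  then show "isolation u \<ge> (1 - a) ^ u" by simp
  then show "isolation u \<ge> 0" using assms(2) by (meson diff_ge_0_iff_ge order_trans zero_le_power)
qed

text \<open>Comparison with two independent rows, column by column. One column contributes
  \<open>1 - 2 * b + q * b\<close> to the pair and \<open>(1 - b)^2\<close> to the square of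
  \<open>isolation\<close>; the excess \<open>q * b\<close> is second order in the density.\<close>

lemma card_avoiding_pair_le:
  assumes y: "y \<in> R" "y' \<in> R" "y \<noteq> y'" and U: "U \<subseteq> C"
    and small: "2 * density + 2 / card R + card U / card C \<le> \<eta>" "\<eta> < 1"
    and a: "\<And>i. i < card U \<Longrightarrow> real r / real (card C - i) \<le> a" "a \<le> 1 / 4" "0 \<le> a"
  shows "real (card (\<W> {y, y'} U)) \<le> (1 + 2 * (density / (1 - \<eta>)) * a) ^ card U * (isolation (card U))\<^sup>2 * \<N>"
proof -
  define q where "q = density / (1 - \<eta>)"
  have q: "q \<ge> 0" using small(2) by (simp add: density_def q_def)
  have "finite U" using U finite_cols finite_subset by blast
  then show ?thesis using U small(1) a(1) unfolding q_def[symmetric]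
  proof (induction U rule: finite_induct)
    case empty
    then show ?case by (simp add: isolation_def)
  next
    case (insert z U)
    define b where "b = real r / real (card C - card U)"
    have b: "0 \<le> b" "b \<le> a" using insert.prems(3)[of "card U"] insert.hyps by (auto simp: b_def)
    have card2: "card {y, y'} = 2" using y by simp
    have less: "2 * density + 2 / card R + card U / card C \<le> \<eta>"
    proof -
      have "card U / card C \<le> card (insert z U) / card C"
        using insert.hyps by (intro divide_right_mono) auto
      then show ?thesis using insert.prems(2) by linarith
    qed
    have IH: "real (card (\<W> {y, y'} U)) \<le> (1 + 2 * q * a) ^ card U * (isolation (card U))\<^sup>2 * \<N>"
      using insert less by simp
    have "real (card (\<W> {y, y'} (insert z U))) \<le> (1 - 2 * b + q * b) * real (card (\<W> {y, y'} U))"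
      unfolding b_def q_def by (rule avoiding_insert_pair) (use y insert card2 less small in auto)
    also have "\<dots> \<le> ((1 + 2 * q * a) * (1 - b)\<^sup>2) * real (card (\<W> {y, y'} U))"
    proof (rule mult_right_mono)
      \<comment> \<open>From \<open>b \<le> 1 / 4\<close> the square is at least 9/16, hence above
        1/2. This allows \<open>q * b\<close> to be absorbed into a multiple of
        \<open>(1 - b)^2\<close>, with the factor 2 that appears in the statement.\<close>
      have "(3/4)\<^sup>2 \<le> (1 - b)\<^sup>2" using b a(2) by (intro power_mono) auto
      then have "1 \<le> 2 * (1 - b)\<^sup>2" by (simp add: power2_eq_square)
      then have "q * b * 1 \<le> q * b * (2 * (1 - b)\<^sup>2)" using q b by (intro mult_left_mono) auto
      also have "\<dots> \<le> q * a * (2 * (1 - b)\<^sup>2)" using q b by (intro mult_right_mono mult_left_mono) auto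
      finally have "q * b \<le> 2 * q * a * (1 - b)\<^sup>2" by (simp add: mult_ac)
      moreover have "1 - 2 * b \<le> (1 - b)\<^sup>2" by (simp add: power2_eq_square algebra_simps)
      ultimately show "1 - 2 * b + q * b \<le> (1 + 2 * q * a) * (1 - b)\<^sup>2"
        unfolding distrib_right by linarith
    qed simp
    also have "\<dots> \<le> ((1 + 2 * q * a) * (1 - b)\<^sup>2) * ((1 + 2 * q * a) ^ card U * (isolation (card U))\<^sup>2 * \<N>)"
      using IH q a(3) by (intro mult_left_mono) auto
    also have "\<dots> = (1 + 2 * q * a) ^ card (insert z U) * (isolation (card (insert z U)))\<^sup>2 * \<N>"
      using insert.hyps by (simp add: isolation_def b_def power_mult_distrib mult_ac)
    finally show ?case .
  qed
qed

text \<open>Chebyshev's inequality for the number X of isolated vertices, whose mean is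
  \<open>\<mu>\<close>. The diagonal of the second moment yields \<open>1 / \<mu>\<close>, and the
  pairs yield the deviation from independence.\<close>

lemma card_no_isolated_le:
  assumes AB: "A \<subseteq> R" "B \<subseteq> C"
    and small: "2 * density + 2 / card R + card B / card C \<le> \<eta>" "\<eta> < 1"
    and a: "\<And>i. i < card B \<Longrightarrow> real r / real (card C - i) \<le> a" "a \<le> 1 / 4" "0 \<le> a"
  defines "\<mu> \<equiv> real (card A) * isolation (card B)"
  assumes \<mu>: "\<mu> > 0"
  shows "real (card {E \<in> \<B>. \<forall>y\<in>A. E `` {y} \<inter> B \<noteq> {}})
    \<le> (1 / \<mu> + ((1 + 2 * (density / (1 - \<eta>)) * a) ^ card B - 1)) * \<N>"
proof -
  let ?X0 = "{E \<in> \<B>. \<forall>y\<in>A. E `` {y} \<inter> B \<noteq> {}}"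
  let ?I = "isolation (card B)"
  define Q where "Q = (1 + 2 * (density / (1 - \<eta>)) * a) ^ card B"
  define X :: "('a \<times> 'b) set \<Rightarrow> real" where "X E = (\<Sum>y\<in>A. of_bool (E \<in> \<W> {y} B))" for E :: "('a \<times> 'b) set"
  have fin: "finite A" using AB(1) finite_rows by (rule finite_subset)
  have Q0: "Q \<ge> 0" using small(2) a(3) by (simp add: Q_def density_def)
  have ob: "(\<Sum>E\<in>\<B>. of_bool (P E)) = real (card {E \<in> \<B>. P E})" for P
    using finite_\<B> by (simp add: of_bool_def sum.If_cases Int_def)
  have single: "real (card {E \<in> \<B>. E \<in> \<W> {y} B}) = ?I * \<N>" if "y \<in> A" for y
  proof -
    have "{E \<in> \<B>. E \<in> \<W> {y} B} = \<W> {y} B" by (auto simp: avoiding_def)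
    then show ?thesis using card_avoiding_singleton[of y B] that AB by (auto simp: isolation_def)
  qed
  have pair: "real (card {E \<in> \<B>. E \<in> \<W> {y} B \<and> E \<in> \<W> {y'} B}) \<le> Q * ?I\<^sup>2 * \<N>"
    if "y \<in> A" "y' \<in> A" "y \<noteq> y'" for y y'
  proof -
    have "{E \<in> \<B>. E \<in> \<W> {y} B \<and> E \<in> \<W> {y'} B} = \<W> {y, y'} B" by (auto simp: avoiding_def)
    moreover have "y \<in> R" "y' \<in> R" using that AB by auto
    ultimately show ?thesis
      unfolding Q_def using card_avoiding_pair_le[OF _ _ that(3) AB(2) small a] by simp
  qed
  have M1: "(\<Sum>E\<in>\<B>. X E) = \<mu> * \<N>"
  proof -
    have "(\<Sum>E\<in>\<B>. X E) = (\<Sum>y\<in>A. \<Sum>E\<in>\<B>. of_bool (E \<in> \<W> {y} B))"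
      unfolding X_def by (rule sum.swap)
    also have "\<dots> = (\<Sum>y\<in>A. ?I * \<N>)" unfolding ob by (intro sum.cong refl single)
    finally show ?thesis by (simp add: \<mu>_def)
  qed
  have M2: "(\<Sum>E\<in>\<B>. (X E)\<^sup>2) \<le> \<mu> * \<N> + Q * \<mu>\<^sup>2 * \<N>"
  proof -
    have "(\<Sum>E\<in>\<B>. (X E)\<^sup>2) = (\<Sum>E\<in>\<B>. \<Sum>y\<in>A. \<Sum>y'\<in>A. of_bool (E \<in> \<W> {y} B \<and> E \<in> \<W> {y'} B))"
      unfolding X_def power2_eq_square by (simp add: sum_product of_bool_conj)
    also have "\<dots> = (\<Sum>y\<in>A. \<Sum>y'\<in>A. \<Sum>E\<in>\<B>. of_bool (E \<in> \<W> {y} B \<and> E \<in> \<W> {y'} B))"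
      by (subst sum.swap) (intro sum.cong refl sum.swap)
    also have "\<dots> \<le> (\<Sum>y\<in>A. \<Sum>y'\<in>A. of_bool (y' = y) * (?I * \<N>) + Q * ?I\<^sup>2 * \<N>)"
    proof (intro sum_mono)
      fix y y' assume "y \<in> A" "y' \<in> A"
      then show "(\<Sum>E\<in>\<B>. of_bool (E \<in> \<W> {y} B \<and> E \<in> \<W> {y'} B)) \<le> of_bool (y' = y) * (?I * \<N>) + Q * ?I\<^sup>2 * \<N>"
        unfolding ob using single[of y] pair[of y y'] Q0 by (cases "y' = y") auto
    qed
    also have "\<dots> = (\<Sum>y\<in>A. ?I * \<N> + card A * (Q * ?I\<^sup>2 * \<N>))"
    proof (rule sum.cong[OF refl])
      fix y assume y: "y \<in> A"
      have "(\<Sum>y'\<in>A. of_bool (y' = y) * (?I * \<N>)) = ?I * \<N>"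
        using fin y by (subst sum.remove[of A y]) auto
      then show "(\<Sum>y'\<in>A. of_bool (y' = y) * (?I * \<N>) + Q * ?I\<^sup>2 * \<N>) = ?I * \<N> + card A * (Q * ?I\<^sup>2 * \<N>)"
        unfolding sum.distrib by simp
    qed
    also have "\<dots> = \<mu> * \<N> + Q * \<mu>\<^sup>2 * \<N>"
      by (simp add: \<mu>_def algebra_simps power2_eq_square)
    finally show ?thesis .
  qed
  \<comment> \<open>No vertex is isolated on \<open>?X0\<close>, so X vanishes there and each
    relation contributes exactly the square of \<open>\<mu>\<close>.\<close>
  have "real (card ?X0) * \<mu>\<^sup>2 = (\<Sum>E\<in>?X0. (X E - \<mu>)\<^sup>2)"
  proof -
    have "X E = 0" if "E \<in> ?X0" for E
      unfolding X_def using that by (intro sum.neutral) (auto simp: avoiding_def)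
    then show ?thesis by simp
  qed
  also have "\<dots> \<le> (\<Sum>E\<in>\<B>. (X E - \<mu>)\<^sup>2)"
    using finite_\<B> by (intro sum_mono2) auto
  also have "\<dots> = (\<Sum>E\<in>\<B>. (X E)\<^sup>2 - 2 * \<mu> * X E + \<mu>\<^sup>2)"
    by (simp add: power2_eq_square algebra_simps)
  also have "\<dots> = (\<Sum>E\<in>\<B>. (X E)\<^sup>2) - 2 * \<mu> * (\<Sum>E\<in>\<B>. X E) + \<N> * \<mu>\<^sup>2"
    by (simp add: sum.distrib sum_subtractf sum_distrib_left)
  also have "\<dots> \<le> (\<mu> * \<N> + Q * \<mu>\<^sup>2 * \<N>) - 2 * \<mu> * (\<mu> * \<N>) + \<N> * \<mu>\<^sup>2"
    using M2 unfolding M1 by simp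
  also have "\<dots> = ((1 / \<mu> + (Q - 1)) * \<N>) * \<mu>\<^sup>2"
    using \<mu> by (simp add: power2_eq_square field_simps)
  finally have "real (card ?X0) * \<mu>\<^sup>2 \<le> ((1 / \<mu> + (Q - 1)) * \<N>) * \<mu>\<^sup>2" .
  moreover have "\<mu>\<^sup>2 > 0" using \<mu> by simp
  ultimately show ?thesis unfolding Q_def by (rule mult_right_le_imp_le)
qed

text \<open>Three ranges of \<open>s\<close>: for \<open>s p\<close> small the two forced edges at each vertex of the deficient
  neighbourhood pay for its choice; beyond that the decay \<open>avoid_rate\<close> alone beats the entropy.\<close>

lemma card_violating_sparse:
  assumes AB: "A \<subseteq> R" "B \<subseteq> C" "card A = m" "card B = m" and r: "r \<le> card C"
    and small: "2 * density + m / card R + m / card C \<le> 1 / 500"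
    and L: "L = density * m" "real m \<le> exp L" "L \<ge> 30000000" "3 + 2 * ln L \<le> L / 6"
    and s: "1 \<le> s" "2 * s \<le> m + 1"
  shows "real (card {E \<in> \<B>. violating A B s E})
    \<le> (of_bool (s = 1) * (m * exp (- L)) + of_bool (s \<ge> 2) * exp (- L / 6) ^ s + exp (- (m / 72)) + (4 / 7) ^ m) * \<N>"
proof -
  define p where "p = density"
  define q where "q = p / (1 - 1 / 500)"
  define \<rho> where "\<rho> = avoid_rate (1 / 500) s"
  define \<mu> where "\<mu> = real s * p"
  have p: "p > 0" "p \<le> 1" "L = p * m"
  proof -
    show Lp: "L = p * m" using L by (simp add: p_def)
    have "p \<ge> 0" by (simp add: p_def density_def)
    moreover have "p \<noteq> 0" using Lp L(3) by auto
    ultimately show "p > 0" by simp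
    have "0 \<le> m / card R" "0 \<le> m / card C" by simp_all
    then show "p \<le> 1" using small unfolding p_def[symmetric] by linarith
  qed
  have q: "q \<ge> 0" "q \<le> (101/100) * p" using p by (simp_all add: q_def field_simps)
  have \<mu>: "\<mu> > 0" using p s by (simp add: \<mu>_def)
  have m: "real m \<ge> L" using p by (simp add: mult_left_le_one_le)
  have sm: "s \<le> m" using s by linarith
  have \<rho>_eq: "\<rho> = 1 - \<mu> / (1 + real s * q)"
    by (simp add: \<rho>_def avoid_rate_def \<mu>_def p_def q_def)
  have sq: "0 \<le> real s * q" "real s * q \<le> (101/100) * \<mu>"
    using q mult_left_mono[OF q(2), of "real s"] by (simp_all add: \<mu>_def mult_ac)
  have \<rho>0: "\<rho> \<ge> 0"
  proof -
    have "p \<le> q" using p by (simp add: q_def field_simps)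
    then have "\<mu> \<le> real s * q" by (simp add: \<mu>_def mult_left_mono)
    then have "\<mu> / (1 + real s * q) \<le> 1" using sq(1) by (simp add: divide_le_eq)
    then show ?thesis by (simp add: \<rho>_eq)
  qed
  have \<rho>_exp: "\<rho> ^ (m + 1 - s) \<le> exp (- (t * w))" if "t \<le> \<mu> / (1 + real s * q)" "w \<le> real (m + 1 - s)" "t \<ge> 0" for t w
  proof -
    have "\<rho> ^ (m + 1 - s) \<le> exp (- (\<mu> / (1 + real s * q) * real (m + 1 - s)))"
      unfolding \<rho>_eq by (rule one_minus_power_le_exp) (use \<rho>0 \<rho>_eq in simp)
    also have "\<dots> \<le> exp (- (t * w))"
    proof -
      have "t * w \<le> t * real (m + 1 - s)" using that by (intro mult_left_mono)
      also have "\<dots> \<le> \<mu> / (1 + real s * q) * real (m + 1 - s)" using that by (intro mult_right_mono) auto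
      finally show ?thesis by simp
    qed
    finally show ?thesis .
  qed
  have crude: "real (card {E \<in> \<B>. violating A B s E}) \<le> real (m choose s) * real (m choose (s - 1)) * \<rho> ^ (m + 1 - s) * \<N>"
    using card_violating_le_crude[OF AB small _ s(1) sm] by (simp add: \<rho>_def mult.assoc)
  let ?Z = "real (card {E \<in> \<B>. violating A B s E})"
  consider (one) "s = 1" | (fine) "s \<ge> 2" "16 * \<mu> \<le> 1" | (mid) "16 * \<mu> > 1" "\<mu> \<le> 100" | (big) "\<mu> > 100"
    using s by linarith
  then show ?thesis
  proof cases
    \<comment> \<open>The tight case: \<open>m * exp (- L)\<close> tends to zero only just above the
      threshold, so the exact row count is used in place of \<open>avoid_rate\<close>. A single
      vertex has the empty set as its deficient neighbourhood.\<close>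
    case one
    have "?Z \<le> real (m choose s) * real (m choose (s - 1)) * (exp (- L) * \<N>)"
    proof (rule card_violating_le[OF AB small _ s(1) sm])
      fix S T assume ST: "S \<subseteq> A" "T \<subseteq> B" "card S = s" "Suc (card T) = s"
      have "finite T" using ST(2) AB(2) finite_cols by (meson finite_subset)
      then have T: "T = {}" using ST one by simp
      obtain y where y: "S = {y}" using ST one by (metis card_1_singletonE)
      have "real (card (\<W> {y} B)) \<le> (1 - density) ^ card B * \<N>"
        using y ST AB r by (intro card_avoiding_singleton_le) auto
      also have "\<dots> \<le> exp (- L) * \<N>"
        using one_minus_power_le_exp[of p m] p AB by (intro mult_right_mono) (auto simp: p_def)
      finally show "real (card {E \<in> \<W> S (B - T). \<forall>t\<in>T. \<exists>x y. x \<in> S \<and> y \<in> S \<and> x \<noteq> y \<and> (x, t) \<in> E \<and> (y, t) \<in> E}) \<le> exp (- L) * \<N>"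
        by (simp add: T y)
    qed simp
    then have "?Z \<le> (m * exp (- L)) * \<N>" using one by (simp add: mult.assoc)
    also have "\<dots> \<le> (of_bool (s = 1) * (m * exp (- L)) + of_bool (s \<ge> 2) * exp (- L / 6) ^ s + exp (- (m / 72)) + (4 / 7) ^ m) * \<N>"
      using one by (intro mult_right_mono) auto
    finally show ?thesis .
  next
    case fine
    define k where "k = s - 1"
    have sk: "s = Suc k" "k \<ge> 1" using fine(1) by (auto simp: k_def)
    have Lpos: "L > 0" using L by simp
    have "?Z \<le> real (m choose s) * real (m choose k) * (real (s choose 2) ^ k * (q ^ (2 * k) * (\<rho> ^ (m + 1 - s) * \<N>)))"
      using card_violating_le_fine[OF AB small _ s(1) sm] by (simp add: \<rho>_def p_def q_def k_def)
    also have "\<dots> \<le> (real m ^ s / fact s) * (real m ^ k / fact k) *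
        (((real s)\<^sup>2 / 2) ^ k * ((2 * p) ^ (2 * k) * (exp (- (5/6 * (s * L))) * \<N>)))"
    proof (intro mult_mono binomial_le_power_fact power_mono)
      have "even (s * (s - 1))" by (cases s) auto
      then have "2 * (s choose 2) = s * (s - 1)" by (simp add: choose_two)
      then have "2 * real (s choose 2) = real s * real (s - 1)" by (metis of_nat_mult of_nat_numeral)
      also have "\<dots> \<le> real s * real s" by (intro mult_left_mono) auto
      finally show "real (s choose 2) \<le> (real s)\<^sup>2 / 2" by (simp add: power2_eq_square)
      show "q \<le> 2 * p" using q(2) p(1) by linarith
      \<comment> \<open>The exponent 5/6 is the product of 8/9, from
        \<open>1 + s q \<le> 9/8\<close>, and 15/16, from \<open>16 s \<le> m\<close>; the latter
        holds because \<open>16 s p \<le> 1\<close> and \<open>p m = L \<ge> 1\<close>.\<close>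
      show "\<rho> ^ (m + 1 - s) \<le> exp (- (5/6 * (s * L)))"
      proof -
        have "1 + real s * q \<le> 9/8" using sq(2) fine(2) by linarith
        then have "\<mu> * (8/9) \<le> \<mu> / (1 + real s * q)" using \<mu> sq(1) by (simp add: field_simps)
        moreover have "real m * (15/16) \<le> real (m + 1 - s)"
        proof -
          have "16 * (real s * p) \<le> 1 * L" using fine(2) L(3) unfolding \<mu>_def by linarith
          then have "(16 * real s) * p \<le> real m * p" using p(3) by (simp add: mult_ac)
          then have "16 * real s \<le> real m" using p(1) by (rule mult_right_le_imp_le)
          then show ?thesis using sm by (simp add: of_nat_diff)
        qed
        ultimately have "\<rho> ^ (m + 1 - s) \<le> exp (- ((\<mu> * (8/9)) * (real m * (15/16))))"
          using \<mu> by (intro \<rho>_exp) auto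
        also have "(\<mu> * (8/9)) * (real m * (15/16)) = 5/6 * (s * L)" by (simp add: \<mu>_def p(3))
        finally show ?thesis .
      qed
    qed (use q \<rho>0 p in auto)
    \<comment> \<open>There are \<open>2 * k + 1\<close> factors m from choosing S and T and
      \<open>2 * k\<close> factors p from the forced edges. They pair up to powers of L and leave
      one m, at most \<open>exp L\<close>, which the decay absorbs because
      \<open>s \<ge> 2\<close>.\<close>
    also have "\<dots> = real m * ((real s ^ k / fact s) * (real s ^ k / fact k) * (2 ^ k * L ^ (2 * k)) * exp (- (5/6 * (s * L)))) * \<N>"
    proof -
      have e: "real m ^ s = real m * real m ^ k" "((real s)\<^sup>2 / 2) ^ k = real s ^ k * real s ^ k / 2 ^ k"
        "(2 * p) ^ (2 * k) = 2 ^ k * 2 ^ k * (p ^ k * p ^ k)" "L ^ (2 * k) = (p ^ k * p ^ k) * (real m ^ k * real m ^ k)"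
        unfolding mult_2[of k] power_add
        by (simp_all add: sk(1) p(3) power_mult_distrib power_divide power2_eq_square mult_ac)
      show ?thesis unfolding e by (simp add: field_simps)
    qed
    also have "\<dots> \<le> exp L * ((exp (real s) * exp (real s)) * exp (real s + 2 * real s * ln L) * exp (- (5/6 * (s * L)))) * \<N>"
    proof (intro mult_right_mono mult_mono)
      have "real s ^ k / fact s \<le> real s ^ s / fact s"
        using s by (intro divide_right_mono) (auto simp: sk(1) mult_le_cancel_right1)
      then show "real s ^ k / fact s \<le> exp (real s)" using power_fact_le_exp[of s s] by linarith
      show "real s ^ k / fact k \<le> exp (real s)" by (rule power_fact_le_exp)
      have "(2::real) ^ k \<le> exp 1 ^ k" using exp_ge_add_one_self[of 1] by (intro power_mono) auto
      also have "\<dots> = exp (real k)" by (simp flip: exp_of_nat_mult)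
      finally have "(2::real) ^ k \<le> exp (real s)" using sk(1) by (meson exp_le_cancel_iff le_SucI of_nat_mono order_refl order_trans)
      moreover have "L ^ (2 * k) \<le> exp (2 * real s * ln L)"
      proof -
        have "L ^ (2 * k) \<le> L ^ (2 * s)" using L(3) sk(1) by (intro power_increasing) auto
        also have "\<dots> = exp (real (2 * s) * ln L)" using Lpos by (simp only: exp_of_nat_mult exp_ln)
        finally show ?thesis by simp
      qed
      ultimately show "2 ^ k * L ^ (2 * k) \<le> exp (real s + 2 * real s * ln L)"
        unfolding exp_add using Lpos by (intro mult_mono) auto
    qed (use L Lpos in auto)
    also have "exp L * ((exp (real s) * exp (real s)) * exp (real s + 2 * real s * ln L) * exp (- (5/6 * (s * L))))
        = exp (L + (real s + real s + (real s + 2 * real s * ln L) + - (5/6 * (s * L))))"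
      by (simp only: exp_add)
    also have "\<dots> \<le> exp (- L / 6) ^ s"
    proof -
      have "2 * L \<le> real s * L" using fine(1) Lpos by (intro mult_right_mono) auto
      moreover have "real s * (3 + 2 * ln L) \<le> real s * (L / 6)" using L(4) by (intro mult_left_mono) auto
      ultimately have "L + (real s + real s + (real s + 2 * real s * ln L) + - (5/6 * (s * L))) \<le> real s * (- L / 6)"
        by (simp add: algebra_simps)
      then show ?thesis by (simp only: exp_le_cancel_iff flip: exp_of_nat_mult)
    qed
    finally have "?Z \<le> exp (- L / 6) ^ s * \<N>" by (simp add: mult_right_mono)
    also have "\<dots> \<le> (of_bool (s = 1) * (m * exp (- L)) + of_bool (s \<ge> 2) * exp (- L / 6) ^ s + exp (- (m / 72)) + (4 / 7) ^ m) * \<N>"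
      using fine(1) by (intro mult_right_mono) auto
    finally show ?thesis .
  next
    case mid
    have e288: "ln (288::real) \<le> 9"
    proof -
      have "(288::real) \<le> 2 ^ 9" by simp
      also have "\<dots> \<le> exp 1 ^ 9" using exp_ge_add_one_self[of 1] by (intro power_mono) auto
      also have "\<dots> = exp 9" by (simp flip: exp_of_nat_mult)
      finally have "ln (288::real) \<le> ln (exp 9)" by (subst ln_le_cancel_iff) auto
      then show ?thesis by simp
    qed
    \<comment> \<open>From \<open>\<mu> \<le> 100\<close> and the size of L, s is at most
      \<open>m / 300000\<close>, so the entropy terms linear in s are negligible. The choice x =
      1/288 makes both binomials together cost \<open>m / 144\<close> against a decay of
      \<open>m / 36\<close>.\<close>
    have sL: "real s * L \<le> 100 * real m"
      using mid(2) mult_right_mono[of "\<mu>" 100 "real m"] by (simp add: \<mu>_def p(3) mult_ac)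
    have "real s * 30000000 \<le> real s * L" using L(3) by (intro mult_left_mono) auto
    then have s_le: "real s * 300000 \<le> real m" using sL by linarith
    have "real (m choose j) \<le> exp (real m / 288 + 9 * real s)" if "j \<le> s" for j
    proof -
      have "real (m choose j) \<le> exp (1/288 * real m + ln (1 / (1/288)) * real j)" by (rule binomial_le_exp) auto
      also have "\<dots> \<le> exp (real m / 288 + 9 * real s)"
        using e288 that mult_mono[OF e288, of "real j" "real s"] by simp
      finally show ?thesis .
    qed
    then have c: "real (m choose s) \<le> exp (real m / 288 + 9 * real s)" "real (m choose (s - 1)) \<le> exp (real m / 288 + 9 * real s)"
      by simp_all
    have "1/18 \<le> \<mu> / (1 + real s * q)"
    proof -
      have "1 + real s * q \<le> 18 * \<mu>" using sq(2) mid(1) by linarith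
      then show ?thesis using sq(1) by (simp add: field_simps)
    qed
    moreover have "real m / 2 \<le> real (m + 1 - s)" using s sm by linarith
    ultimately have rr: "\<rho> ^ (m + 1 - s) \<le> exp (- (1/18 * (real m / 2)))" by (intro \<rho>_exp) auto
    have "?Z \<le> (exp (real m / 288 + 9 * real s) * exp (real m / 288 + 9 * real s) * exp (- (1/18 * (real m / 2)))) * \<N>"
      using crude by (rule order_trans) (intro mult_right_mono mult_mono c rr, use \<rho>0 in auto)
    also have "\<dots> = exp (real m / 144 + 18 * real s - real m / 36) * \<N>"
      by (simp add: field_simps flip: exp_add)
    also have "\<dots> \<le> exp (- (m / 72)) * \<N>"
      using s_le by (intro mult_right_mono) auto
    also have "\<dots> \<le> (of_bool (s = 1) * (m * exp (- L)) + of_bool (s \<ge> 2) * exp (- L / 6) ^ s + exp (- (m / 72)) + (4 / 7) ^ m) * \<N>"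
      by (intro mult_right_mono) auto
    finally show ?thesis .
  next
    case big
    \<comment> \<open>Choosing S and T costs at most \<open>4 ^ m\<close> and only about
      \<open>m / 2\<close> columns are guaranteed, so the rate must lie below 1/16. The value 1/49
      is available since \<open>\<mu> > 100\<close> and \<open>\<eta> = 1 / 500\<close>, and its
      square root gives the ratio 4/7.\<close>
    have "\<rho> \<le> 1 / 49"
    proof -
      have "48/49 * (1 + z) \<le> \<mu>" if "z \<le> (101/100) * \<mu>" for z using that big by (simp add: field_simps)
      then have "48/49 * (1 + real s * q) \<le> \<mu>" using sq(2) by blast
      then have "48/49 \<le> \<mu> / (1 + real s * q)" using sq(1) by (simp add: field_simps)
      then show ?thesis by (simp add: \<rho>_eq)
    qed
    then have "\<rho> ^ (m + 1 - s) \<le> (1 / 49) ^ (m + 1 - s)" using \<rho>0 by (intro power_mono)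
    also have "\<dots> = (1 / 7) ^ (2 * (m + 1 - s))" by (simp add: power_mult power2_eq_square)
    also have "\<dots> \<le> (1 / 7) ^ m" using s by (intro power_decreasing) auto
    finally have rr: "\<rho> ^ (m + 1 - s) \<le> (1 / 7) ^ m" .
    have c: "real (m choose j) \<le> 2 ^ m" for j
      using of_nat_mono[OF binomial_le_pow2[of m j], where 'a = real] by simp
    have "?Z \<le> (2 ^ m * 2 ^ m * (1 / 7) ^ m) * \<N>"
      using crude by (rule order_trans) (intro mult_right_mono mult_mono c rr, use \<rho>0 in auto)
    also have "2 ^ m * 2 ^ m * (1 / 7) ^ m = (4 / 7 :: real) ^ m" by (simp flip: power_mult_distrib)
    also have "(4 / 7) ^ m * \<N> \<le> (of_bool (s = 1) * (m * exp (- L)) + of_bool (s \<ge> 2) * exp (- L / 6) ^ s + exp (- (m / 72)) + (4 / 7) ^ m) * \<N>"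
      by (intro mult_right_mono) auto
    finally show ?thesis .
  qed
qed

lemma sum_violating_sparse:
  assumes AB: "A \<subseteq> R" "B \<subseteq> C" "card A = m" "card B = m" and r: "r \<le> card C"
    and small: "2 * density + m / card R + m / card C \<le> 1 / 500"
    and L: "L = density * m" "real m \<le> exp L" "L \<ge> 30000000" "3 + 2 * ln L \<le> L / 6"
  shows "(\<Sum>s | 1 \<le> s \<and> 2 * s \<le> m + 1. real (card {E \<in> \<B>. violating A B s E}))
    \<le> (m * exp (- L) + 2 * exp (- L / 3) + m * exp (- (m / 72)) + m * (4 / 7) ^ m) * \<N>"
proof -
  let ?J = "{s. 1 \<le> s \<and> 2 * s \<le> m + 1}"
  define q where "q = exp (- L / 6)"
  have J: "?J \<subseteq> {1..m}" by auto
  have finJ: "finite ?J" using J by (rule finite_subset) simp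
  have cJ: "real (card ?J) \<le> real m" using card_mono[OF _ J] by simp
  have "q \<le> exp (- 1)" using L(3) by (simp add: q_def)
  also have "exp (- 1 :: real) \<le> 1 / 2" using exp_ge_add_one_self[of 1] by (simp add: exp_minus field_simps)
  finally have q: "0 < q" "q \<le> 1 / 2" by (simp_all add: q_def)
  have S1: "(\<Sum>s\<in>?J. of_bool (s = 1) * (m * exp (- L))) \<le> m * exp (- L)"
  proof -
    have "(\<Sum>s\<in>?J. of_bool (s = 1) * (m * exp (- L))) \<le> (\<Sum>s\<in>{1..m}. of_bool (s = 1) * (m * exp (- L)))"
      using J by (intro sum_mono2) auto
    also have "\<dots> \<le> m * exp (- L)" by (cases "m \<ge> 1") (auto simp: of_bool_def if_distrib[of "\<lambda>x. x * _"] cong: if_cong)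
    finally show ?thesis .
  qed
  have S2: "(\<Sum>s\<in>?J. of_bool (s \<ge> 2) * q ^ s) \<le> 2 * q\<^sup>2"
  proof -
    have "(\<Sum>s\<in>?J. of_bool (s \<ge> 2) * q ^ s) \<le> (\<Sum>s\<in>{..<Suc (Suc m)}. of_bool (s \<ge> 2) * q ^ s)"
      using q by (intro sum_mono2) auto
    also have "\<dots> = (\<Sum>i<m. q ^ (i + 2))"
      by (simp only: sum.lessThan_Suc_shift) simp
    also have "\<dots> = q\<^sup>2 * (\<Sum>i<m. q ^ i)" by (simp add: sum_distrib_left power_add power2_eq_square mult_ac)
    also have "(\<Sum>i<m. q ^ i) \<le> 2"
    proof -
      have "(\<Sum>i<m. q ^ i) = (1 - q ^ m) / (1 - q)" using q by (simp add: sum_gp_strict)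
      also have "\<dots> \<le> 1 / (1 / 2)" using q by (intro frac_le) auto
      finally show ?thesis by simp
    qed
    finally show ?thesis using q by (simp add: mult_left_mono mult.commute)
  qed
  have "(\<Sum>s\<in>?J. real (card {E \<in> \<B>. violating A B s E}))
      \<le> (\<Sum>s\<in>?J. (of_bool (s = 1) * (m * exp (- L)) + of_bool (s \<ge> 2) * q ^ s + exp (- (m / 72)) + (4 / 7) ^ m) * \<N>)"
    unfolding q_def by (rule sum_mono, rule card_violating_sparse[OF AB r small L]) auto
  also have "\<dots> = ((\<Sum>s\<in>?J. of_bool (s = 1) * (m * exp (- L))) + (\<Sum>s\<in>?J. of_bool (s \<ge> 2) * q ^ s)
      + card ?J * exp (- (m / 72)) + card ?J * (4 / 7) ^ m) * \<N>"
    by (simp only: sum.distrib sum_distrib_right[symmetric] sum_constant)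
  also have "\<dots> \<le> (m * exp (- L) + 2 * q\<^sup>2 + m * exp (- (m / 72)) + m * (4 / 7) ^ m) * \<N>"
    using S1 S2 cJ by (intro mult_right_mono add_mono) auto
  also have "q\<^sup>2 = exp (- L / 3)" by (simp add: q_def power2_eq_square flip: exp_add)
  finally show ?thesis .
qed

lemma card_unmatchable_le_sparse:
  assumes AB: "A \<subseteq> R" "B \<subseteq> C" "card A = m" "card B = m" and deg: "r \<le> card C" "c \<le> card R"
    and small: "2 * density + m / card R + m / card C \<le> 1 / 500"
    and L: "L = density * m" "real m \<le> exp L" "L \<ge> 30000000" "3 + 2 * ln L \<le> L / 6"
  shows "real (card {E \<in> \<B>. \<not> matchable A B E})
    \<le> 2 * (m * exp (- L) + 2 * exp (- L / 3) + m * exp (- (m / 72)) + m * (4 / 7) ^ m) * \<N>"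
proof -
  interpret conv: biregular_degrees C R c r by (rule converse_degrees)
  have ne: "R \<noteq> {}" "C \<noteq> {}"
    using L(1,3) AB by (auto simp: density_def)
  have dens: "conv.density = density" using density_eq_col[OF ne] by (simp add: conv.density_def)
  have "(\<Sum>s | 1 \<le> s \<and> 2 * s \<le> m + 1. real (card {E \<in> biregular_relations C R c r. violating B A s E}))
      \<le> (m * exp (- L) + 2 * exp (- L / 3) + m * exp (- (m / 72)) + m * (4 / 7) ^ m) * real (card (biregular_relations C R c r))"
    by (rule conv.sum_violating_sparse[OF AB(2,1,4,3) deg(2)]) (use small L dens in \<open>simp_all add: add_ac\<close>)
  moreover have "(\<Sum>s | 1 \<le> s \<and> 2 * s \<le> m + 1. real (card {E \<in> \<B>. violating A B s E}))
      \<le> (m * exp (- L) + 2 * exp (- L / 3) + m * exp (- (m / 72)) + m * (4 / 7) ^ m) * \<N>"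
    by (rule sum_violating_sparse[OF AB deg(1) small L])
  moreover have "card (biregular_relations C R c r) = card \<B>" by (rule card_biregular_relations_converse)
  ultimately show ?thesis using card_unmatchable_le_sum[OF AB] by (simp only: mult.assoc)
qed

text \<open>The cutoff j is a fraction \<open>\<nu>\<close> of m, small enough that choosing j
  vertices costs half of what a row gains by missing \<open>m - j\<close> columns, and still linear,
  so that blocks with both sides at least j gain a term quadratic in m.\<close>

lemma card_unmatchable_le_dense_exp:
  assumes AB: "A \<subseteq> R" "B \<subseteq> C" "card A = m" "card B = m" and deg: "r \<le> card C" "c \<le> card R"
    and ne: "R \<noteq> {}" "C \<noteq> {}"
    and \<delta>: "0 < \<delta>" "\<delta> \<le> density" and \<nu>: "0 < \<nu>" "\<nu> \<le> 1 / 2" "\<nu> * ln (8 / \<delta>) \<le> \<delta> / 8"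
    and m: "2 \<le> \<nu> * m"
  shows "real (card {E \<in> \<B>. \<not> matchable A B E})
    \<le> (2 * real m * exp (- \<delta> * real m / 4) + exp (real m * ln 4 + real (card C) * ln (real (card R) + 1) - \<delta> * \<nu>\<^sup>2 * (real m)\<^sup>2 / 4)) * \<N>"
proof -
  \<comment> \<open>The assumption \<open>2 \<le> \<nu> * m\<close> ensures that rounding down loses
    at most half.\<close>
  define j where "j = nat \<lfloor>\<nu> * m\<rfloor>"
  have j: "real j \<le> \<nu> * m" "real j \<ge> \<nu> * m / 2"
  proof -
    have "real j = of_int \<lfloor>\<nu> * m\<rfloor>" using m by (simp add: j_def)
    then show "real j \<le> \<nu> * m" "real j \<ge> \<nu> * m / 2" using m by linarith+
  qed
  have p1: "density \<le> 1" using deg by (simp add: density_def divide_le_eq)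
  have "\<nu> * m \<le> 1 / 2 * m" using \<nu>(2) by (intro mult_right_mono) auto
  then have j2: "real j \<le> m / 2" using j by linarith
  then have jm: "j \<le> m" by linarith
  have lnp: "0 \<le> ln (8 / \<delta>)" using \<delta> p1 by simp
  have pow: "(1 - density) ^ i \<le> exp (- (\<delta> * real i))" for i
  proof -
    have "(1 - density) ^ i \<le> exp (- (density * real i))" using p1 by (rule one_minus_power_le_exp)
    also have "\<dots> \<le> exp (- (\<delta> * real i))" using \<delta> by (simp add: mult_right_mono)
    finally show ?thesis .
  qed
  \<comment> \<open>With x = \<open>\<delta> / 8\<close> the term in m is half of the target
    \<open>\<delta> / 4 * m\<close>; the condition on \<open>\<nu> * ln (8 / \<delta>)\<close>
    bounds the term in j by the other half.\<close>
  have "real (m choose j) \<le> exp (\<delta> / 8 * m + ln (1 / (\<delta> / 8)) * j)"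
    by (rule binomial_le_exp) (use \<delta> p1 in auto)
  also have "\<dots> \<le> exp (\<delta> / 4 * m)"
  proof -
    have "ln (8 / \<delta>) * j \<le> ln (8 / \<delta>) * (\<nu> * m)" using j lnp by (intro mult_left_mono)
    also have "\<dots> = (\<nu> * ln (8 / \<delta>)) * m" by simp
    also have "\<dots> \<le> \<delta> / 8 * m" using \<nu>(3) by (intro mult_right_mono) auto
    finally show ?thesis by simp
  qed
  finally have 1: "real (m choose j) \<le> exp (\<delta> / 4 * m)" .
  have 2: "(1 - density) ^ (m - j) \<le> exp (- (\<delta> / 2 * m))"
  proof -
    have "\<delta> * (m / 2) \<le> \<delta> * real (m - j)" using j2 jm \<delta> by (intro mult_left_mono) (auto simp: of_nat_diff)
    then show ?thesis using pow[of "m - j"] by (smt (verit) exp_le_cancel_iff times_divide_eq_left times_divide_eq_right)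
  qed
  have 3: "(1 - density) ^ (j * j) \<le> exp (- (\<delta> * \<nu>\<^sup>2 * (real m)\<^sup>2 / 4))"
  proof -
    have "(\<nu> * m / 2) * (\<nu> * m / 2) \<le> real j * real j" using j m by (intro mult_mono) auto
    then have "\<delta> * ((\<nu> * m / 2) * (\<nu> * m / 2)) \<le> \<delta> * (real j * real j)" using \<delta> by (intro mult_left_mono) auto
    then have "\<delta> * \<nu>\<^sup>2 * (real m)\<^sup>2 / 4 \<le> \<delta> * real (j * j)" by (simp add: power2_eq_square mult_ac)
    then show ?thesis using pow[of "j * j"] by (smt (verit) exp_le_cancel_iff)
  qed
  have "2 * (real m * (real (m choose j) * (1 - density) ^ (m - j)))
      \<le> 2 * (real m * (exp (\<delta> / 4 * m) * exp (- (\<delta> / 2 * m))))"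
    using 1 2 p1 by (intro mult_left_mono mult_mono) auto
  also have "\<dots> = 2 * real m * exp (- \<delta> * real m / 4)" by (simp add: field_simps flip: exp_add)
  finally have A1: "2 * (real m * (real (m choose j) * (1 - density) ^ (m - j))) \<le> 2 * real m * exp (- \<delta> * real m / 4)" .
  have e: "(4::real) ^ m = exp (real m * ln 4)" "real (card R + 1) ^ card C = exp (real (card C) * ln (real (card R) + 1))"
    by (simp_all add: exp_of_nat_mult add.commute)
  have "4 ^ m * ((1 - density) ^ (j * j) * real (card R + 1) ^ card C)
      \<le> 4 ^ m * (exp (- (\<delta> * \<nu>\<^sup>2 * (real m)\<^sup>2 / 4)) * real (card R + 1) ^ card C)"
    using 3 by (intro mult_left_mono mult_right_mono) auto
  also have "\<dots> = exp (real m * ln 4 + real (card C) * ln (real (card R) + 1) - \<delta> * \<nu>\<^sup>2 * (real m)\<^sup>2 / 4)"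
    unfolding e by (simp add: mult_ac add_ac flip: exp_add)
  finally have A2: "4 ^ m * ((1 - density) ^ (j * j) * real (card R + 1) ^ card C)
      \<le> exp (real m * ln 4 + real (card C) * ln (real (card R) + 1) - \<delta> * \<nu>\<^sup>2 * (real m)\<^sup>2 / 4)" .
  show ?thesis
    using card_unmatchable_le_dense[OF AB deg jm ne]
    by (rule order_trans) (use A1 A2 in \<open>intro mult_right_mono add_mono\<close>, auto)
qed

section \<open>Below the threshold\<close>

lemma matchable_not_isolated:
  assumes "matchable A B E" "y \<in> A"
  shows "E `` {y} \<inter> B \<noteq> {}"
  using assms unfolding matchable_def by blast

lemma isolation_rate:
  assumes "i < r" "r < card C"
  shows "real r / real (card C - i) \<le> density / (1 - density)"
proof -
  have "real r / real (card C - i) \<le> real r / (real (card C) - real r)"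
    using assms by (intro frac_le) (auto simp: of_nat_diff)
  also have "\<dots> = density / (1 - density)" using assms by (simp add: density_def field_simps)
  finally show ?thesis .
qed

text \<open>One vertex y of A suffices. It has \<open>density * r\<close> edges into B on average,
  and Bernoulli's inequality for the exact isolation product bounds the probability of any such edge
  by twice that. This is used for constant degree, where the average tends to zero.\<close>

lemma card_matchable_le_rare:
  assumes AB: "A \<subseteq> R" "B \<subseteq> C" "A \<noteq> {}" "card B = r" and p: "density \<le> 1 / 2" and C: "C \<noteq> {}"
  shows "real (card {E \<in> \<B>. matchable A B E}) \<le> 2 * (density * r) * \<N>"
proof -
  obtain y where y: "y \<in> A" using AB by blast
  define a where "a = density / (1 - density)"
  have p0: "density \<ge> 0" by (simp add: density_def)
  have Cpos: "card C > 0" using C finite_cols by (simp add: card_gt_0_iff)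
  then have rC: "r < card C" using p by (simp add: density_def field_simps)
  have a: "0 \<le> a" "a \<le> 2 * density" "a \<le> 1"
  proof -
    have "density * 1 \<le> density * (2 * (1 - density))" using p p0 by (intro mult_left_mono) auto
    then show "0 \<le> a" "a \<le> 2 * density" using p p0 by (auto simp: a_def divide_le_eq algebra_simps)
    then show "a \<le> 1" using p by linarith
  qed
  have "isolation r \<ge> (1 - a) ^ r"
    by (rule isolation_bounds) (use isolation_rate rC a in \<open>auto simp: a_def\<close>)
  moreover have "(1 - a) ^ r \<ge> 1 - r * a"
    using Bernoulli_inequality[of "- a" r] a by simp
  moreover have "real r * a \<le> real r * (2 * density)" using a by (intro mult_left_mono) auto
  ultimately have iso: "1 - isolation r \<le> 2 * (density * r)" by (simp add: mult_ac)
  have W: "real (card (\<W> {y} B)) = isolation r * \<N>"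
    using card_avoiding_singleton[of y B] y AB by (auto simp: isolation_def)
  have "{E \<in> \<B>. matchable A B E} \<subseteq> \<B> - \<W> {y} B"
    using matchable_not_isolated[OF _ y] by (auto simp: avoiding_def)
  then have "card {E \<in> \<B>. matchable A B E} \<le> card (\<B> - \<W> {y} B)"
    using finite_\<B> by (intro card_mono) auto
  also have "\<dots> = card \<B> - card (\<W> {y} B)"
    using finite_\<W> by (intro card_Diff_subset) (auto simp: avoiding_def)
  finally have "real (card {E \<in> \<B>. matchable A B E}) \<le> \<N> - real (card (\<W> {y} B))"
    using card_mono[OF finite_\<B>, of "\<W> {y} B"] by (auto simp: avoiding_def of_nat_diff)
  also have "\<dots> = (1 - isolation r) * \<N>" by (simp add: W algebra_simps)
  also have "\<dots> \<le> 2 * (density * r) * \<N>" using iso by (intro mult_right_mono) auto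
  finally show ?thesis .
qed

text \<open>The expected number of isolated vertices is about \<open>exp (ln r - L)\<close>, and all
  corrections are multiples of \<open>density * L\<close>. This quantity tends to zero below the
  threshold, so both summands vanish once \<open>L - ln r\<close> tends to minus infinity.\<close>

lemma card_matchable_le:
  assumes AB: "A \<subseteq> R" "B \<subseteq> C" "card A = r" "card B = r" and r: "r \<ge> 1" and p: "density \<le> 1 / 10"
    and R: "card R \<ge> 20" and L: "L = density * r"
  shows "real (card {E \<in> \<B>. matchable A B E})
    \<le> (exp (L - ln r + 10 * (density * L)) + (exp (8 * (density * L)) - 1)) * \<N>"
proof -
  define p where "p = density"
  define a where "a = p / (1 - p)"
  have Bne: "B \<noteq> {}" using AB r by auto
  then have Cpos: "card C > 0" using AB finite_cols by (metis card_gt_0_iff subset_empty)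
  have rC: "r < card C" using p Cpos by (simp add: density_def field_simps)
  have p': "p > 0" "p \<le> 1 / 10" using p r Cpos by (auto simp: p_def density_def)
  have a: "0 \<le> a" "a \<le> p + 2 * p\<^sup>2" "a \<le> (10/9) * p" "a \<le> 1/4"
  proof -
    show "0 \<le> a" using p' by (simp add: a_def)
    have "p * 1 \<le> p * ((10/9) * (1 - p))" using p' by (intro mult_left_mono) auto
    then show a2: "a \<le> (10/9) * p" using p' by (simp add: a_def divide_le_eq mult_ac)
    then show "a \<le> 1/4" using p' by linarith
    have "0 \<le> p\<^sup>2 * (1 - 2 * p)" using p' by simp
    then have "p \<le> (p + 2 * p\<^sup>2) * (1 - p)" by (simp add: power2_eq_square algebra_simps)
    then show "a \<le> p + 2 * p\<^sup>2" using p' by (simp add: a_def divide_le_eq)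
  qed
  have rate: "real r / real (card C - i) \<le> a" if "i < r" for i
    using isolation_rate[OF that rC] by (simp add: a_def p_def)
  have a2: "a * a \<le> 2 * p\<^sup>2"
  proof -
    have "a * a \<le> ((10/9) * p) * ((10/9) * p)" using a by (intro mult_mono) auto
    also have "\<dots> \<le> 2 * p\<^sup>2" by (simp add: power2_eq_square)
    finally show ?thesis .
  qed
  \<comment> \<open>A second-order bound on the logarithm is needed: since a exceeds p only by a
    multiple of the square of p, raising to the power r reproduces L up to a multiple of
    \<open>p * L\<close>, rather than a constant multiple of L.\<close>
  have "exp (- (L + 10 * (p * L))) \<le> exp (ln (1 - a) * r)"
  proof -
    have "- a - 2 * a\<^sup>2 \<le> ln (1 - a)" using a by (intro ln_one_minus_pos_lower_bound) auto
    moreover have "a + 2 * a\<^sup>2 \<le> p + 10 * p\<^sup>2" using a(2) a2 zero_le_power2[of p] unfolding power2_eq_square[of a] by linarith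
    ultimately have "- (p + 10 * p\<^sup>2) \<le> ln (1 - a)" by linarith
    then have "- (p + 10 * p\<^sup>2) * r \<le> ln (1 - a) * r" by (intro mult_right_mono) auto
    then show ?thesis by (simp add: L p_def power2_eq_square algebra_simps)
  qed
  also have "\<dots> = (1 - a) ^ r" using a by (simp add: exp_of_nat2_mult)
  also have "\<dots> \<le> isolation r" by (rule isolation_bounds) (use rate a in auto)
  finally have iso: "exp (- (L + 10 * (p * L))) \<le> isolation r" .
  have \<mu>: "exp (ln r - (L + 10 * (p * L))) \<le> r * isolation r"
  proof -
    have "exp (ln r - (L + 10 * (p * L))) = r * exp (- (L + 10 * (p * L)))"
      using r by (simp only: diff_conv_add_uminus exp_add) simp
    also have "\<dots> \<le> r * isolation r" using iso by (intro mult_left_mono) auto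
    finally show ?thesis .
  qed
  have \<mu>0: "0 < r * isolation r" using \<mu> exp_gt_zero by (rule less_le_trans[rotated])
  \<comment> \<open>The three summands are at most 1/5, 1/10 and 1/10, so
    \<open>\<eta> = 1 / 2\<close> suffices; here switchings affect only a lower-order term.\<close>
  have small: "2 * density + 2 / card R + card B / card C \<le> 1 / 2"
  proof -
    have "2 / real (card R) \<le> 2 / 20" using R by (intro frac_le) auto
    moreover have "card B / card C = density" using AB by (simp add: density_def)
    ultimately show ?thesis using p by linarith
  qed
  have "{E \<in> \<B>. matchable A B E} \<subseteq> {E \<in> \<B>. \<forall>y\<in>A. E `` {y} \<inter> B \<noteq> {}}"
  proof (intro subsetI CollectI conjI ballI)
    fix E y assume "E \<in> {E \<in> \<B>. matchable A B E}" "y \<in> A"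
    then show "E `` {y} \<inter> B \<noteq> {}" by (intro matchable_not_isolated) auto
  qed simp
  then have "real (card {E \<in> \<B>. matchable A B E}) \<le> real (card {E \<in> \<B>. \<forall>y\<in>A. E `` {y} \<inter> B \<noteq> {}})"
    using finite_\<B> by (intro of_nat_mono card_mono) auto
  also have "\<dots> \<le> (1 / (real (card A) * isolation (card B)) + ((1 + 2 * (density / (1 - 1 / 2)) * a) ^ card B - 1)) * \<N>"
    by (rule card_no_isolated_le) (use AB small rate a \<mu>0 in auto)
  also have "\<dots> \<le> (exp (L - ln r + 10 * (p * L)) + (exp (8 * (p * L)) - 1)) * \<N>"
  proof (intro mult_right_mono add_mono diff_right_mono)
    have "1 / (r * isolation r) \<le> 1 / exp (ln r - (L + 10 * (p * L)))"
      using \<mu> by (intro frac_le) auto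
    also have "\<dots> = exp (- (ln r - (L + 10 * (p * L))))" by (simp only: exp_minus inverse_eq_divide)
    also have "- (ln r - (L + 10 * (p * L))) = L - ln r + 10 * (p * L)" by simp
    finally show "1 / (real (card A) * isolation (card B)) \<le> exp (L - ln r + 10 * (p * L))"
      by (simp only: AB)
    have "2 * (density / (1 - 1 / 2)) * a = 4 * p * a" by (simp add: p_def)
    also have "\<dots> \<le> 4 * p * ((10/9) * p)" using a p' by (intro mult_left_mono) auto
    also have "\<dots> \<le> 8 * p\<^sup>2" by (simp add: power2_eq_square)
    finally have "1 + 2 * (density / (1 - 1 / 2)) * a \<le> exp (8 * p\<^sup>2)"
      using exp_ge_add_one_self[of "8 * p\<^sup>2"] by linarith
    then have "(1 + 2 * (density / (1 - 1 / 2)) * a) ^ r \<le> exp (8 * p\<^sup>2) ^ r"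
      using a p' by (intro power_mono) (auto simp: p_def)
    also have "\<dots> = exp (8 * (p * L))" by (simp add: L p_def power2_eq_square mult_ac flip: exp_of_nat2_mult)
    finally show "(1 + 2 * (density / (1 - 1 / 2)) * a) ^ card B \<le> exp (8 * (p * L))" by (simp only: AB)
  qed simp
  finally show ?thesis by (simp only: p_def)
qed

end

section \<open>From digraphs and matchings to relations and injections\<close>

lemma card_digraphs_eq_relations:
  assumes fin: "finite Y" "finite Z" and disj: "Y \<inter> Z = {}" and m: "of_nat m = k * of_nat d"
  shows "card {G \<in> biregular_digraphs k Y Z d. P (parcs G)} = card {E \<in> biregular_relations Y Z m d. P E}"
    and "finite (biregular_digraphs k Y Z d)"
proof -
  have out: "out_degree (with_proj G) y = card (parcs G `` {y})" for G :: "'a pair_pre_digraph" and y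
  proof -
    have "out_arcs (with_proj G) y = Pair y ` (parcs G `` {y})" by (auto simp: out_arcs_def)
    then show ?thesis by (simp add: out_degree_def card_image inj_on_def)
  qed
  have "in": "in_degree (with_proj G) z = card ((parcs G)\<inverse> `` {z})" for G :: "'a pair_pre_digraph" and z
  proof -
    have "in_arcs (with_proj G) z = (\<lambda>y. (y, z)) ` ((parcs G)\<inverse> `` {z})" by (auto simp: in_arcs_def)
    then show ?thesis by (simp add: in_degree_def card_image inj_on_def)
  qed
  have eq: "of_nat x = k * of_nat d \<longleftrightarrow> x = m" for x :: nat
    using m by (metis of_nat_eq_iff)
  have mem: "G \<in> biregular_digraphs k Y Z d \<longleftrightarrow> pverts G = Y \<union> Z \<and> parcs G \<in> biregular_relations Y Z m d" for G
    by (auto simp: biregular_digraphs_def biregular_relations_def out "in" eq)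
  have bij: "bij_betw parcs {G \<in> biregular_digraphs k Y Z d. P (parcs G)} {E \<in> biregular_relations Y Z m d. P E}" for P
    by (rule bij_betw_byWitness[where f' = "\<lambda>E. \<lparr>pverts = Y \<union> Z, parcs = E\<rparr>"]) (auto simp: mem)
  show "card {G \<in> biregular_digraphs k Y Z d. P (parcs G)} = card {E \<in> biregular_relations Y Z m d. P E}"
    using bij by (rule bij_betw_same_card)
  have "finite {E \<in> biregular_relations Y Z m d. True}" using finite_biregular_relations[OF fin] by simp
  then show "finite (biregular_digraphs k Y Z d)" using bij[of "\<lambda>_. True"] by (simp add: bij_betw_finite)
qed

text \<open>Disjoint edges have distinct tails and distinct heads, so \<open>card A\<close> of them
  use every vertex of A as a tail and form the graph of an injection. Conversely, disjointness of A
  and B keeps the head of one edge away from the tail of another.\<close>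

lemma perfect_matching_iff_matchable:
  assumes fin: "finite A" and "A \<inter> B = {}"
  shows "(\<exists>M. perfect_matching (with_proj G \<restriction> (A \<union> B)) A B M) \<longleftrightarrow> matchable A B (parcs G)"
proof
  assume "\<exists>M. perfect_matching (with_proj G \<restriction> (A \<union> B)) A B M"
  then obtain M where M: "perfect_matching (with_proj G \<restriction> (A \<union> B)) A B M" by blast
  have sub: "M \<subseteq> parcs G" "finite M" "card M = card A"
    and AB: "\<And>e. e \<in> M \<Longrightarrow> fst e \<in> A \<and> snd e \<in> B"
    and dj: "\<And>e f. e \<in> M \<Longrightarrow> f \<in> M \<Longrightarrow> e \<noteq> f \<Longrightarrow> {fst e, snd e} \<inter> {fst f, snd f} = {}"
    using M by (auto simp: perfect_matching_def induce_subgraph_def)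
  have inj: "inj_on fst M" "inj_on snd M"
    by (rule inj_onI, use dj in blast)+
  have "fst ` M = A"
    using AB fin sub inj by (intro card_subset_eq) (auto simp: card_image)
  then have "\<forall>a\<in>A. \<exists>b. (a, b) \<in> M" by force
  then obtain f where f: "\<forall>a\<in>A. (a, f a) \<in> M" by metis
  have "inj_on f A"
  proof (rule inj_onI)
    fix a a' assume "a \<in> A" "a' \<in> A" "f a = f a'"
    then have "(a, f a) = (a', f a')" using f by (intro inj_onD[OF inj(2)]) auto
    then show "a = a'" by simp
  qed
  then show "matchable A B (parcs G)"
    unfolding matchable_def using f AB sub by (intro exI[of _ f]) force
next
  assume "matchable A B (parcs G)"
  then obtain f where f: "inj_on f A" "\<And>a. a \<in> A \<Longrightarrow> f a \<in> B \<and> (a, f a) \<in> parcs G"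
    unfolding matchable_def by blast
  let ?M = "(\<lambda>a. (a, f a)) ` A"
  have "perfect_matching (with_proj G \<restriction> (A \<union> B)) A B ?M"
    unfolding perfect_matching_def
  proof (intro conjI ballI impI)
    show "?M \<subseteq> arcs (with_proj G \<restriction> (A \<union> B))" using f(2) by (auto simp: induce_subgraph_def)
    show "card ?M = card A" by (simp add: card_image inj_on_def)
    fix e g assume eg: "e \<in> ?M" "g \<in> ?M" "e \<noteq> g"
    then obtain a a' where a: "a \<in> A" "a' \<in> A" "e = (a, f a)" "g = (a', f a')" "a \<noteq> a'" by auto
    have "f a \<noteq> f a'" using a f(1) by (auto dest: inj_onD)
    moreover have "a \<noteq> f a'" "f a \<noteq> a'" using a f(2) assms(2) by (auto simp: disjoint_iff)
    ultimately show "{tail (with_proj G \<restriction> (A \<union> B)) e, head (with_proj G \<restriction> (A \<union> B)) e} \<inter>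
        {tail (with_proj G \<restriction> (A \<union> B)) g, head (with_proj G \<restriction> (A \<union> B)) g} = {}"
      using a by (simp add: induce_subgraph_def)
  qed (use fin f(2) in \<open>auto simp: induce_subgraph_def\<close>)
  then show "\<exists>M. perfect_matching (with_proj G \<restriction> (A \<union> B)) A B M" by blast
qed

lemma prob_perfect_matching:
  assumes fin: "finite Y" "finite Z" and disj: "Y \<inter> Z = {}" and m: "of_nat m = k * of_nat d"
    and AB: "A \<subseteq> Y" "B \<subseteq> Z" and ne: "card (biregular_relations Y Z m d) > 0"
  shows "measure_pmf.prob (random_biregular_digraph k Y Z d)
      {G. \<exists>M. perfect_matching (with_proj G \<restriction> (A \<union> B)) A B M}
      = real (card {E \<in> biregular_relations Y Z m d. matchable A B E}) / real (card (biregular_relations Y Z m d))"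
    and "measure_pmf.prob (random_biregular_digraph k Y Z d)
      {G. \<nexists>M. perfect_matching (with_proj G \<restriction> (A \<union> B)) A B M}
      = real (card {E \<in> biregular_relations Y Z m d. \<not> matchable A B E}) / real (card (biregular_relations Y Z m d))"
proof -
  have AB': "finite A" "A \<inter> B = {}" using fin disj AB finite_subset by blast+
  note cde = card_digraphs_eq_relations[OF fin disj m]
  have c: "card (biregular_digraphs k Y Z d) = card (biregular_relations Y Z m d)"
    using cde(1)[of "\<lambda>_. True"] by simp
  then have ne': "biregular_digraphs k Y Z d \<noteq> {}" using ne by auto
  have *: "measure_pmf.prob (random_biregular_digraph k Y Z d) {G. P (parcs G)}
      = real (card {E \<in> biregular_relations Y Z m d. P E}) / real (card (biregular_relations Y Z m d))" for P
  proof -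
    have "biregular_digraphs k Y Z d \<inter> {G. P (parcs G)} = {G \<in> biregular_digraphs k Y Z d. P (parcs G)}" by blast
    then show ?thesis
      unfolding random_biregular_digraph_def measure_pmf_of_set[OF ne' cde(2)] c cde(1)[of P, symmetric] by simp
  qed
  show "measure_pmf.prob (random_biregular_digraph k Y Z d)
      {G. \<exists>M. perfect_matching (with_proj G \<restriction> (A \<union> B)) A B M}
      = real (card {E \<in> biregular_relations Y Z m d. matchable A B E}) / real (card (biregular_relations Y Z m d))"
    unfolding perfect_matching_iff_matchable[OF AB'] by (rule *)
  show "measure_pmf.prob (random_biregular_digraph k Y Z d)
      {G. \<nexists>M. perfect_matching (with_proj G \<restriction> (A \<union> B)) A B M}
      = real (card {E \<in> biregular_relations Y Z m d. \<not> matchable A B E}) / real (card (biregular_relations Y Z m d))"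
    unfolding perfect_matching_iff_matchable[OF AB'] by (rule *)
qed

section \<open>The threshold\<close>

lemma tendsto_prob_one:
  assumes "\<forall>\<^sub>F n in F. measure_pmf.prob (M n) {x. \<not> P n x} \<le> b n" "(b \<longlongrightarrow> 0) F"
  shows "((\<lambda>n. measure_pmf.prob (M n) {x. P n x}) \<longlongrightarrow> 1) F"
proof (rule tendsto_sandwich)
  have compl: "measure_pmf.prob (M n) {x. P n x} = 1 - measure_pmf.prob (M n) {x. \<not> P n x}" for n
  proof -
    have "space (measure_pmf (M n)) - {x. \<not> P n x} = {x. P n x}" by auto
    then show ?thesis using measure_pmf.prob_compl[of "{x. \<not> P n x}" "M n"] by simp
  qed
  show "\<forall>\<^sub>F n in F. 1 - b n \<le> measure_pmf.prob (M n) {x. P n x}"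
    using assms(1) unfolding compl by eventually_elim simp
  show "\<forall>\<^sub>F n in F. measure_pmf.prob (M n) {x. P n x} \<le> 1" by simp
  show "((\<lambda>n. 1 - b n) \<longlongrightarrow> 1) F" using tendsto_diff[OF tendsto_const assms(2), of 1] by simp
qed simp

text \<open>The hypotheses at one fixed n. They hold eventually, so interpreting the locale under
  \<open>eventually_elim\<close> makes the finite bounds available pointwise.\<close>

locale bipartite_instance =
  fixes k :: rat and n d :: nat and Y Z A B :: "'a set"
  assumes k: "k > 0" and d: "1 \<le> d" "d \<le> n" and kd: "k * of_nat d \<le> of_nat n"
    and fin: "finite Y" "finite Z" and disj: "Y \<inter> Z = {}"
    and card_Y: "card Y = n" and card_Z: "of_nat (card Z) = k * of_nat n"
    and sub: "A \<subseteq> Y" "B \<subseteq> Z"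
    and card_A: "of_nat (card A) = k * of_nat d" and card_B: "of_nat (card B) = k * of_nat d"
begin

definition m :: nat where "m = card A"
definition L :: real where "L = of_rat k * real d ^ 2 / real n"

lemma card_AB: "card A = m" "card B = m"
proof -
  have "(of_nat (card B) :: rat) = of_nat (card A)" using card_A card_B by simp
  then show "card A = m" "card B = m" by (simp_all add: m_def)
qed

lemma real_m: "real m = of_rat k * real d"
  using arg_cong[OF card_A, of real_of_rat] by (simp add: m_def of_rat_mult)

lemma real_card_Z: "real (card Z) = of_rat k * real n"
  using arg_cong[OF card_Z, of real_of_rat] by (simp add: of_rat_mult)

lemma rk: "real_of_rat k > 0"
  using k by simp

lemma n_pos: "n > 0"
  using d by simp

lemma m_pos: "m \<ge> 1"
proof -
  have "real m > 0" using real_m rk d by simp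
  then show ?thesis by simp
qed

lemma ne: "Y \<noteq> {}" "Z \<noteq> {}" "A \<noteq> {}"
proof -
  show "A \<noteq> {}" using m_pos m_def by auto
  then show "Y \<noteq> {}" using sub by auto
  have "B \<noteq> {}" using m_pos card_AB by auto
  then show "Z \<noteq> {}" using sub by auto
qed

text \<open>The row degree is m, which is also the size of A and B. This is why
  \<open>card_matchable_le\<close> takes the sets to have cardinality r, and why
  \<open>L = density * m\<close>.\<close>

sublocale biregular_degrees Y Z m d
proof
  have "real (card Y * m) = real (card Z * d)" by (simp add: real_m real_card_Z card_Y)
  then show "card Y * m = card Z * d" by (simp only: of_nat_eq_iff)
qed (rule fin)+

lemma degrees: "m \<le> card Z" "d \<le> card Y"
  using card_mono[OF fin(2) sub(2)] d card_Y card_AB by auto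

lemma density: "density = real d / real n"
  using density_eq_col[OF ne(1,2)] card_Y by simp

lemma L_eq: "L = density * m"
  by (simp add: L_def density real_m power2_eq_square)

lemma m_le_n: "real m \<le> real n"
  using kd card_A unfolding m_def by (metis of_nat_le_iff)

lemma N_pos: "\<N> > 0"
  using card_biregular_relations_pos[OF degrees(1)] by simp

lemmas prob = prob_perfect_matching[OF fin disj card_A[folded m_def] sub]

end

theorem theorem1:
  fixes k :: rat and d :: "nat \<Rightarrow> nat" and Y Z A B :: "nat \<Rightarrow> 'a set"
  assumes "k > 0"
    and "\<forall>\<^sub>F n in integral_at_top k.
           1 \<le> d n \<and> d n \<le> n \<and> k * of_nat (d n) \<in> \<int> \<and> k * of_nat (d n) \<le> of_nat n"
    and "\<forall>\<^sub>F n in integral_at_top k.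
           finite (Y n) \<and> finite (Z n) \<and> Y n \<inter> Z n = {} \<and>
           card (Y n) = n \<and> of_nat (card (Z n)) = k * of_nat n"
    and "\<forall>\<^sub>F n in integral_at_top k.
           A n \<subseteq> Y n \<and> B n \<subseteq> Z n \<and>
           of_nat (card (A n)) = k * of_nat (d n) \<and> of_nat (card (B n)) = k * of_nat (d n)"
  shows "(filterlim (\<lambda>n. of_rat k * real (d n) ^ 2 / real n - ln (of_rat k * real (d n)))
            at_bot (integral_at_top k) \<or>
          (\<exists>c. \<forall>\<^sub>F n in integral_at_top k. d n = c) \<longrightarrow>
          ((\<lambda>n. measure_pmf.prob (random_biregular_digraph k (Y n) (Z n) (d n))
                  {G. \<nexists>M. perfect_matching (with_proj G \<restriction> (A n \<union> B n)) (A n) (B n) M})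
            \<longlongrightarrow> 1) (integral_at_top k)) \<and>
         (filterlim (\<lambda>n. of_rat k * real (d n) ^ 2 / real n - ln (of_rat k * real (d n)))
            at_top (integral_at_top k) \<longrightarrow>
          ((\<lambda>n. measure_pmf.prob (random_biregular_digraph k (Y n) (Z n) (d n))
                  {G. \<exists>M. perfect_matching (with_proj G \<restriction> (A n \<union> B n)) (A n) (B n) M})
            \<longlongrightarrow> 1) (integral_at_top k))"
proof -
  define F where "F = integral_at_top k"
  define \<kappa> where "\<kappa> = real_of_rat k"
  define L where "L n = \<kappa> * real (d n) ^ 2 / real n" for n
  define m where "m n = card (A n)" for n
  define p where "p n = real (d n) / real n" for n
  define t where "t n = L n - ln (\<kappa> * real (d n))" for n
  have \<kappa>: "\<kappa> > 0" using assms(1) by (simp add: \<kappa>_def)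
  have F: "F \<le> at_top" by (simp add: F_def integral_at_top_def)
  have ev_n: "\<forall>\<^sub>F n in F. P n" if "\<forall>\<^sub>F n in sequentially. P n" for P
    using that F by (rule filter_leD[rotated])
  have lim_n: "(f \<longlongrightarrow> l) F" if "f \<longlonglongrightarrow> l" for f :: "nat \<Rightarrow> real" and l
    using F that by (rule tendsto_mono)
  have inst: "\<forall>\<^sub>F n in F. bipartite_instance k n (d n) (Y n) (Z n) (A n) (B n)"
    using assms(2,3,4) unfolding F_def[symmetric]
    by eventually_elim (use assms(1) in \<open>simp add: bipartite_instance_def\<close>)
  have tr: "L n = bipartite_instance.L k n (d n)" "m n = bipartite_instance.m (A n)"
    "p n = biregular_degrees.density (Z n) (m n)" "real (m n) = \<kappa> * real (d n)" "t n = L n - ln (real (m n))"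
    if "bipartite_instance k n (d n) (Y n) (Z n) (A n) (B n)" for n
  proof -
    interpret I: bipartite_instance k n "d n" "Y n" "Z n" "A n" "B n" by (rule that)
    show "L n = bipartite_instance.L k n (d n)" by (simp add: L_def \<kappa>_def I.L_def)
    show m: "m n = bipartite_instance.m (A n)" by (simp add: m_def I.m_def)
    show "p n = biregular_degrees.density (Z n) (m n)" using I.density by (simp add: p_def m)
    show "real (m n) = \<kappa> * real (d n)" using I.real_m by (simp add: m \<kappa>_def)
    then show "t n = L n - ln (real (m n))" by (simp add: t_def)
  qed
  let ?prob = "\<lambda>n. measure_pmf.prob (random_biregular_digraph k (Y n) (Z n) (d n))"
  let ?PM = "\<lambda>n G. \<exists>M. perfect_matching (with_proj G \<restriction> (A n \<union> B n)) (A n) (B n) M"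

  \<comment> \<open>For constant d, L tends to zero while m stays fixed, so \<open>t\<close> has a
    finite limit and the isolated vertices do not become numerous. But a fixed vertex is isolated
    with probability tending to 1.\<close>
  have rare: "((\<lambda>n. ?prob n {G. \<not> ?PM n G}) \<longlongrightarrow> 1) F" if const: "\<forall>\<^sub>F n in F. d n = c" for c
  proof (rule tendsto_prob_one[where b = "\<lambda>n. 2 * (\<kappa> * real c ^ 2 / real n)"])
    show "((\<lambda>n. 2 * (\<kappa> * real c ^ 2 / real n)) \<longlongrightarrow> 0) F"
      by (rule lim_n) real_asymp
    have "\<forall>\<^sub>F n in F. 2 * c \<le> n" by (rule ev_n) (rule eventually_ge_at_top)
    with inst const show "\<forall>\<^sub>F n in F. ?prob n {G. \<not> \<not> ?PM n G} \<le> 2 * (\<kappa> * real c ^ 2 / real n)"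
    proof eventually_elim
      case (elim n)
      interpret I: bipartite_instance k n "d n" "Y n" "Z n" "A n" "B n" by (rule elim)
      have "I.density \<le> 1 / 2" using elim I.n_pos by (simp add: I.density field_simps)
      then have "real (card {E \<in> I.\<B>. matchable (A n) (B n) E}) \<le> 2 * (I.density * I.m) * I.\<N>"
        by (intro I.card_matchable_le_rare I.sub I.ne I.card_AB)
      also have "I.density * I.m = \<kappa> * real c ^ 2 / real n"
        using I.L_eq elim(2) unfolding I.L_def by (simp add: \<kappa>_def)
      finally show ?case using I.N_pos by (simp add: I.prob divide_le_eq)
    qed
  qed

  have below: "((\<lambda>n. ?prob n {G. \<not> ?PM n G}) \<longlongrightarrow> 1) F" if t: "filterlim t at_bot F"
  proof -
    have ev_t: "\<forall>\<^sub>F n in F. t n \<le> 0" using t by (simp add: filterlim_at_bot)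
    \<comment> \<open>Since L is nonnegative, \<open>t\<close> can tend to minus infinity only if
      \<open>ln m\<close>, and hence m, tends to infinity.\<close>
    have m_top: "filterlim (\<lambda>n. real (m n)) at_top F"
    proof (rule filterlim_at_top_mono)
      show "filterlim (\<lambda>n. - t n) at_top F" using t by (simp add: filterlim_uminus_at_bot)
      show "\<forall>\<^sub>F n in F. - t n \<le> real (m n)"
        using inst
      proof eventually_elim
        case (elim n)
        interpret I: bipartite_instance k n "d n" "Y n" "Z n" "A n" "B n" by (rule elim)
        have "real (m n) > 0" using I.m_pos tr(2)[OF elim] by simp
        then have "ln (real (m n)) \<le> real (m n)" using ln_bound by blast
        moreover have "L n \<ge> 0" using \<kappa> by (simp add: L_def)
        ultimately show ?case using tr(5)[OF elim] by linarith
      qed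
    qed
    have Lm: "\<forall>\<^sub>F n in F. 0 \<le> L n \<and> L n \<le> ln (real (m n)) \<and> p n = L n / real (m n) \<and> real (m n) > 0"
      using inst ev_t
    proof eventually_elim
      case (elim n)
      interpret I: bipartite_instance k n "d n" "Y n" "Z n" "A n" "B n" by (rule elim)
      have "real (m n) > 0" using I.m_pos tr(2)[OF elim(1)] by simp
      moreover have "L n = p n * real (m n)" using I.L_eq tr[OF elim(1)] by simp
      moreover have "L n \<ge> 0" using \<kappa> by (simp add: L_def)
      ultimately show ?case using tr(5)[OF elim(1)] elim(2) by simp
    qed
    \<comment> \<open>Here \<open>p * L\<close> equals the square of L divided by m, and L is at
      most \<open>ln m\<close>.\<close>
    have pL: "((\<lambda>n. p n * L n) \<longlongrightarrow> 0) F"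
    proof (rule tendsto_sandwich[where f = "\<lambda>_. 0" and h = "\<lambda>n. (ln (real (m n)))\<^sup>2 / real (m n)"])
      show "((\<lambda>n. (ln (real (m n)))\<^sup>2 / real (m n)) \<longlongrightarrow> 0) F"
        by (rule filterlim_compose[OF _ m_top, where g = "\<lambda>x. (ln x)\<^sup>2 / x"]) real_asymp
      show "\<forall>\<^sub>F n in F. 0 \<le> p n * L n" using Lm by eventually_elim simp
      show "\<forall>\<^sub>F n in F. p n * L n \<le> (ln (real (m n)))\<^sup>2 / real (m n)"
        using Lm
      proof eventually_elim
        case (elim n)
        then have "L n * L n \<le> ln (real (m n)) * ln (real (m n))" by (intro mult_mono) auto
        then show ?case using elim by (simp add: power2_eq_square divide_right_mono)
      qed
    qed simp
    have p0: "\<forall>\<^sub>F n in F. p n \<le> 1 / 10"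
    proof -
      have "((\<lambda>n. ln (real (m n)) / real (m n)) \<longlongrightarrow> 0) F"
        by (rule filterlim_compose[OF _ m_top, where g = "\<lambda>x. ln x / x"]) real_asymp
      then have "\<forall>\<^sub>F n in F. ln (real (m n)) / real (m n) < 1 / 10" by (rule order_tendstoD) simp
      with Lm show ?thesis
      proof eventually_elim
        case (elim n)
        then have "L n / real (m n) \<le> ln (real (m n)) / real (m n)" by (intro divide_right_mono) auto
        then show ?case using elim by linarith
      qed
    qed
    have e1: "((\<lambda>n. exp (t n + 10 * (p n * L n))) \<longlongrightarrow> 0) F"
    proof (rule filterlim_compose[OF exp_at_bot])
      have "((\<lambda>n. 10 * (p n * L n)) \<longlongrightarrow> 10 * 0) F" by (intro tendsto_intros pL)
      then show "filterlim (\<lambda>n. t n + 10 * (p n * L n)) at_bot F"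
        using filterlim_tendsto_add_at_bot_iff[of "\<lambda>n. 10 * (p n * L n)" "10 * 0" F t] t by (simp add: add.commute)
    qed
    have e2: "((\<lambda>n. exp (8 * (p n * L n)) - 1) \<longlongrightarrow> exp (8 * 0) - 1) F"
      by (intro tendsto_intros pL)
    show ?thesis
    proof (rule tendsto_prob_one[where b = "\<lambda>n. exp (t n + 10 * (p n * L n)) + (exp (8 * (p n * L n)) - 1)"])
      show "((\<lambda>n. exp (t n + 10 * (p n * L n)) + (exp (8 * (p n * L n)) - 1)) \<longlongrightarrow> 0) F"
        using tendsto_add[OF e1 e2] by simp
      have "\<forall>\<^sub>F n in F. 20 \<le> n" by (rule ev_n) (rule eventually_ge_at_top)
      with inst p0
      show "\<forall>\<^sub>F n in F. ?prob n {G. \<not> \<not> ?PM n G} \<le> exp (t n + 10 * (p n * L n)) + (exp (8 * (p n * L n)) - 1)"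
      proof eventually_elim
        case (elim n)
        interpret I: bipartite_instance k n "d n" "Y n" "Z n" "A n" "B n" by (rule elim)
        have eq: "I.m = m n" "biregular_degrees.density (Z n) (m n) = p n" "I.L = L n"
          using tr[OF elim(1)] by simp_all
        have "real (card {E \<in> I.\<B>. matchable (A n) (B n) E})
            \<le> (exp (L n - ln (m n) + 10 * (p n * L n)) + (exp (8 * (p n * L n)) - 1)) * I.\<N>"
          using I.card_matchable_le[OF I.sub I.card_AB I.m_pos _ _ I.L_eq] elim I.card_Y unfolding eq by simp
        then show ?case using I.N_pos tr(5)[OF elim(1)] by (simp add: I.prob divide_le_eq)
      qed
    qed
  qed

  have above: "((\<lambda>n. ?prob n {G. ?PM n G}) \<longlongrightarrow> 1) F" if t: "filterlim t at_top F"
  proof -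
    \<comment> \<open>On the instance, the switching loss \<open>2 p + m / n + m / (k n)\<close>
      equals \<open>(3 + \<kappa>) * p\<close>. The value of \<open>\<delta>\<close> makes this at
      most 1/500 exactly when \<open>p \<le> \<delta>\<close>.\<close>
    define \<delta> where "\<delta> = 1 / (500 * (3 + \<kappa>))"
    have \<delta>: "0 < \<delta>" "\<delta> < 1" "(3 + \<kappa>) * \<delta> = 1 / 500" using \<kappa> by (simp_all add: \<delta>_def divide_simps)
    define \<nu> where "\<nu> = min (1 / 2) (\<delta> / 8 / ln (8 / \<delta>))"
    have ln_pos: "ln (8 / \<delta>) > 0" using \<delta> by simp
    have \<nu>: "0 < \<nu>" "\<nu> \<le> 1 / 2" "\<nu> * ln (8 / \<delta>) \<le> \<delta> / 8"
    proof -
      show "0 < \<nu>" "\<nu> \<le> 1 / 2" using ln_pos \<delta> by (simp_all add: \<nu>_def)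
      have "\<nu> \<le> \<delta> / 8 / ln (8 / \<delta>)" by (simp add: \<nu>_def)
      then show "\<nu> * ln (8 / \<delta>) \<le> \<delta> / 8" using ln_pos by (simp add: pos_le_divide_eq)
    qed
    have mL: "\<forall>\<^sub>F n in F. t n \<le> L n \<and> L n \<le> real (m n)"
      using inst
    proof eventually_elim
      case (elim n)
      interpret I: bipartite_instance k n "d n" "Y n" "Z n" "A n" "B n" by (rule elim)
      have m1: "real (m n) \<ge> 1" using I.m_pos tr(2)[OF elim] by simp
      then have "t n \<le> L n" using tr(5)[OF elim] by simp
      moreover have "L n = p n * real (m n)" using I.L_eq tr[OF elim] by simp
      moreover have "p n \<le> 1" using I.d by (simp add: p_def divide_le_eq)
      ultimately show ?case using m1 mult_right_mono[of "p n" 1 "real (m n)"] by simp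
    qed
    have L_top: "filterlim L at_top F"
      by (rule filterlim_at_top_mono[OF t]) (use mL in \<open>auto elim: eventually_mono\<close>)
    have m_top: "filterlim (\<lambda>n. real (m n)) at_top F"
      by (rule filterlim_at_top_mono[OF L_top]) (use mL in \<open>auto elim: eventually_mono\<close>)
    \<comment> \<open>The density may oscillate around \<open>\<delta>\<close> along the sequence,
      so the sparse bound \<open>b1\<close> and the dense bound \<open>b2\<close> are added instead
      of splitting the limit. In \<open>b1\<close> the term \<open>m * exp (- L)\<close> is
      rewritten as \<open>exp (- t)\<close>, and \<open>powr\<close> allows composition with the
      limit of \<open>real (m n)\<close>.\<close>
    define b1 where "b1 n = 2 * (exp (- t n) + 2 * exp (- L n / 3) + m n * exp (- (m n / 72)) + m n * (4 / 7) powr m n)" for n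
    define b2 where "b2 n = 2 * real n * exp (- \<delta> * (\<kappa> * \<delta> * real n) / 4)
        + exp (real n * ln 4 + \<kappa> * real n * ln (real n + 1) - \<delta> * \<nu>\<^sup>2 * (\<kappa> * \<delta> * real n)\<^sup>2 / 4)" for n
    have b1: "(b1 \<longlongrightarrow> 2 * (0 + 2 * 0 + 0 + 0)) F"
      unfolding b1_def
    proof (intro tendsto_intros)
      show "((\<lambda>n. exp (- t n)) \<longlongrightarrow> 0) F"
        by (rule filterlim_compose[OF _ t, where g = "\<lambda>x. exp (- x)"]) real_asymp
      show "((\<lambda>n. exp (- L n / 3)) \<longlongrightarrow> 0) F"
        by (rule filterlim_compose[OF _ L_top, where g = "\<lambda>x. exp (- x / 3)"]) real_asymp
      show "((\<lambda>n. m n * exp (- (m n / 72))) \<longlongrightarrow> 0) F"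
        by (rule filterlim_compose[OF _ m_top, where g = "\<lambda>x. x * exp (- (x / 72))"]) real_asymp
      show "((\<lambda>n. m n * (4 / 7) powr m n) \<longlongrightarrow> 0) F"
        by (rule filterlim_compose[OF _ m_top, where g = "\<lambda>x. x * (4 / 7) powr x"]) real_asymp
    qed
    have b2: "(b2 \<longlongrightarrow> 0) F"
    proof (rule lim_n)
      \<comment> \<open>The cost of the column sums has order n times \<open>ln n\<close> in the
        exponent, and the quadratic gain from linear-sized blocks beats it.\<close>
      have "(\<lambda>n. 2 * real n * exp (- a * real n) + exp (real n * ln 4 + \<kappa> * real n * ln (real n + 1) - b * (real n)\<^sup>2)) \<longlonglongrightarrow> 0"
        if "a > 0" "b > 0" for a b :: real
        using that \<kappa> by real_asymp
      from this[of "\<delta> * (\<kappa> * \<delta>) / 4" "\<delta> * \<nu>\<^sup>2 * (\<kappa> * \<delta>)\<^sup>2 / 4"] \<delta> \<kappa> \<nu>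
      show "b2 \<longlonglongrightarrow> 0" unfolding b2_def by (simp add: power_mult_distrib mult_ac)
    qed
    have nonneg: "b1 n \<ge> 0" "b2 n \<ge> 0" for n by (simp_all add: b1_def b2_def)
    show ?thesis
    proof (rule tendsto_prob_one[where b = "\<lambda>n. b1 n + b2 n"])
      show "((\<lambda>n. b1 n + b2 n) \<longlongrightarrow> 0) F" using tendsto_add[OF b1 b2] by simp
      have evL: "\<forall>\<^sub>F n in F. L n \<ge> 30000000 \<and> 3 + 2 * ln (L n) \<le> L n / 6"
      proof (rule eventually_compose_filterlim[OF _ L_top])
        show "\<forall>\<^sub>F x in at_top. (x::real) \<ge> 30000000 \<and> 3 + 2 * ln x \<le> x / 6"
          by (intro eventually_conj eventually_ge_at_top) real_asymp
      qed
      have evn: "\<forall>\<^sub>F n in F. 2 \<le> \<nu> * (\<kappa> * \<delta> * real n)"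
        by (rule ev_n) (use \<nu> \<kappa> \<delta> in real_asymp)
      have evt: "\<forall>\<^sub>F n in F. t n \<ge> 0" using t by (simp add: filterlim_at_top)
      show "\<forall>\<^sub>F n in F. ?prob n {G. \<not> ?PM n G} \<le> b1 n + b2 n"
        using inst evL evn evt
      proof eventually_elim
        case (elim n)
        interpret I: bipartite_instance k n "d n" "Y n" "Z n" "A n" "B n" by (rule elim)
        have eq: "I.m = m n" "biregular_degrees.density (Z n) (m n) = p n" "I.L = L n"
          using tr[OF elim(1)] by simp_all
        have mpos: "real (m n) > 0" using I.m_pos eq by simp
        have pm: "real (m n) = \<kappa> * p n * real n" using tr(4)[OF elim(1)] I.n_pos by (simp add: p_def)
        let ?U = "real (card {E \<in> I.\<B>. \<not> matchable (A n) (B n) E})"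
        have "?U \<le> (b1 n + b2 n) * I.\<N>"
        proof (cases "p n \<le> \<delta>")
          case True
          have "real (m n) / real (card (Y n)) = \<kappa> * p n" using pm I.card_Y I.n_pos by simp
          moreover have "real (m n) / real (card (Z n)) = p n" using I.density_def unfolding eq by simp
          moreover have "(3 + \<kappa>) * p n \<le> (3 + \<kappa>) * \<delta>" using True \<kappa> by (intro mult_left_mono) auto
          ultimately have small: "2 * I.density + I.m / card (Y n) + I.m / card (Z n) \<le> 1 / 500"
            unfolding eq using \<delta>(3) by (simp add: algebra_simps)
          have em: "exp (ln (real (m n))) = real (m n)" using mpos by simp
          have "exp (ln (real (m n))) \<le> exp (L n)" using tr(5)[OF elim(1)] elim(4) by simp
          then have me: "real (m n) \<le> exp (L n)" unfolding em .
          have "exp (- t n) = exp (ln (real (m n))) * exp (- L n)"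
            using tr(5)[OF elim(1)] by (simp flip: exp_add)
          then have et: "exp (- t n) = real (m n) * exp (- L n)" unfolding em .
          have "?U \<le> 2 * (I.m * exp (- L n) + 2 * exp (- L n / 3) + I.m * exp (- (I.m / 72)) + I.m * (4 / 7) ^ I.m) * I.\<N>"
            by (rule I.card_unmatchable_le_sparse[OF I.sub I.card_AB I.degrees small])
              (use I.L_eq me elim(2) in \<open>simp_all add: eq\<close>)
          also have "\<dots> = b1 n * I.\<N>" by (simp add: b1_def eq et powr_realpow)
          also have "\<dots> \<le> (b1 n + b2 n) * I.\<N>" using nonneg by (intro mult_right_mono) auto
          finally show ?thesis .
        next
          case False
          \<comment> \<open>In the dense case m is between two constant multiples of n, so every
            bound in m can be replaced by one in n alone.\<close>
          have lo: "\<kappa> * \<delta> * real n \<le> real (m n)"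
            unfolding pm using False \<kappa> by (intro mult_right_mono mult_left_mono) auto
          have hi: "real (m n) \<le> real n" using I.m_le_n eq by simp
          have "\<nu> * (\<kappa> * \<delta> * real n) \<le> \<nu> * real (m n)" using lo \<nu> by (intro mult_left_mono) auto
          then have vm: "2 \<le> \<nu> * real I.m" using elim(3) unfolding eq by linarith
          have "?U \<le> (2 * real I.m * exp (- \<delta> * real I.m / 4)
              + exp (real I.m * ln 4 + real (card (Z n)) * ln (real (card (Y n)) + 1) - \<delta> * \<nu>\<^sup>2 * (real I.m)\<^sup>2 / 4)) * I.\<N>"
            by (rule I.card_unmatchable_le_dense_exp[OF I.sub I.card_AB I.degrees I.ne(1,2) \<delta>(1) _ \<nu> vm])
              (use False eq in simp)
          also have "\<dots> \<le> b2 n * I.\<N>"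
          proof (rule mult_right_mono)
            have sq: "\<delta> * \<nu>\<^sup>2 * (\<kappa> * \<delta> * real n)\<^sup>2 \<le> \<delta> * \<nu>\<^sup>2 * (real (m n))\<^sup>2"
              using lo \<delta> \<nu> \<kappa> by (intro mult_left_mono power_mono) auto
            have ln4: "real (m n) * ln 4 \<le> real n * ln 4" using hi by (intro mult_right_mono) auto
            have Zn: "real (card (Z n)) * ln (real (card (Y n)) + 1) = \<kappa> * real n * ln (real n + 1)"
              using I.real_card_Z I.card_Y by (simp add: \<kappa>_def)
            have "exp (real I.m * ln 4 + real (card (Z n)) * ln (real (card (Y n)) + 1) - \<delta> * \<nu>\<^sup>2 * (real I.m)\<^sup>2 / 4)
                \<le> exp (real n * ln 4 + \<kappa> * real n * ln (real n + 1) - \<delta> * \<nu>\<^sup>2 * (\<kappa> * \<delta> * real n)\<^sup>2 / 4)"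
              unfolding exp_le_cancel_iff eq Zn using sq ln4 by linarith
            moreover have "2 * real I.m * exp (- \<delta> * real I.m / 4) \<le> 2 * real n * exp (- \<delta> * (\<kappa> * \<delta> * real n) / 4)"
              unfolding eq using hi lo \<delta> by (intro mult_mono) auto
            ultimately show "2 * real I.m * exp (- \<delta> * real I.m / 4)
              + exp (real I.m * ln 4 + real (card (Z n)) * ln (real (card (Y n)) + 1) - \<delta> * \<nu>\<^sup>2 * (real I.m)\<^sup>2 / 4) \<le> b2 n"
              unfolding b2_def by (rule add_mono[rotated])
          qed simp
          also have "\<dots> \<le> (b1 n + b2 n) * I.\<N>" using nonneg by (intro mult_right_mono) auto
          finally show ?thesis .
        qed
        moreover have "?prob n {G. \<not> ?PM n G} = ?U / I.\<N>"
          by (rule I.prob(2)) (use I.N_pos in simp)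
        ultimately show ?case using I.N_pos by (simp only: divide_le_eq if_True)
      qed
    qed
  qed

  show ?thesis
    using rare below above unfolding F_def t_def[abs_def] L_def \<kappa>_def by blast
qed

end
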